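(* Let $\mu\ge1$ and $\alpha>0$. If $$\max_{(R_p,R_c)\in\mathcal{R}_{part,out}^{\alpha}}\mu R_p+R_c=\max_{(R_p,R_c)\in\mathcal{C}_{BC}^{\alpha}}\mu R_p+R_c,$$ then $$\max_{(R_p,R_c)\in\mathcal{R}_{part,out}^{\alpha}}\mu R_p+R_c=\inf_{\Sigma_z}\max_{(R_p,R_c)\in\mathcal{R}_{out}^{\alpha,\Sigma_z}}\mu R_p+R_c,$$ the infimum being over admissible $\Sigma_z$.
   Context: Fixed complex matrices $H_{p,p}\in\mathbb{C}^{n_{p,r}\times n_{p,t}}$, $H_{c,p}\in\mathbb{C}^{n_{p,r}\times n_{c,t}}$, $H_{c,c}\in\mathbb{C}^{n_{c,r}\times n_{c,t}}$, powers $P_p,P_c>0$. For $\alpha>0$ let $G_\alpha=[H_{p,p}\ \ H_{c,p}/\sqrt\alpha]$, $K=[0\ \ H_{c,c}/\sqrt\alpha]$ (the zero block of size $n_{c,r}\times n_{p,t}$), and $\overline K=\begin{pmatrix}H_{p,p}&H_{c,p}/\sqrt\alpha\\0&H_{c,c}/\sqrt\alpha\end{pmatrix}$. $A^\dagger$ is conjugate transpose, $|\cdot|$ determinant. An admissible $\Sigma_z$ is a positive definite matrix of the form $\begin{pmatrix}I_{n_{p,r}}&Q_z\\Q_z^\dagger&I_{n_{c,r}}\end{pmatrix}$. $\mathcal{R}_{out}^{\alpha,\Sigma_z}$ is the closure of the convex hull of the set of $(R_p,R_c)$, $R_p,R_c\ge0$, for which there exist $Q_p,Q_c\succeq0$ (size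 $n_{p,t}+n_{c,t}$) with $\mathrm{Tr}(Q_p)+\mathrm{Tr}(Q_c)\le P_p+\alpha P_c$, $R_p\le\log|I+G_\alpha(Q_p+Q_c)G_\alpha^\dagger|-\log|I+G_\alpha Q_cG_\alpha^\dagger|$, $R_c\le\log|\Sigma_z+\overline KQ_c\overline K^\dagger|-\log|\Sigma_z|$. $\mathcal{R}_{part,out}^{\alpha}$ is the closure of the convex hull of the set of $(R_p,R_c)$, $R_p,R_c\ge0$, for which there exist $Q_p\succeq0$ (size $n_{p,t}+n_{c,t}$) and $\Sigma_{c,c}\succeq0$ (size $n_{c,t}$) with $\mathrm{Tr}(Q_p)+\mathrm{Tr}(\Sigma_{c,c})\le P_p+\alpha P_c$, $R_p\le\log|I+G_\alpha Q_pG_\alpha^\dagger+\tfrac1\alpha H_{c,p}\Sigma_{c,c}H_{c,p}^\dagger|-\log|I+\tfrac1\alpha H_{c,p}\Sigma_{c,c}H_{c,p}^\dagger|$, $R_c\le\log|I+\tfrac1\alpha H_{c,c}\Sigma_{c,c}H_{c,c}^\dagger|$. $\mathcal{C}_{BC}^{\alpha}$ is the capacity region of the two-user Gaussian MIMO broadcast channel with input $X(i)\in\mathbb{C}^{n_{p,t}+n_{c,t}}$, outputs $Y_1(i)=G_\alpha X(i)+Z_1(i)$, $Y_2(i)=KX(i)+Z_2(i)$ with $Z_1,Z_2$ i.i.d. $\mathcal{N}(0,I)$ noise, and power constraint $\sum_{i=1}^n\mathrm{Tr}(\mathrm{Cov}(X(i)))\le n(P_p+\alpha P_c)$ (user 1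 has rate $R_p$, user 2 rate $R_c$). *)

theory Defs
  imports "HOL-Probability.Probability"
begin

definition ctrans :: "complex^'m^'n \<Rightarrow> complex^'n^'m" where
  "ctrans A = (\<chi> i j. cnj (A $ j $ i))"

definition cquad :: "complex^'n^'n \<Rightarrow> complex^'n \<Rightarrow> complex" where
  "cquad A x = (\<Sum>i\<in>UNIV. \<Sum>j\<in>UNIV. cnj (x $ i) * A $ i $ j * x $ j)"

definition psd :: "complex^'n^'n \<Rightarrow> bool" where
  "psd A \<longleftrightarrow> (\<forall>x. Im (cquad A x) = 0 \<and> 0 \<le> Re (cquad A x))"

definition pdef :: "complex^'n^'n \<Rightarrow> bool" where
  "pdef A \<longleftrightarrow> (\<forall>x. x \<noteq> 0 \<longrightarrow> Im (cquad A x) = 0 \<and> 0 < Re (cquad A x))"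

text \<open>log of the determinant (natural logarithm; determinants occurring are real positive).\<close>
definition logdet :: "complex^'n^'n \<Rightarrow> real" where
  "logdet A = ln (Re (det A))"

definition brow :: "complex^'a^'m \<Rightarrow> complex^'b^'m \<Rightarrow> complex^('a+'b)^'m" where
  "brow A B = (\<chi> i k. case k of Inl j \<Rightarrow> A $ i $ j | Inr j \<Rightarrow> B $ i $ j)"

definition bmat :: "complex^'a^'m \<Rightarrow> complex^'b^'m \<Rightarrow> complex^'a^'n \<Rightarrow> complex^'b^'n
                    \<Rightarrow> complex^('a+'b)^('m+'n)" where
  "bmat A B C D = (\<chi> r k. case r of Inl i \<Rightarrow> (case k of Inl j \<Rightarrow> A $ i $ j | Inr j \<Rightarrow> B $ i $ j)
                                | Inr i \<Rightarrow> (case k of Inl j \<Rightarrow> C $ i $ j | Inr j \<Rightarrow> D $ i $ j))"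

definition Galpha :: "real \<Rightarrow> complex^'pt::finite^'pr::finite \<Rightarrow> complex^'ct^'pr \<Rightarrow> complex^('pt+'ct)^'pr" where
  "Galpha \<alpha> Hpp Hcp = brow Hpp ((1 / sqrt \<alpha>) *\<^sub>R Hcp)"

definition Kalpha :: "real \<Rightarrow> complex^'ct::finite^'cr::finite \<Rightarrow> complex^('pt::finite+'ct)^'cr" where
  "Kalpha \<alpha> Hcc = brow (0 :: complex^'pt^'cr) ((1 / sqrt \<alpha>) *\<^sub>R Hcc)"

definition Kbar :: "real \<Rightarrow> complex^'pt::finite^'pr::finite \<Rightarrow> complex^'ct^'pr \<Rightarrow> complex^'ct^'cr
                    \<Rightarrow> complex^('pt+'ct)^('pr+'cr)" where
  "Kbar \<alpha> Hpp Hcp Hcc = bmat Hpp ((1 / sqrt \<alpha>) *\<^sub>R Hcp) 0 ((1 / sqrt \<alpha>) *\<^sub>R Hcc)"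

definition admissible_Sz :: "complex^('pr::finite+'cr::finite)^('pr+'cr) \<Rightarrow> bool" where
  "admissible_Sz S \<longleftrightarrow> pdef S \<and>
     (\<exists>Qz :: complex^'cr^'pr. S = bmat (mat 1) Qz (ctrans Qz) (mat 1))"

definition R_out :: "complex^'pt::finite^'pr::finite \<Rightarrow> complex^'ct^'pr \<Rightarrow> complex^'ct^'cr \<Rightarrow> real \<Rightarrow> real \<Rightarrow> real
                     \<Rightarrow> complex^('pr+'cr)^('pr+'cr) \<Rightarrow> (real \<times> real) set" where
  "R_out Hpp Hcp Hcc Pp Pc \<alpha> Sz = closure (convex hull
     {(Rp, Rc). 0 \<le> Rp \<and> 0 \<le> Rc \<and>
       (\<exists>Qp Qc :: complex^('pt+'ct)^('pt+'ct). psd Qp \<and> psd Qc \<and>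
          Re (trace Qp) + Re (trace Qc) \<le> Pp + \<alpha> * Pc \<and>
          Rp \<le> logdet (mat 1 + Galpha \<alpha> Hpp Hcp ** (Qp + Qc) ** ctrans (Galpha \<alpha> Hpp Hcp))
               - logdet (mat 1 + Galpha \<alpha> Hpp Hcp ** Qc ** ctrans (Galpha \<alpha> Hpp Hcp)) \<and>
          Rc \<le> logdet (Sz + Kbar \<alpha> Hpp Hcp Hcc ** Qc ** ctrans (Kbar \<alpha> Hpp Hcp Hcc))
               - logdet Sz)})"

definition R_part_out :: "complex^'pt::finite^'pr::finite \<Rightarrow> complex^'ct^'pr \<Rightarrow> complex^'ct^'cr \<Rightarrow> real \<Rightarrow> real \<Rightarrow> real
                     \<Rightarrow> (real \<times> real) set" where
  "R_part_out Hpp Hcp Hcc Pp Pc \<alpha> = closure (convex hull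
     {(Rp, Rc). 0 \<le> Rp \<and> 0 \<le> Rc \<and>
       (\<exists>(Qp :: complex^('pt+'ct)^('pt+'ct)) (Scc :: complex^'ct^'ct). psd Qp \<and> psd Scc \<and>
          Re (trace Qp) + Re (trace Scc) \<le> Pp + \<alpha> * Pc \<and>
          Rp \<le> logdet (mat 1 + Galpha \<alpha> Hpp Hcp ** Qp ** ctrans (Galpha \<alpha> Hpp Hcp)
                         + (1 / \<alpha>) *\<^sub>R (Hcp ** Scc ** ctrans Hcp))
               - logdet (mat 1 + (1 / \<alpha>) *\<^sub>R (Hcp ** Scc ** ctrans Hcp)) \<and>
          Rc \<le> logdet (mat 1 + (1 / \<alpha>) *\<^sub>R (Hcc ** Scc ** ctrans Hcc)))})"

text \<open>Circularly symmetric complex Gaussian CN(0,I) on complex^'r.\<close>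
definition cnormal_vec :: "(complex^'r) measure" where
  "cnormal_vec = density lborel (\<lambda>z. ennreal (\<Prod>i\<in>UNIV. exp (- (cmod (z $ i))\<^sup>2) / pi))"

definition chan_out :: "complex^'t^'r \<Rightarrow> (nat \<Rightarrow> complex^'t) \<Rightarrow> nat \<Rightarrow> (nat \<Rightarrow> complex^'r)
                        \<Rightarrow> (nat \<Rightarrow> complex^'r)" where
  "chan_out H x n z = (\<lambda>i\<in>{..<n}. H *v x i + z i)"

definition noise_meas :: "nat \<Rightarrow> ((nat \<Rightarrow> complex^'r1) \<times> (nat \<Rightarrow> complex^'r2)) measure" where
  "noise_meas n = (PiM {..<n} (\<lambda>_. cnormal_vec)) \<Otimes>\<^sub>M (PiM {..<n} (\<lambda>_. cnormal_vec))"

text \<open>Trace of the covariance of the i-th input symbol X(i) = f M1 M2 i, messages uniform.\<close>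
definition tr_cov :: "(nat \<Rightarrow> nat \<Rightarrow> nat \<Rightarrow> complex^'t) \<Rightarrow> nat \<Rightarrow> nat \<Rightarrow> nat \<Rightarrow> real" where
  "tr_cov f M1 M2 i =
     (let mean = (1 / real (M1 * M2)) *\<^sub>R (\<Sum>m1<M1. \<Sum>m2<M2. f m1 m2 i)
      in (1 / real (M1 * M2)) * (\<Sum>m1<M1. \<Sum>m2<M2. (norm (f m1 m2 i - mean))\<^sup>2))"

definition avg_err :: "complex^'t^'r1 \<Rightarrow> complex^'t^'r2 \<Rightarrow> nat \<Rightarrow> nat \<Rightarrow> nat
                       \<Rightarrow> (nat \<Rightarrow> nat \<Rightarrow> nat \<Rightarrow> complex^'t)
                       \<Rightarrow> ((nat \<Rightarrow> complex^'r1) \<Rightarrow> nat) \<Rightarrow> ((nat \<Rightarrow> complex^'r2) \<Rightarrow> nat) \<Rightarrow> real" where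
  "avg_err G K n M1 M2 f g1 g2 =
     (1 / real (M1 * M2)) * (\<Sum>m1<M1. \<Sum>m2<M2.
        measure (noise_meas n)
          {zz \<in> space (noise_meas n :: ((nat \<Rightarrow> complex^'r1) \<times> (nat \<Rightarrow> complex^'r2)) measure).
             g1 (chan_out G (f m1 m2) n (fst zz)) \<noteq> m1 \<or> g2 (chan_out K (f m1 m2) n (snd zz)) \<noteq> m2})"

definition bc_code :: "complex^'t^'r1 \<Rightarrow> complex^'t^'r2 \<Rightarrow> real \<Rightarrow> nat \<Rightarrow> nat \<Rightarrow> nat
                       \<Rightarrow> (nat \<Rightarrow> nat \<Rightarrow> nat \<Rightarrow> complex^'t)
                       \<Rightarrow> ((nat \<Rightarrow> complex^'r1) \<Rightarrow> nat) \<Rightarrow> ((nat \<Rightarrow> complex^'r2) \<Rightarrow> nat) \<Rightarrow> real \<Rightarrow> bool" where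
  "bc_code G K P n M1 M2 f g1 g2 eps \<longleftrightarrow>
     1 \<le> M1 \<and> 1 \<le> M2 \<and>
     g1 \<in> measurable (PiM {..<n} (\<lambda>_. borel)) (count_space UNIV) \<and>
     g2 \<in> measurable (PiM {..<n} (\<lambda>_. borel)) (count_space UNIV) \<and>
     (\<Sum>i<n. tr_cov f M1 M2 i) \<le> real n * P \<and>
     avg_err G K n M1 M2 f g1 g2 \<le> eps"

definition bc_achievable :: "complex^'t^'r1 \<Rightarrow> complex^'t^'r2 \<Rightarrow> real \<Rightarrow> real \<times> real \<Rightarrow> bool" where
  "bc_achievable G K P R \<longleftrightarrow>
     (\<forall>eps>0. \<exists>N. \<forall>n\<ge>N. \<exists>M1 M2 f g1 g2.
        exp (real n * fst R) \<le> real M1 \<and> exp (real n * snd R) \<le> real M2 \<and>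
        bc_code G K P n M1 M2 f g1 g2 eps)"

definition bc_capacity_region :: "complex^'t^'r1 \<Rightarrow> complex^'t^'r2 \<Rightarrow> real \<Rightarrow> (real \<times> real) set" where
  "bc_capacity_region G K P =
     closure {R. 0 \<le> fst R \<and> 0 \<le> snd R \<and> bc_achievable G K P R}"

definition C_BC :: "complex^'pt::finite^'pr::finite \<Rightarrow> complex^'ct^'pr \<Rightarrow> complex^'ct^'cr \<Rightarrow> real \<Rightarrow> real \<Rightarrow> real
                     \<Rightarrow> (real \<times> real) set" where
  "C_BC Hpp Hcp Hcc Pp Pc \<alpha> =
     bc_capacity_region (Galpha \<alpha> Hpp Hcp) (Kalpha \<alpha> Hcc :: complex^('pt+'ct)^'cr) (Pp + \<alpha> * Pc)"

definition wmax :: "real \<Rightarrow> (real \<times> real) set \<Rightarrow> real" where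
  "wmax \<mu> S = (SUP R\<in>S. \<mu> * fst R + snd R)"

end

theory Submission
  imports Defs
begin

text \<open>
  The inequality \<open>\<le>\<close> holds because a covariance supported on the cognitive antennas is a special case and
  discarding an output can only decrease the rate of the second user.

  For \<open>\<ge>\<close>, broadcast--multiple access duality turns the weighted sum rate of either broadcast problem
  into the concave function \<open>(\<mu> - 1) log |N| + log |M|\<close> with \<open>N = I + G\<^sup>\<dagger> S\<^sub>1 G\<close> and \<open>M = N + K\<^sup>\<dagger> S\<^sub>2 K\<close>.
  At a maximiser, the KKT multiplier \<open>\<lambda>\<close> yields the noise correlation \<open>G M\<^sup>-\<^sup>1 K\<^sup>\<dagger> / \<lambda>\<close>, for which
  cooperation of the receivers does not increase the maximum.  Hence the infimum is at most the maximal
  dirty paper weighted sum rate, and it remains to see that this rate is achievable: random Gaussian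
  codes, an encoder that selects a codeword jointly typical with the known interference, threshold
  decoders, and the weak law of large numbers for the likelihood ratios.  Since suprema of unbounded
  sets are meaningless, the capacity region must also be shown to be bounded.
\<close>

section \<open>Hermitian matrices\<close>

text \<open>In the broadcast form the weighted rate is a difference of log determinants and not
  concave in the covariances, so a stationary point would certify nothing. The dual form has weights
  \<open>\<mu> - 1\<close> and \<open>1\<close>, nonnegative as \<open>1 \<le> \<mu>\<close>, and
  its tangent plane at the optimum bounds it globally. Under duality an interference term lowers the
  power of one user and raises that of the other by the same amount, so the total budget is
  preserved. The multiplier may be 0, and the noise covariance built from it may be singular, which
  is not admissible. Therefore it is enlarged by \<open>e > 0\<close>; this costs
  \<open>e * P\<close>, which disappears in the infimum. Coding needs strict slack in power and in
  positive rates. The power slack comes from scaling covariances with \<open>t < 1\<close>, which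
  concavity makes harmless in the limit; a user of rate 0 gets a single message. All quantities that
  encoder and decoders observe are linear images of one standard Gaussian vector per symbol, so that
  fourth moments and Chebyshev's inequality control every likelihood ratio.\<close>

definition cinner :: "complex^'n \<Rightarrow> complex^'n \<Rightarrow> complex" where
  "cinner x y = (\<Sum>i\<in>UNIV. cnj (x $ i) * y $ i)"

lemma cinner_add_left: "cinner (x + y) z = cinner x z + cinner y z"
  and cinner_add_right: "cinner x (y + z) = cinner x y + cinner x z"
  and cinner_diff_right: "cinner x (y - z) = cinner x y - cinner x z"
  and cinner_scale_left: "cinner (c *s x) z = cnj c * cinner x z"
  and cinner_scale_right: "cinner x (c *s z) = c * cinner x z"
  and cinner_scaleR_left: "cinner (r *\<^sub>R x) z = of_real r * cinner x z"
  and cinner_scaleR_right: "cinner x (r *\<^sub>R z) = of_real r * cinner x z"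
  by (simp_all add: cinner_def algebra_simps sum.distrib sum_subtractf sum_distrib_left)
     (simp_all add: scaleR_conv_of_real algebra_simps)

lemma cinner_zero_left [simp]: "cinner 0 y = 0" and cinner_zero_right [simp]: "cinner x 0 = 0"
  by (simp_all add: cinner_def)

lemma cinner_commute: "cinner y x = cnj (cinner x y)"
  by (simp add: cinner_def mult.commute)

lemma cinner_self: "cinner x x = of_real ((norm x)\<^sup>2)"
proof -
  have "(norm x)\<^sup>2 = (\<Sum>i\<in>UNIV. (cmod (x $ i))\<^sup>2)"
    unfolding norm_vec_def L2_set_def by (simp add: sum_nonneg)
  then show ?thesis
    by (simp add: cinner_def complex_norm_square[symmetric] mult.commute)
qed

lemma cinner_self_eq_0 [simp]: "cinner x x = 0 \<longleftrightarrow> x = 0"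
  by (simp add: cinner_self)

lemma cinner_ctrans: "cinner x (A *v y) = cinner (ctrans A *v x) y"
proof -
  have "cinner x (A *v y) = (\<Sum>i\<in>UNIV. \<Sum>j\<in>UNIV. cnj (x $ i) * (A $ i $ j * y $ j))"
    by (simp add: cinner_def matrix_vector_mult_def sum_distrib_left)
  also have "\<dots> = (\<Sum>j\<in>UNIV. \<Sum>i\<in>UNIV. cnj (x $ i) * (A $ i $ j * y $ j))"
    by (rule sum.swap)
  also have "\<dots> = cinner (ctrans A *v x) y"
    by (simp add: cinner_def matrix_vector_mult_def ctrans_def sum_distrib_right sum_distrib_left algebra_simps)
  finally show ?thesis .
qed

lemma cquad_cinner: "cquad A x = cinner x (A *v x)"
  by (simp add: cquad_def cinner_def matrix_vector_mult_def sum_distrib_left algebra_simps)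

lemma ctrans_ctrans [simp]: "ctrans (ctrans A) = A"
  by (simp add: ctrans_def)

lemma ctrans_mul: "ctrans (A ** B) = ctrans B ** ctrans A"
  by (simp add: ctrans_def matrix_matrix_mult_def vec_eq_iff mult.commute)

lemma ctrans_add: "ctrans (A + B) = ctrans A + ctrans B"
  and ctrans_diff: "ctrans (A - B) = ctrans A - ctrans B"
  and ctrans_scaleR: "ctrans (r *\<^sub>R A) = r *\<^sub>R ctrans A"
  by (simp_all add: ctrans_def vec_eq_iff)

lemma ctrans_mat_1 [simp]: "ctrans (mat 1) = mat 1"
  by (simp add: ctrans_def mat_def vec_eq_iff)

lemma ctrans_0 [simp]: "ctrans 0 = 0"
  by (simp add: ctrans_def vec_eq_iff)

lemma matrix_scaleR_left: "(r *\<^sub>R A) ** (B::complex^'k^'m) = r *\<^sub>R (A ** B)"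
  and matrix_scaleR_right: "C ** (r *\<^sub>R B) = r *\<^sub>R (C ** (B::complex^'k^'m))"
  by (simp_all add: matrix_matrix_mult_def vec_eq_iff scaleR_sum_right)

lemma matrix_scaleR_vector: "(r *\<^sub>R A) *v (x::complex^'k) = r *\<^sub>R (A *v x)"
  by (simp add: matrix_vector_mult_def vec_eq_iff scaleR_sum_right)

lemma matrix_vector_scaleR: "A *v (r *\<^sub>R (x::complex^'k)) = r *\<^sub>R (A *v x)"
  by (simp add: matrix_vector_mult_def vec_eq_iff scaleR_sum_right)

lemma matrix_diff_ldistrib: "A ** (B - C) = A ** B - A ** (C::complex^'k^'m)"
  and matrix_diff_rdistrib: "(D - E) ** B = D ** B - E ** (B::complex^'k^'m)"
  by (simp_all add: matrix_matrix_mult_def vec_eq_iff algebra_simps sum_subtractf)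

lemma matrix_add_rdistrib: "(D + E) ** B = D ** B + E ** (B::complex^'k^'m)"
  by (simp add: matrix_matrix_mult_def vec_eq_iff algebra_simps sum.distrib)

lemma trace_scaleR: "trace (r *\<^sub>R (A::complex^'n^'n)) = r *\<^sub>R trace A"
  by (simp add: trace_def scaleR_sum_right)

lemma cquad_add: "cquad (A + B) x = cquad A x + cquad B x"
  and cquad_diff: "cquad (A - B) x = cquad A x - cquad B x"
  and cquad_scaleR: "cquad (r *\<^sub>R A) x = of_real r * cquad A x"
  and cquad_mat_1: "cquad (mat 1) x = of_real ((norm x)\<^sup>2)"
  by (simp_all add: cquad_cinner matrix_vector_mult_add_rdistrib matrix_vector_mult_diff_rdistrib
        cinner_add_right cinner_diff_right matrix_scaleR_vector cinner_scaleR_right cinner_self)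

lemma cquad_congr: "cquad (F ** A ** ctrans F) x = cquad A (ctrans F *v x)"
proof -
  have "cquad (F ** A ** ctrans F) x = cinner x (F *v (A *v (ctrans F *v x)))"
    by (simp add: cquad_cinner matrix_vector_mul_assoc matrix_mul_assoc)
  then show ?thesis
    by (simp add: cquad_cinner cinner_ctrans[of x F])
qed

text \<open>Near \<open>t = 0\<close> the linear term dominates the square; the choice
  \<open>t = a / k\<close> with \<open>2 * k + c > 0\<close> exhibits a positive value if
  \<open>a \<noteq> 0\<close>. It serves as the first-order condition for the quadratic form on a
  sphere below.\<close>

lemma quadratic_nonpos_imp_zero:
  fixes a c :: real
  assumes "\<And>t. 2 * t * a + t\<^sup>2 * c \<le> 0"
  shows "a = 0"
proof (rule ccontr)
  assume "a \<noteq> 0"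
  define k where "k = \<bar>c\<bar> + 1"
  have k: "k > 0" "2 * k + c > 0" by (auto simp: k_def)
  have "2 * (a / k) * a + (a / k)\<^sup>2 * c \<le> 0" by (rule assms)
  then have "(a\<^sup>2 / k\<^sup>2) * (2 * k + c) \<le> 0"
    using k(1) by (simp add: field_simps power2_eq_square)
  moreover have "(a\<^sup>2 / k\<^sup>2) * (2 * k + c) > 0"
    using k \<open>a \<noteq> 0\<close> by (intro mult_pos_pos divide_pos_pos) auto
  ultimately show False by simp
qed

text \<open>Eigenvectors are added one at a time, each as a maximiser of the quadratic form on the
  unit sphere of the orthogonal complement of the earlier ones. Indexing by subsets \<open>J\<close>
  of the coordinate type makes \<open>J = UNIV\<close> yield a full basis with no dimension
  count.\<close>

lemma hermitian_eigen_family: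
  fixes A :: "complex^'n^'n" and J :: "'n set"
  assumes A: "ctrans A = A"
  shows "\<exists>v d. (\<forall>i\<in>J. A *v v i = (d i :: real) *\<^sub>R v i) \<and>
               (\<forall>i\<in>J. \<forall>j\<in>J. cinner (v i) (v j) = of_bool (i = j))"
  using finite[of J]
proof (induction J rule: finite_induct)
  case empty
  then show ?case by simp
next
  case (insert j J)
  then obtain v d where ev: "\<And>i. i \<in> J \<Longrightarrow> A *v v i = (d i :: real) *\<^sub>R v i"
    and on: "\<And>i k. i \<in> J \<Longrightarrow> k \<in> J \<Longrightarrow> cinner (v i) (v k) = of_bool (i = k)"
    by blast
  define W where "W = {x. \<forall>i\<in>J. cinner (v i) x = 0}"
  define f where "f x = Re (cinner x (A *v x))" for x
  \<comment> \<open>The rows are the conjugated earlier eigenvectors; row \<open>j\<close>, still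
    free, is zero. Hence \<open>B\<close> is singular, and a kernel vector shows that the complement
    \<open>W\<close> is not trivial.\<close>
  define B where "B = (\<chi> i. if i \<in> J then (\<chi> k. cnj (v i $ k)) else 0)"
  have "row j B = 0" using insert by (simp add: B_def row_def vec_eq_iff)
  then have "det B = 0" by (rule det_zero_row)
  then have "\<not> invertible B" by (simp add: invertible_det_nz)
  then obtain x1 where x1: "x1 \<noteq> 0" "B *v x1 = 0"
    unfolding invertible_left_inverse matrix_left_invertible_ker by auto
  have "cinner (v i) x1 = 0" if "i \<in> J" for i
    using arg_cong[OF x1(2), of "\<lambda>y. y $ i"] that
    by (simp add: B_def cinner_def matrix_vector_mult_def)
  then have x1W: "x1 \<in> W" by (simp add: W_def)
  have cont: "continuous_on UNIV (\<lambda>x. cinner (v i) x)" for i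
    unfolding cinner_def by (intro continuous_intros)
  have "closed W"
    unfolding W_def Collect_ball_eq
    by (intro closed_INT ballI closed_Collect_eq cont continuous_on_const)
  then have "compact (W \<inter> sphere 0 1)" by (simp add: closed_Int_compact)
  moreover have "x1 /\<^sub>R norm x1 \<in> W \<inter> sphere 0 1"
    using x1 x1W by (simp add: W_def cinner_scaleR_right)
  moreover have "continuous_on (W \<inter> sphere 0 1) f"
    unfolding f_def cinner_def matrix_vector_mult_def by (intro continuous_intros)
  ultimately obtain x0 where x0: "x0 \<in> W" "norm x0 = 1"
    and mx: "\<And>y. y \<in> W \<Longrightarrow> norm y = 1 \<Longrightarrow> f y \<le> f x0"
    using continuous_attains_sup[of "W \<inter> sphere 0 1" f] by (metis IntE IntI empty_iff mem_sphere_0)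
  define l where "l = f x0"
  have le: "f y \<le> l * (norm y)\<^sup>2" if "y \<in> W" for y
  proof (cases "y = 0")
    case False
    have "y /\<^sub>R norm y \<in> W" using that by (simp add: W_def cinner_scaleR_right)
    with False have "f (y /\<^sub>R norm y) \<le> l" by (auto simp: l_def intro!: mx)
    moreover have "f (y /\<^sub>R norm y) = f y / (norm y)\<^sup>2"
      by (simp add: f_def matrix_vector_scaleR cinner_scaleR_left cinner_scaleR_right
          power2_eq_square field_simps)
    ultimately have "f y / (norm y)\<^sup>2 \<le> l" by simp
    then show ?thesis using False by (simp add: pos_divide_le_eq)
  qed (simp add: f_def)
  \<comment> \<open>The residual lies in \<open>W\<close>, since \<open>A\<close> preserves
    \<open>W\<close>. Moving the maximiser \<open>x0\<close> along it gives the linear coefficient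
    \<open>(norm r)\<^sup>2\<close>, which must vanish.\<close>
  define r where "r = A *v x0 - l *\<^sub>R x0"
  have "cinner (v i) (A *v x0) = 0" if "i \<in> J" for i
    using that x0(1) by (simp add: cinner_ctrans A ev cinner_scaleR_left W_def)
  then have rW: "r \<in> W" using x0(1) by (simp add: r_def W_def cinner_diff_right cinner_scaleR_right)
  have "2 * t * (norm r)\<^sup>2 + t\<^sup>2 * (f r - l * (norm r)\<^sup>2) \<le> 0" for t
  proof -
    have "x0 + t *\<^sub>R r \<in> W"
      using rW x0(1) by (simp add: W_def cinner_add_right cinner_scaleR_right)
    from le[OF this] have e1: "f (x0 + t *\<^sub>R r) - l * (norm (x0 + t *\<^sub>R r))\<^sup>2 \<le> 0" by simp
    have e2: "f (x0 + t *\<^sub>R r) = f x0 + 2 * t * Re (cinner r (A *v x0)) + t\<^sup>2 * f r"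
    proof -
      have "Re (cinner x0 (A *v r)) = Re (cinner r (A *v x0))"
        by (subst cinner_commute) (simp add: cinner_ctrans A)
      then show ?thesis
        by (simp add: f_def matrix_vector_right_distrib matrix_vector_scaleR cinner_add_left
            cinner_add_right cinner_scaleR_left cinner_scaleR_right power2_eq_square algebra_simps)
    qed
    have e3: "(norm (x0 + t *\<^sub>R r))\<^sup>2 = 1 + 2 * t * Re (cinner r x0) + t\<^sup>2 * (norm r)\<^sup>2"
    proof -
      have "Re (cinner x0 r) = Re (cinner r x0)" by (subst cinner_commute) simp
      then have "Re (cinner (x0 + t *\<^sub>R r) (x0 + t *\<^sub>R r))
          = Re (cinner x0 x0) + 2 * t * Re (cinner r x0) + t\<^sup>2 * Re (cinner r r)"
        by (simp add: cinner_add_left cinner_add_right cinner_scaleR_left cinner_scaleR_right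
            power2_eq_square algebra_simps)
      then show ?thesis using x0(2) by (simp add: cinner_self)
    qed
    have e4: "Re (cinner r (A *v x0)) = (norm r)\<^sup>2 + l * Re (cinner r x0)"
    proof -
      have "(norm r)\<^sup>2 = Re (cinner r r)" by (simp add: cinner_self)
      also have "\<dots> = Re (cinner r (A *v x0 - l *\<^sub>R x0))" by (simp add: r_def)
      finally show ?thesis by (simp add: cinner_diff_right cinner_scaleR_right)
    qed
    show ?thesis using e1 unfolding e2 e3 e4 by (simp add: l_def[symmetric] algebra_simps)
  qed
  then have "(norm r)\<^sup>2 = 0" by (rule quadratic_nonpos_imp_zero)
  then have e0: "A *v x0 = l *\<^sub>R x0" by (simp add: r_def)
  have o1: "cinner (v i) x0 = 0" "cinner x0 (v i) = 0" if "i \<in> J" for i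
    using x0(1) that cinner_commute[of x0 "v i"] by (auto simp: W_def)
  have "cinner x0 x0 = 1" using x0(2) by (simp add: cinner_self)
  then show ?case
    using ev on o1 e0 insert.hyps
    by (intro exI[of _ "v(j := x0)"] exI[of _ "d(j := l)"]) auto
qed

definition diagm :: "('n \<Rightarrow> real) \<Rightarrow> complex^'n^'n" where
  "diagm d = (\<chi> i j. if i = j then of_real (d i) else 0)"

theorem hermitian_spectral:
  fixes A :: "complex^'n^'n"
  assumes "ctrans A = A"
  obtains V :: "complex^'n^'n" and d where "ctrans V ** V = mat 1" "V ** ctrans V = mat 1" "A = V ** diagm d ** ctrans V"
proof -
  obtain v :: "'n \<Rightarrow> complex^'n" and d where ev: "\<And>i. A *v v i = (d i :: real) *\<^sub>R v i"
    and on: "\<And>i k. cinner (v i) (v k) = of_bool (i = k)"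
    using hermitian_eigen_family[OF assms, of UNIV] by blast
  define V where "V = (\<chi> i j. v j $ i)"
  have 1: "ctrans V ** V = mat 1"
    using on by (simp add: vec_eq_iff matrix_matrix_mult_def ctrans_def V_def cinner_def mat_def)
  then have 2: "V ** ctrans V = mat 1" by (simp add: matrix_left_right_inverse)
  have "A ** V = V ** diagm d"
  proof -
    have "(A ** V) $ i $ j = (V ** diagm d) $ i $ j" for i j
    proof -
      have "(A ** V) $ i $ j = (A *v v j) $ i"
        by (simp add: matrix_matrix_mult_def matrix_vector_mult_def V_def)
      also have "\<dots> = of_real (d j) * v j $ i" unfolding ev vector_scaleR_component by (rule scaleR_conv_of_real)
      also have "\<dots> = (V ** diagm d) $ i $ j"
        by (simp add: matrix_matrix_mult_def diagm_def V_def if_distrib cong: if_cong)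
      finally show ?thesis .
    qed
    then show ?thesis by (simp add: vec_eq_iff)
  qed
  then have "A ** V ** ctrans V = V ** diagm d ** ctrans V" by simp
  then have "A = V ** diagm d ** ctrans V" by (simp add: matrix_mul_assoc[symmetric] 2)
  with 1 2 show ?thesis by (rule that)
qed

text \<open>Polarisation with \<open>x + y\<close> and \<open>x + \<i> *s y\<close>. Complex vectors
  are essential, as a real skew-symmetric matrix has zero form on real vectors. Consequence: real
  values of the form already force a matrix to be Hermitian, which is why \<open>psd\<close> does
  not ask for it.\<close>

lemma cquad_eq_0_imp:
  fixes B :: "complex^'n^'n"
  assumes "\<And>x. cquad B x = 0"
  shows "B = 0"
proof -
  have "cinner x (B *v y) = 0" for x y
  proof -
    have 1: "cinner y (B *v x) + cinner x (B *v y) = 0"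
      using assms[of "x + y"] assms[of x] assms[of y]
      by (simp add: cquad_cinner matrix_vector_right_distrib cinner_add_left cinner_add_right)
    have Bi: "B *v (\<i> *s y) = \<i> *s (B *v y)"
      by (simp add: vector_scalar_commute)
    have "\<i> * cinner x (B *v y) - \<i> * cinner y (B *v x) = 0"
      using assms[of "x + \<i> *s y"] assms[of x] assms[of y]
      by (simp add: cquad_cinner matrix_vector_right_distrib cinner_add_left cinner_add_right Bi
          cinner_scale_left cinner_scale_right algebra_simps)
    then have "\<i> * (cinner x (B *v y) - cinner y (B *v x)) = 0" by (simp add: algebra_simps)
    then have "cinner x (B *v y) = cinner y (B *v x)" by simp
    with 1 show ?thesis by simp
  qed
  from this[of "B *v y" y for y] have "B *v y = 0" for y by simp
  then show ?thesis by (subst matrix_eq) simp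
qed

lemma cquad_ctrans: "cquad (ctrans A) x = cnj (cquad A x)"
  using cinner_commute[of "A *v x" x] cinner_ctrans[of x "ctrans A" x]
  by (simp add: cquad_cinner)

lemma psd_hermitian: "psd A \<Longrightarrow> ctrans A = A"
proof -
  assume "psd A"
  then have "cquad (A - ctrans A) x = 0" for x
    by (simp add: cquad_diff cquad_ctrans psd_def complex_eq_iff)
  then show ?thesis using cquad_eq_0_imp[of "A - ctrans A"] by auto
qed

lemma hermitian_cquad_real: "ctrans A = A \<Longrightarrow> Im (cquad A x) = 0"
  using cquad_ctrans[of A x] by (simp add: complex_eq_iff)

lemma psd_iff: "psd A \<longleftrightarrow> ctrans A = A \<and> (\<forall>x. 0 \<le> Re (cquad A x))"
  using psd_hermitian hermitian_cquad_real by (auto simp: psd_def)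

lemma pdef_psd: "pdef A \<Longrightarrow> psd A"
  unfolding pdef_def psd_def by (metis cquad_cinner cinner_zero_left complex.sel order_le_less zero_complex.simps)

lemma psd_add: "psd A \<Longrightarrow> psd B \<Longrightarrow> psd (A + B)"
  by (simp add: psd_def cquad_add)

lemma psd_scaleR: "psd A \<Longrightarrow> 0 \<le> r \<Longrightarrow> psd (r *\<^sub>R A)"
  by (simp add: psd_def cquad_scaleR)

lemma psd_0 [simp]: "psd 0"
  by (simp add: psd_def cquad_cinner)

lemma psd_congr: "psd A \<Longrightarrow> psd (F ** A ** ctrans F)"
  by (simp add: psd_def cquad_congr)

lemma psd_congr': "psd A \<Longrightarrow> psd (ctrans F ** A ** F)"
  using psd_congr[of A "ctrans F"] by simp

lemma pdef_mat_1 [simp]: "pdef (mat 1)"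
  by (simp add: pdef_def cquad_mat_1)

lemma psd_mat_1 [simp]: "psd (mat 1)"
  by (simp add: pdef_psd)

lemma psd_mult_ctrans: "psd (F ** ctrans F)" and psd_ctrans_mult: "psd (ctrans F ** F)"
  using psd_congr[of "mat 1" F] psd_congr'[of "mat 1" F] by simp_all

lemma pdef_add_psd: "pdef A \<Longrightarrow> psd B \<Longrightarrow> pdef (A + B)"
  unfolding pdef_def psd_def by (simp add: cquad_add add_pos_nonneg)

lemma pdef_scaleR: "pdef A \<Longrightarrow> 0 < r \<Longrightarrow> pdef (r *\<^sub>R A)"
  by (simp add: pdef_def cquad_scaleR)

lemma diagm_mul: "diagm d ** diagm e = diagm (\<lambda>i. d i * e i)"
  by (simp add: diagm_def matrix_matrix_mult_def vec_eq_iff mult_delta_left mult_delta_right)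

lemma ctrans_diagm [simp]: "ctrans (diagm d) = diagm d"
  by (auto simp: diagm_def ctrans_def vec_eq_iff)

lemma diagm_1: "diagm (\<lambda>_. 1) = mat 1"
  by (simp add: diagm_def mat_def vec_eq_iff)

lemma diagm_add: "diagm d + diagm e = diagm (\<lambda>i. d i + e i)"
  and diagm_scaleR: "r *\<^sub>R diagm d = diagm (\<lambda>i. r * d i)"
  by (simp_all add: diagm_def vec_eq_iff) (simp_all add: scaleR_conv_of_real)

lemma det_diagm: "det (diagm d) = of_real (\<Prod>i\<in>UNIV. d i)"
  by (subst det_diagonal) (simp_all add: diagm_def)

lemma trace_diagm: "trace (diagm d) = of_real (\<Sum>i\<in>UNIV. d i)"
  by (simp add: trace_def diagm_def)

lemma cquad_diagm: "cquad (diagm d) x = of_real (\<Sum>i\<in>UNIV. d i * (cmod (x $ i))\<^sup>2)"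
proof -
  have "(diagm d *v x) $ i = of_real (d i) * x $ i" for i
    by (simp add: diagm_def matrix_vector_mult_def mult_delta_left)
  then show ?thesis
    by (simp add: cquad_cinner cinner_def complex_norm_square algebra_simps del: of_real_power)
qed

lemma cquad_axis: "cquad A (axis i 1) = A $ i $ i"
proof -
  have "cnj (axis i (1::complex) $ k) = (if k = i then 1 else 0)" for k by (simp add: axis_def)
  moreover have "axis i (1::complex) $ k = (if k = i then 1 else 0)" for k by (simp add: axis_def)
  ultimately show ?thesis by (simp add: cquad_def mult_delta_left mult_delta_right)
qed

lemma psd_diagm_iff: "psd (diagm d) \<longleftrightarrow> (\<forall>i. 0 \<le> d i)"
proof
  assume "psd (diagm d)"
  then have "0 \<le> Re (cquad (diagm d) (axis i 1))" for i by (simp add: psd_def)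
  then show "\<forall>i. 0 \<le> d i" by (simp add: cquad_axis diagm_def)
qed (simp add: psd_def cquad_diagm sum_nonneg)

lemma pdef_diagm_imp: "pdef (diagm d) \<Longrightarrow> 0 < d i"
proof -
  assume "pdef (diagm d)"
  moreover have "axis i (1::complex) \<noteq> 0" by simp
  ultimately have "0 < Re (cquad (diagm d) (axis i 1))" unfolding pdef_def by blast
  then show ?thesis by (simp add: cquad_axis diagm_def)
qed

lemma matrix_inv_unique_left: "A ** B = mat 1 \<Longrightarrow> matrix_inv A = (B::complex^'n^'n)"
proof -
  assume AB: "A ** B = mat 1"
  then have BA: "B ** A = mat 1" by (simp add: matrix_left_right_inverse)
  have "A ** matrix_inv A = mat 1 \<and> matrix_inv A ** A = mat 1"
    unfolding matrix_inv_def by (rule someI[of _ B]) (simp add: AB BA)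
  then show ?thesis by (metis BA matrix_mul_assoc matrix_mul_lid matrix_mul_rid)
qed

lemma matrix_inv_mul:
  fixes A :: "complex^'n^'n"
  assumes "invertible A"
  shows "A ** matrix_inv A = mat 1" and "matrix_inv A ** A = mat 1"
proof -
  obtain B where B: "A ** B = mat 1" "B ** A = mat 1" using assms invertible_def by blast
  then show "A ** matrix_inv A = mat 1" "matrix_inv A ** A = mat 1"
    using matrix_inv_unique_left[OF B(1)] by simp_all
qed

lemma psd_spectral:
  fixes A :: "complex^'n^'n"
  assumes "psd A"
  obtains V :: "complex^'n^'n" and d where "ctrans V ** V = mat 1" "V ** ctrans V = mat 1" "A = V ** diagm d ** ctrans V"
    "\<And>i. 0 \<le> d i"
proof -
  obtain V :: "complex^'n^'n" and d where V: "ctrans V ** V = mat 1" "V ** ctrans V = mat 1" "A = V ** diagm d ** ctrans V"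
    by (rule hermitian_spectral[OF psd_hermitian[OF assms]])
  have "ctrans V ** A ** V = (ctrans V ** V) ** diagm d ** (ctrans V ** V)"
    by (simp add: V(3) matrix_mul_assoc)
  then have "psd (diagm d)" using psd_congr'[OF assms, of V] by (simp add: V(1))
  then show ?thesis using V that psd_diagm_iff by blast
qed

lemma psd_factor:
  fixes A :: "complex^'n^'n"
  assumes "psd A"
  obtains B :: "complex^'n^'n" where "A = B ** ctrans B"
proof -
  obtain V :: "complex^'n^'n" and d where V: "ctrans V ** V = mat 1" "A = V ** diagm d ** ctrans V" "\<And>i. 0 \<le> d i"
    using psd_spectral[OF assms] by metis
  define B where "B = V ** diagm (\<lambda>i. sqrt (d i))"
  have "diagm d = diagm (\<lambda>i. sqrt (d i)) ** diagm (\<lambda>i. sqrt (d i))"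
    using V(3) by (simp add: diagm_mul)
  then have "A = B ** ctrans B"
    by (simp add: V(2) B_def ctrans_mul matrix_mul_assoc)
  then show ?thesis using that by blast
qed

lemma pdef_factor:
  fixes A :: "complex^'n^'n"
  assumes "pdef A"
  obtains T :: "complex^'n^'n" where "A = ctrans T ** T" "invertible T"
proof -
  obtain B :: "complex^'n^'n" where B: "A = B ** ctrans B" by (rule psd_factor[OF pdef_psd[OF assms]])
  have "invertible (ctrans B)"
    unfolding invertible_left_inverse matrix_left_invertible_ker
  proof (intro allI impI, rule ccontr)
    fix x assume x: "ctrans B *v x = 0" "x \<noteq> 0"
    have "A *v x = B *v (ctrans B *v x)" by (simp add: B matrix_vector_mul_assoc)
    then have "cquad A x = 0" by (simp add: cquad_cinner x)
    then show False using assms x(2) by (auto simp: pdef_def)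
  qed
  then show ?thesis using that[of "ctrans B"] B by simp
qed

lemma pdef_invertible: "pdef A \<Longrightarrow> invertible A"
proof -
  assume A: "pdef A"
  show ?thesis
    unfolding invertible_left_inverse matrix_left_invertible_ker
  proof (intro allI impI, rule ccontr)
    fix x assume "A *v x = 0" "x \<noteq> 0"
    then show False using A by (auto simp: pdef_def cquad_cinner)
  qed
qed

lemma pdef_congr:
  fixes A T :: "complex^'n^'n"
  assumes "pdef A" "invertible T" shows "pdef (ctrans T ** A ** T)"
proof -
  have "T *v x \<noteq> 0" if "x \<noteq> 0" for x
    using assms(2) that unfolding invertible_left_inverse matrix_left_invertible_ker by blast
  moreover have "cquad (ctrans T ** A ** T) x = cquad A (T *v x)" for x
    using cquad_congr[of "ctrans T" A x] by simp
  ultimately show ?thesis using assms(1) by (simp add: pdef_def)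
qed

lemma hermitian_matrix_inv:
  assumes "invertible A" "ctrans A = A" shows "ctrans (matrix_inv A) = matrix_inv A"
proof -
  have "ctrans (matrix_inv A ** A) = mat 1" using matrix_inv_mul(2)[OF assms(1)] by simp
  then have "A ** ctrans (matrix_inv A) = mat 1" by (simp add: ctrans_mul assms(2))
  then show ?thesis using matrix_inv_unique_left by metis
qed

lemma pdef_matrix_inv: "pdef A \<Longrightarrow> pdef (matrix_inv A)"
proof -
  assume A: "pdef A"
  have i: "invertible A" using A by (rule pdef_invertible)
  have h: "ctrans (matrix_inv A) = matrix_inv A"
    using hermitian_matrix_inv i psd_hermitian pdef_psd A by blast
  have inv: "invertible (matrix_inv A)"
    using matrix_inv_mul[OF i] invertible_def by blast
  have "matrix_inv A = ctrans (matrix_inv A) ** A ** matrix_inv A"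
    by (simp add: h matrix_inv_mul[OF i])
  then show ?thesis using pdef_congr[OF A inv] by simp
qed

lemma det_ctrans: "det (ctrans A) = cnj (det A)"
proof -
  have "ctrans A = transpose (\<chi> i j. cnj (A $ i $ j))"
    by (simp add: ctrans_def transpose_def vec_eq_iff)
  then have "det (ctrans A) = det (\<chi> i j. cnj (A $ i $ j))" by simp
  also have "\<dots> = cnj (det A)" by (simp add: det_def)
  finally show ?thesis .
qed

text \<open>Whiten \<open>M\<close> by a factor \<open>S\<close>, then diagonalise what
  \<open>D\<close> has become by a unitary \<open>V\<close>, which leaves the whitened
  \<open>M\<close> alone. In these coordinates log determinants become sums of scalar
  logarithms.\<close>

lemma simultaneous_diagonalization:
  fixes M D :: "complex^'n^'n"
  assumes "pdef M" "ctrans D = D"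
  obtains T :: "complex^'n^'n" and d where "invertible T" "M = ctrans T ** T" "D = ctrans T ** diagm d ** T"
proof -
  obtain S :: "complex^'n^'n" where S: "M = ctrans S ** S" "invertible S" by (rule pdef_factor[OF assms(1)])
  define R where "R = matrix_inv S"
  have R: "S ** R = mat 1" "R ** S = mat 1" using matrix_inv_mul[OF S(2)] by (simp_all add: R_def)
  have R': "ctrans S ** ctrans R = mat 1" using R(2) by (metis ctrans_mul ctrans_mat_1)
  have "ctrans (ctrans R ** D ** R) = ctrans R ** D ** R"
    by (simp add: ctrans_mul assms(2) matrix_mul_assoc)
  then obtain V :: "complex^'n^'n" and d where V: "ctrans V ** V = mat 1" "V ** ctrans V = mat 1"
    "ctrans R ** D ** R = V ** diagm d ** ctrans V" by (rule hermitian_spectral)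
  define T where "T = ctrans V ** S"
  have "ctrans S ** (ctrans R ** D ** R) ** S = (ctrans S ** ctrans R) ** D ** (R ** S)"
    by (simp add: matrix_mul_assoc)
  then have "D = ctrans T ** diagm d ** T" unfolding V(3)
    by (simp add: R R' T_def ctrans_mul matrix_mul_assoc)
  moreover have "ctrans T ** T = ctrans S ** (V ** ctrans V) ** S"
    by (simp add: T_def ctrans_mul matrix_mul_assoc)
  moreover have "invertible T" unfolding T_def
    by (rule invertible_mult) (use V S in \<open>auto simp: invertible_def\<close>)
  ultimately show ?thesis using that[of T d] S V(2) by simp
qed

lemma det_congr: "Re (det (ctrans T ** diagm d ** T)) = (cmod (det T))\<^sup>2 * (\<Prod>i\<in>UNIV. d i)"
proof -
  have "det (ctrans T ** diagm d ** T) = cnj (det T) * det T * of_real (\<Prod>i\<in>UNIV. d i)"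
    by (simp add: det_mul det_ctrans det_diagm algebra_simps)
  also have "cnj (det T) * det T = of_real ((cmod (det T))\<^sup>2)"
    by (simp only: complex_norm_square mult.commute)
  finally show ?thesis by (simp only: Re_complex_of_real of_real_mult[symmetric])
qed

lemma trace_inv_congr:
  fixes T :: "complex^'n^'n"
  assumes "invertible T"
  shows "Re (trace (matrix_inv (ctrans T ** T) ** (ctrans T ** diagm d ** T))) = (\<Sum>i\<in>UNIV. d i)"
proof -
  define R where "R = matrix_inv T"
  have R: "T ** R = mat 1" "R ** T = mat 1" using matrix_inv_mul[OF assms] by (simp_all add: R_def)
  have R': "ctrans T ** ctrans R = mat 1" "ctrans R ** ctrans T = mat 1"
    using R by (metis ctrans_mul ctrans_mat_1)+
  have "ctrans T ** T ** (R ** ctrans R) = ctrans T ** (T ** R) ** ctrans R"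
    by (simp add: matrix_mul_assoc)
  then have "matrix_inv (ctrans T ** T) = R ** ctrans R"
    by (intro matrix_inv_unique_left) (simp add: R R')
  moreover have "R ** ctrans R ** (ctrans T ** diagm d ** T) = R ** (ctrans R ** ctrans T) ** diagm d ** T"
    by (simp add: matrix_mul_assoc)
  ultimately have "trace (matrix_inv (ctrans T ** T) ** (ctrans T ** diagm d ** T)) = trace (R ** (diagm d ** T))"
    by (simp add: R' matrix_mul_assoc)
  also have "\<dots> = trace (diagm d ** (T ** R))" by (subst trace_mul_sym) (simp add: matrix_mul_assoc)
  finally show ?thesis by (simp add: R trace_diagm)
qed

section \<open>Concavity and differentiation of the log determinant\<close>

lemma pdef_det_pos:
  fixes A :: "complex^'n^'n"
  shows "pdef A \<Longrightarrow> 0 < Re (det A)"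
proof -
  assume A: "pdef A"
  obtain T :: "complex^'n^'n" where T: "A = ctrans T ** T" "invertible T" by (rule pdef_factor[OF A])
  have "A = ctrans T ** diagm (\<lambda>_. 1) ** T" by (simp add: T diagm_1)
  then show ?thesis using T(2) det_congr[of T "\<lambda>_. 1"] by (simp add: invertible_det_nz)
qed

lemma pdef_diag_coeffs:
  fixes T :: "complex^'n^'n"
  assumes "pdef (ctrans T ** diagm d ** T)" "invertible T"
  shows "0 < d i"
proof -
  define R where "R = matrix_inv T"
  have R: "T ** R = mat 1" "R ** T = mat 1" using matrix_inv_mul[OF assms(2)] by (simp_all add: R_def)
  then have "invertible R" using invertible_def by blast
  from pdef_congr[OF assms(1) this]
  have "pdef (ctrans (T ** R) ** diagm d ** (T ** R))" by (simp add: ctrans_mul matrix_mul_assoc)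
  then show ?thesis using R pdef_diagm_imp by simp
qed

text \<open>Concavity of \<open>logdet\<close> as a supporting hyperplane at \<open>Y\<close>: in
  coordinates where \<open>Y\<close> is the identity and \<open>X\<close> diagonal, it is
  \<open>ln d \<le> d - 1\<close> summed over the diagonal.\<close>

theorem logdet_tangent:
  fixes X Y :: "complex^'n^'n"
  assumes X: "pdef X" and Y: "pdef Y"
  shows "logdet X \<le> logdet Y + Re (trace (matrix_inv Y ** (X - Y)))"
proof -
  obtain T :: "complex^'n^'n" and d where T: "invertible T" "Y = ctrans T ** T" "X = ctrans T ** diagm d ** T"
    by (rule simultaneous_diagonalization[OF Y psd_hermitian[OF pdef_psd[OF X]]])
  have d: "0 < d i" for i using pdef_diag_coeffs X T by blast
  have cT: "0 < (cmod (det T))\<^sup>2" using T(1) by (simp add: invertible_det_nz)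
  have "logdet X = ln ((cmod (det T))\<^sup>2) + (\<Sum>i\<in>UNIV. ln (d i))"
  proof -
    have "(\<Prod>i\<in>UNIV. d i) > 0" by (simp add: prod_pos d)
    then have "ln ((cmod (det T))\<^sup>2 * (\<Prod>i\<in>UNIV. d i)) = ln ((cmod (det T))\<^sup>2) + ln (\<Prod>i\<in>UNIV. d i)"
      using cT by (intro ln_mult_pos)
    moreover have "ln (\<Prod>i\<in>UNIV. d i) = (\<Sum>i\<in>UNIV. ln (d i))" by (rule ln_prod) (use d in \<open>simp_all add: less_imp_neq[THEN not_sym]\<close>)
    ultimately show ?thesis unfolding logdet_def T(3) det_congr by simp
  qed
  moreover have "logdet Y = ln ((cmod (det T))\<^sup>2)"
    unfolding logdet_def T(2) using det_congr[of T "\<lambda>_. 1"] by (simp add: diagm_1)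
  moreover have "Re (trace (matrix_inv Y ** (X - Y))) = (\<Sum>i\<in>UNIV. d i - 1)"
  proof -
    have "X - Y = ctrans T ** diagm (\<lambda>i. d i - 1) ** T"
    proof -
      have "diagm (\<lambda>i. d i - 1) = diagm d - mat 1" by (simp add: diagm_def mat_def vec_eq_iff)
      then show ?thesis by (simp add: T matrix_diff_ldistrib matrix_diff_rdistrib)
    qed
    then show ?thesis using trace_inv_congr[OF T(1)] T(2) by simp
  qed
  moreover have "(\<Sum>i\<in>UNIV. ln (d i)) \<le> (\<Sum>i\<in>UNIV. d i - 1)"
    by (intro sum_mono ln_le_minus_one d)
  ultimately show ?thesis by simp
qed

text \<open>In common coordinates \<open>logdet (M + t *\<^sub>R D)\<close> is a constant plus the
  sum of \<open>ln (1 + t * d i)\<close>, whose derivative at 0 is the sum of the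
  \<open>d i\<close>.\<close>

theorem logdet_line_derivative:
  fixes M D :: "complex^'n^'n"
  assumes M: "pdef M" and D: "ctrans D = D"
  shows "((\<lambda>t. logdet (M + t *\<^sub>R D)) has_real_derivative Re (trace (matrix_inv M ** D))) (at 0)"
proof -
  obtain T :: "complex^'n^'n" and d where T: "invertible T" "M = ctrans T ** T" "D = ctrans T ** diagm d ** T"
    by (rule simultaneous_diagonalization[OF M D])
  have cT: "0 < (cmod (det T))\<^sup>2" using T(1) by (simp add: invertible_det_nz)
  have eq: "M + t *\<^sub>R D = ctrans T ** diagm (\<lambda>i. 1 + t * d i) ** T" for t
  proof -
    have "diagm (\<lambda>i. 1 + t * d i) = mat 1 + t *\<^sub>R diagm d"
      by (simp add: diagm_1[symmetric] diagm_scaleR diagm_add)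
    then show ?thesis
      by (simp add: T matrix_add_ldistrib matrix_add_rdistrib matrix_scaleR_left matrix_scaleR_right)
  qed
  \<comment> \<open>\<open>D\<close> may be indefinite, so all factors are positive only for
    \<open>t\<close> near 0, which is all that a derivative sees.\<close>
  have "\<forall>\<^sub>F t in nhds (0::real). \<forall>i\<in>UNIV. 0 < 1 + t * d i"
    by (intro eventually_ball_finite ballI order_tendstoD[where y = 1])
       (auto intro!: tendsto_eq_intros filterlim_ident)
  then have "\<forall>\<^sub>F t in nhds (0::real). logdet (M + t *\<^sub>R D) = ln ((cmod (det T))\<^sup>2) + (\<Sum>i\<in>UNIV. ln (1 + t * d i))"
  proof eventually_elim
    case (elim t)
    have "(\<Prod>i\<in>UNIV. 1 + t * d i) > 0" using elim by (simp add: prod_pos)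
    then have "ln ((cmod (det T))\<^sup>2 * (\<Prod>i\<in>UNIV. 1 + t * d i)) = ln ((cmod (det T))\<^sup>2) + ln (\<Prod>i\<in>UNIV. 1 + t * d i)"
      using cT by (intro ln_mult_pos)
    moreover have "ln (\<Prod>i\<in>UNIV. 1 + t * d i) = (\<Sum>i\<in>UNIV. ln (1 + t * d i))"
      by (rule ln_prod) (use elim in \<open>simp_all add: less_imp_neq[THEN not_sym]\<close>)
    ultimately show ?case unfolding logdet_def eq det_congr by simp
  qed
  moreover have "((\<lambda>t. ln ((cmod (det T))\<^sup>2) + (\<Sum>i\<in>UNIV. ln (1 + t * d i)))
      has_real_derivative (\<Sum>i\<in>UNIV. d i)) (at 0)"
    by (auto intro!: derivative_eq_intros)
  ultimately have "((\<lambda>t. logdet (M + t *\<^sub>R D)) has_real_derivative (\<Sum>i\<in>UNIV. d i)) (at 0)"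
    by (subst DERIV_cong_ev[OF refl _ refl]) auto
  then show ?thesis using trace_inv_congr[OF T(1)] T(2,3) by simp
qed

lemma psd_trace_nonneg: "psd A \<Longrightarrow> 0 \<le> Re (trace A)"
proof -
  assume "psd A"
  then have "0 \<le> Re (cquad A (axis i 1))" for i by (simp add: psd_def)
  then show ?thesis by (simp add: cquad_axis trace_def sum_nonneg)
qed

lemma psd_trace_mult_nonneg:
  fixes A B :: "complex^'n^'n"
  assumes "psd A" "psd B" shows "0 \<le> Re (trace (A ** B))"
proof -
  obtain C :: "complex^'n^'n" where C: "A = C ** ctrans C" by (rule psd_factor[OF assms(1)])
  have "trace (A ** B) = trace (C ** (ctrans C ** B))" by (simp add: C matrix_mul_assoc)
  also have "\<dots> = trace (ctrans C ** B ** C)" by (subst trace_mul_sym) simp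
  finally show ?thesis using psd_trace_nonneg[OF psd_congr'[OF assms(2), of C]] by simp
qed

lemma trace_mono:
  fixes A B Q :: "complex^'n^'n"
  assumes "psd (B - A)" "psd Q" shows "Re (trace (A ** Q)) \<le> Re (trace (B ** Q))"
  using psd_trace_mult_nonneg[OF assms] by (simp add: matrix_diff_rdistrib trace_sub)

text \<open>The tangent at the larger matrix suffices: its linear term is minus the trace of a
  product of two positive semidefinite matrices.\<close>

lemma logdet_mono:
  fixes A B :: "complex^'n^'n"
  assumes "pdef A" "psd (B - A)" shows "logdet A \<le> logdet B"
proof -
  have B: "pdef B" using pdef_add_psd[OF assms] by simp
  have "0 \<le> Re (trace (matrix_inv B ** (B - A)))"
    by (intro psd_trace_mult_nonneg pdef_psd pdef_matrix_inv B assms)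
  moreover have "matrix_inv B ** (A - B) = - (matrix_inv B ** (B - A))"
    by (simp add: matrix_diff_ldistrib)
  ultimately show ?thesis
    using logdet_tangent[OF assms(1) B]
    by (simp add: trace_def sum_negf)
qed

lemma logdet_mat_1 [simp]: "logdet (mat 1) = 0"
  by (simp add: logdet_def)

lemma logdet_congr:
  fixes X T :: "complex^'n^'n"
  assumes "pdef X" "invertible T"
  shows "logdet (ctrans T ** X ** T) = logdet X + ln ((cmod (det T))\<^sup>2)"
proof -
  have "det (ctrans T ** X ** T) = (cnj (det T) * det T) * det X"
    by (simp add: det_mul det_ctrans)
  also have "cnj (det T) * det T = of_real ((cmod (det T))\<^sup>2)"
    by (simp only: complex_norm_square mult.commute)
  finally have "Re (det (ctrans T ** X ** T)) = Re (det X) * (cmod (det T))\<^sup>2"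
    by (simp del: of_real_power)
  moreover have "0 < (cmod (det T))\<^sup>2" using assms(2) by (simp add: invertible_det_nz)
  ultimately show ?thesis
    unfolding logdet_def using pdef_det_pos[OF assms(1)] by (simp only: ln_mult_pos)
qed

lemma logdet_ctrans_mult:
  fixes T :: "complex^'n^'n"
  assumes "invertible T" shows "logdet (ctrans T ** T) = ln ((cmod (det T))\<^sup>2)"
  using logdet_congr[of "mat 1" T] assms by simp

lemma logdet_line_derivative_at:
  fixes D :: "complex^'n^'n"
  assumes D: "psd D" and t: "0 \<le> t0"
  shows "((\<lambda>t. logdet (mat 1 + t *\<^sub>R D)) has_real_derivative
            Re (trace (matrix_inv (mat 1 + t0 *\<^sub>R D) ** D))) (at t0)"
proof -
  have M: "pdef (mat 1 + t0 *\<^sub>R D)" by (intro pdef_add_psd pdef_mat_1 psd_scaleR D t)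
  have "((\<lambda>t. logdet ((mat 1 + t0 *\<^sub>R D) + (t - t0) *\<^sub>R D)) has_real_derivative
            Re (trace (matrix_inv (mat 1 + t0 *\<^sub>R D) ** D)) * 1) (at t0)"
    by (rule DERIV_chain2[where g = "\<lambda>t. t - t0"])
       (auto intro!: logdet_line_derivative M psd_hermitian D derivative_eq_intros)
  moreover have "(mat 1 + t0 *\<^sub>R D) + (t - t0) *\<^sub>R D = mat 1 + t *\<^sub>R D" for t
    by (simp add: algebra_simps)
  ultimately show ?thesis by simp
qed

text \<open>Both sides have the same derivative along \<open>t \<mapsto> I + t F F\<^sup>\<dagger>\<close>, \<open>t \<mapsto> I + t F\<^sup>\<dagger> F\<close>, by the
  push-through identity; this avoids determinants of block matrices.\<close>
theorem logdet_sylvester: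
  fixes F :: "complex^'n^'m"
  shows "logdet (mat 1 + F ** ctrans F) = logdet (mat 1 + ctrans F ** F)"
proof -
  define A where "A t = mat 1 + t *\<^sub>R (F ** ctrans F)" for t :: real
  define B where "B t = mat 1 + t *\<^sub>R (ctrans F ** F)" for t :: real
  define g where "g t = logdet (A t) - logdet (B t)" for t
  have "(g has_real_derivative 0) (at t)" if t: "0 \<le> t" for t
  proof -
    have iA: "invertible (A t)" "invertible (B t)"
      unfolding A_def B_def
      by (intro pdef_invertible pdef_add_psd pdef_mat_1 psd_scaleR psd_mult_ctrans psd_ctrans_mult t)+
    have "A t ** F = F ** B t"
      by (simp add: A_def B_def matrix_add_ldistrib matrix_add_rdistrib matrix_scaleR_left
          matrix_scaleR_right matrix_mul_assoc)
    then have "matrix_inv (A t) ** (A t ** F) ** matrix_inv (B t) =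
               matrix_inv (A t) ** (F ** B t) ** matrix_inv (B t)" by simp
    then have "(matrix_inv (A t) ** A t) ** F ** matrix_inv (B t) =
               matrix_inv (A t) ** F ** (B t ** matrix_inv (B t))" by (simp add: matrix_mul_assoc)
    then have push: "F ** matrix_inv (B t) = matrix_inv (A t) ** F"
      by (simp add: matrix_inv_mul iA)
    have "trace (matrix_inv (A t) ** (F ** ctrans F)) = trace ((F ** matrix_inv (B t)) ** ctrans F)"
      by (simp add: push matrix_mul_assoc)
    also have "\<dots> = trace (ctrans F ** F ** matrix_inv (B t))"
      by (subst trace_mul_sym) (simp add: matrix_mul_assoc)
    also have "\<dots> = trace (matrix_inv (B t) ** (ctrans F ** F))" by (rule trace_mul_sym)
    finally have tr: "trace (matrix_inv (A t) ** (F ** ctrans F)) = trace (matrix_inv (B t) ** (ctrans F ** F))" .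
    have "(g has_real_derivative Re (trace (matrix_inv (A t) ** (F ** ctrans F)))
        - Re (trace (matrix_inv (B t) ** (ctrans F ** F)))) (at t)"
      unfolding g_def A_def B_def
      by (intro DERIV_diff logdet_line_derivative_at psd_mult_ctrans psd_ctrans_mult t)
    then show ?thesis by (simp add: tr)
  qed
  then have "g 1 = g 0"
    by (intro DERIV_isconst2[of 0 1]) (auto intro!: continuous_at_imp_continuous_on DERIV_isCont)
  then show ?thesis by (simp add: g_def A_def B_def)
qed

text \<open>\<open>W\<close> is the partial isometry of the polar decomposition of \<open>F\<close>,
  and \<open>P\<close> the positive part. As the two dimensions may differ, \<open>W\<close> cannot
  be taken unitary; the contraction property is what controls traces later.\<close>

lemma polar_contraction:
  fixes F :: "complex^'t^'r"
  obtains W :: "complex^'t^'r" and P :: "complex^'t^'t"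
  where "ctrans W ** F = P" "ctrans P = P" "P ** P = ctrans F ** F" "psd (mat 1 - ctrans W ** W)"
proof -
  obtain V :: "complex^'t^'t" and d where V: "ctrans V ** V = mat 1" "V ** ctrans V = mat 1"
    "ctrans F ** F = V ** diagm d ** ctrans V" and d: "\<And>i. 0 \<le> d i"
    using psd_spectral[OF psd_ctrans_mult[of F]] by metis
  \<comment> \<open>Pseudo-inverse of the positive part: division by zero is 0, so kernel
    directions, where \<open>d i = 0\<close>, are mapped to 0.\<close>
  define E where "E = V ** diagm (\<lambda>i. 1 / sqrt (d i)) ** ctrans V"
  define W where "W = F ** E"
  define P where "P = V ** diagm (\<lambda>i. sqrt (d i)) ** ctrans V"
  have mulV: "(V ** X ** ctrans V) ** (V ** Y ** ctrans V) = V ** (X ** Y) ** ctrans V" for X Y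
  proof -
    have "(V ** X ** ctrans V) ** (V ** Y ** ctrans V) = V ** X ** (ctrans V ** V) ** Y ** ctrans V"
      by (simp add: matrix_mul_assoc)
    then show ?thesis by (simp add: V(1) matrix_mul_assoc)
  qed
  have hE: "ctrans E = E" and hP: "ctrans P = P"
    by (simp_all add: E_def P_def ctrans_mul matrix_mul_assoc)
  have "ctrans W ** F = E ** (ctrans F ** F)" by (simp add: W_def ctrans_mul hE matrix_mul_assoc)
  also have "\<dots> = P" unfolding V(3) E_def mulV P_def diagm_mul
    using d by (simp add: real_div_sqrt)
  finally have 1: "ctrans W ** F = P" .
  have 2: "P ** P = ctrans F ** F" unfolding V(3) P_def mulV diagm_mul using d by simp
  have "ctrans W ** W = (ctrans W ** F) ** E" by (simp add: W_def matrix_mul_assoc)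
  also have "\<dots> = V ** diagm (\<lambda>i. of_bool (d i \<noteq> 0)) ** ctrans V"
    unfolding 1 P_def E_def mulV diagm_mul by (rule arg_cong[where f = "\<lambda>e. V ** diagm e ** ctrans V"]) auto
  finally have W: "ctrans W ** W = V ** diagm (\<lambda>i. of_bool (d i \<noteq> 0)) ** ctrans V" .
  have "mat 1 - diagm (\<lambda>i. of_bool (d i \<noteq> 0)) = diagm (\<lambda>i. of_bool (d i = 0))"
    by (simp add: diagm_def mat_def vec_eq_iff)
  then have "V ** (mat 1 - diagm (\<lambda>i. of_bool (d i \<noteq> 0))) ** ctrans V = V ** diagm (\<lambda>i. of_bool (d i = 0)) ** ctrans V"
    by simp
  then have "mat 1 - ctrans W ** W = V ** diagm (\<lambda>i. of_bool (d i = 0)) ** ctrans V"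
    unfolding W by (simp add: matrix_diff_ldistrib matrix_diff_rdistrib V(2))
  then have "psd (mat 1 - ctrans W ** W)" by (simp add: psd_congr psd_diagm_iff)
  then show ?thesis using that[OF 1 hP 2] by simp
qed

text \<open>White noise case of the link duality. With \<open>S = W ** Q ** ctrans W\<close> the
  reversed Gram matrix is \<open>P ** Q ** P\<close>; moving the factor of \<open>Q\<close> outside
  by Sylvester's identity replaces \<open>P ** P\<close> by \<open>ctrans F ** F\<close>. The
  contraction \<open>W\<close> does not increase the trace.\<close>

lemma channel_flip:
  fixes F :: "complex^'t^'r" and Q :: "complex^'t^'t"
  assumes "psd Q"
  shows "\<exists>S::complex^'r^'r. psd S \<and> Re (trace S) \<le> Re (trace Q) \<and>
     logdet (mat 1 + ctrans F ** S ** F) = logdet (mat 1 + F ** Q ** ctrans F)"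
proof -
  obtain B :: "complex^'t^'t" where B: "Q = B ** ctrans B" by (rule psd_factor[OF assms])
  obtain W :: "complex^'t^'r" and P :: "complex^'t^'t" where W: "ctrans W ** F = P" "ctrans P = P"
    "P ** P = ctrans F ** F" "psd (mat 1 - ctrans W ** W)" by (rule polar_contraction)
  have W': "ctrans F ** W = P" using W(1,2) by (metis ctrans_ctrans ctrans_mul)
  define S where "S = W ** Q ** ctrans W"
  have "trace S = trace (ctrans W ** W ** Q)"
    unfolding S_def by (subst trace_mul_sym) (simp add: matrix_mul_assoc)
  then have "Re (trace S) \<le> Re (trace Q)" using trace_mono[OF W(4) assms] by simp
  moreover have "logdet (mat 1 + ctrans F ** S ** F) = logdet (mat 1 + F ** Q ** ctrans F)"
  proof -
    have "ctrans F ** S ** F = (ctrans F ** W) ** (B ** ctrans B) ** (ctrans W ** F)"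
      by (simp add: S_def B matrix_mul_assoc)
    also have "\<dots> = (P ** B) ** ctrans (P ** B)"
      unfolding W W' by (simp add: ctrans_mul W(2) matrix_mul_assoc)
    finally have "logdet (mat 1 + ctrans F ** S ** F) = logdet (mat 1 + ctrans (P ** B) ** (P ** B))"
      by (simp add: logdet_sylvester)
    also have "ctrans (P ** B) ** (P ** B) = ctrans B ** (P ** P) ** B"
      by (simp add: ctrans_mul W(2) matrix_mul_assoc)
    also have "\<dots> = ctrans (F ** B) ** (F ** B)" by (simp add: W(3) ctrans_mul matrix_mul_assoc)
    also have "logdet (mat 1 + \<dots>) = logdet (mat 1 + (F ** B) ** ctrans (F ** B))"
      by (simp add: logdet_sylvester)
    finally show ?thesis by (simp add: B ctrans_mul matrix_mul_assoc)
  qed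
  moreover have "psd S" unfolding S_def by (rule psd_congr[OF assms])
  ultimately show ?thesis by blast
qed

text \<open>The single-link form of the duality between broadcast and multiple access channels:
  \<open>Z\<close> is the noise covariance of the forward link, \<open>N\<close> that of the reverse link.\<close>
theorem link_duality:
  fixes H :: "complex^'t^'r" and Z :: "complex^'r^'r" and N Q :: "complex^'t^'t"
  assumes Z: "pdef Z" and N: "pdef N" and Q: "psd Q"
  shows "\<exists>S. psd S \<and> Re (trace (Z ** S)) \<le> Re (trace (N ** Q)) \<and>
     logdet (N + ctrans H ** S ** H) - logdet N = logdet (Z + H ** Q ** ctrans H) - logdet Z"
proof -
  obtain A :: "complex^'r^'r" where A: "Z = ctrans A ** A" "invertible A" by (rule pdef_factor[OF Z])
  obtain C :: "complex^'t^'t" where C: "N = ctrans C ** C" "invertible C" by (rule pdef_factor[OF N])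
  define A' where "A' = matrix_inv A"
  define C' where "C' = matrix_inv C"
  have A': "A ** A' = mat 1" "A' ** A = mat 1" "ctrans A ** ctrans A' = mat 1"
    using matrix_inv_mul[OF A(2)] by (simp_all add: A'_def flip: ctrans_mul)
  have C': "C ** C' = mat 1" "C' ** C = mat 1" "ctrans C ** ctrans C' = mat 1"
    using matrix_inv_mul[OF C(2)] by (simp_all add: C'_def flip: ctrans_mul)
  \<comment> \<open>The channel between whitened signals: the noise \<open>Z\<close> of the forward
    link and the noise \<open>N\<close> of the reverse link both become the identity, which is the
    case of \<open>channel_flip\<close>.\<close>
  define F where "F = ctrans A' ** H ** C'"
  have FC: "F ** C = ctrans A' ** H"
  proof -
    have "F ** C = ctrans A' ** H ** (C' ** C)" by (simp add: F_def matrix_mul_assoc)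
    then show ?thesis by (simp add: C')
  qed
  have AF: "ctrans A ** F = H ** C'"
  proof -
    have "ctrans A ** F = (ctrans A ** ctrans A') ** H ** C'" by (simp add: F_def matrix_mul_assoc)
    then show ?thesis by (simp add: A')
  qed
  have AFC: "ctrans A ** F ** C = H"
  proof -
    have "ctrans A ** F ** C = H ** (C' ** C)" by (simp add: AF matrix_mul_assoc)
    then show ?thesis by (simp add: C')
  qed
  define Q' where "Q' = C ** Q ** ctrans C"
  have Q': "psd Q'" unfolding Q'_def by (rule psd_congr[OF Q])
  have trQ': "trace Q' = trace (N ** Q)"
    unfolding Q'_def C by (subst trace_mul_sym) (simp add: matrix_mul_assoc)
  obtain S' :: "complex^'r^'r" where S': "psd S'" "Re (trace S') \<le> Re (trace Q')"
    "logdet (mat 1 + ctrans F ** S' ** F) = logdet (mat 1 + F ** Q' ** ctrans F)"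
    using channel_flip[OF Q'] by blast
  define S where "S = A' ** S' ** ctrans A'"
  have "trace (Z ** S) = trace (ctrans A ** ((A ** A') ** S' ** ctrans A'))"
    unfolding A S_def by (simp add: matrix_mul_assoc)
  also have "\<dots> = trace (S' ** ctrans A' ** ctrans A)" by (subst trace_mul_sym) (simp add: A')
  also have "S' ** ctrans A' ** ctrans A = S' ** ctrans (A ** A')" by (simp add: ctrans_mul matrix_mul_assoc)
  finally have trS: "trace (Z ** S) = trace S'"
    using A'(2) by (metis A'(1) ctrans_mat_1 matrix_mul_rid)
  have cAFC: "ctrans C ** ctrans F ** A = ctrans H"
    using AFC by (metis ctrans_ctrans ctrans_mul matrix_mul_assoc)
  have "Z + H ** Q ** ctrans H = ctrans A ** (mat 1 + F ** Q' ** ctrans F) ** A"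
  proof -
    have "ctrans A ** (F ** Q' ** ctrans F) ** A = (ctrans A ** F ** C) ** Q ** (ctrans C ** ctrans F ** A)"
      by (simp add: Q'_def matrix_mul_assoc)
    then show ?thesis
      by (simp add: AFC cAFC A(1) matrix_add_ldistrib matrix_add_rdistrib)
  qed
  moreover have "N + ctrans H ** S ** H = ctrans C ** (mat 1 + ctrans F ** S' ** F) ** C"
  proof -
    have "ctrans C ** (ctrans F ** S' ** F) ** C = ctrans (F ** C) ** S' ** (F ** C)"
      by (simp add: ctrans_mul matrix_mul_assoc)
    also have "\<dots> = ctrans H ** S ** H" by (simp add: FC S_def ctrans_mul matrix_mul_assoc)
    finally show ?thesis
      by (simp add: C(1) matrix_add_ldistrib matrix_add_rdistrib)
  qed
  moreover have "pdef (mat 1 + F ** Q' ** ctrans F)" "pdef (mat 1 + ctrans F ** S' ** F)"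
    by (intro pdef_add_psd pdef_mat_1 psd_congr psd_congr' Q' S')+
  ultimately have "logdet (N + ctrans H ** S ** H) - logdet N = logdet (Z + H ** Q ** ctrans H) - logdet Z"
    using A C S'(3) by (simp add: logdet_congr logdet_ctrans_mult)
  moreover have "psd S" unfolding S_def by (rule psd_congr[OF S'(1)])
  ultimately show ?thesis using S'(2) trS trQ' by (intro exI[of _ S]) simp
qed

text \<open>Whiten with the factor of \<open>Z\<close> and change sides by Sylvester's identity. On
  the input side the noise enters through its inverse only, which makes different receivers
  comparable by \<open>logdet_mono\<close>.\<close>

lemma logdet_ratio:
  fixes Z :: "complex^'m^'m" and F :: "complex^'k^'m"
  assumes Z: "pdef Z"
  shows "logdet (Z + F ** ctrans F) - logdet Z = logdet (mat 1 + ctrans F ** matrix_inv Z ** F)"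
proof -
  obtain A :: "complex^'m^'m" where A: "Z = ctrans A ** A" "invertible A" by (rule pdef_factor[OF Z])
  define A' where "A' = matrix_inv A"
  have A': "A ** A' = mat 1" "A' ** A = mat 1" "ctrans A ** ctrans A' = mat 1" "ctrans A' ** ctrans A = mat 1"
    using matrix_inv_mul[OF A(2)] by (simp_all add: A'_def flip: ctrans_mul)
  define X where "X = ctrans A' ** F"
  have AX: "ctrans A ** X = F"
  proof -
    have "ctrans A ** X = (ctrans A ** ctrans A') ** F" by (simp add: X_def matrix_mul_assoc)
    then show ?thesis by (simp add: A')
  qed
  have "Z + F ** ctrans F = ctrans A ** (mat 1 + X ** ctrans X) ** A"
  proof -
    have "ctrans A ** (X ** ctrans X) ** A = (ctrans A ** X) ** ctrans (ctrans A ** X)"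
      by (simp add: ctrans_mul matrix_mul_assoc)
    then show ?thesis by (simp add: AX A(1) matrix_add_ldistrib matrix_add_rdistrib)
  qed
  then have "logdet (Z + F ** ctrans F) - logdet Z = logdet (mat 1 + X ** ctrans X)"
    using A by (simp add: logdet_congr logdet_ctrans_mult pdef_add_psd psd_mult_ctrans)
  also have "\<dots> = logdet (mat 1 + ctrans X ** X)" by (rule logdet_sylvester)
  also have "matrix_inv Z = A' ** ctrans A'"
  proof (rule matrix_inv_unique_left)
    have "Z ** (A' ** ctrans A') = ctrans A ** (A ** A') ** ctrans A'" by (simp add: A matrix_mul_assoc)
    then show "Z ** (A' ** ctrans A') = mat 1" by (simp add: A')
  qed
  then have "ctrans X ** X = ctrans F ** matrix_inv Z ** F" by (simp add: X_def ctrans_mul matrix_mul_assoc)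
  finally show ?thesis .
qed

text \<open>The columns of \<open>E\<close> combine the outputs into a receiver with white noise.
  Moved to the input side, the comparison says that \<open>E ** ctrans E\<close> is below the
  inverse of \<open>Z\<close> in the positive semidefinite order.\<close>

theorem logdet_data_processing:
  fixes K :: "complex^'t^'m" and Q :: "complex^'t^'t" and E :: "complex^'k^'m"
  assumes Z: "pdef Z" and Q: "psd Q" and E: "ctrans E ** Z ** E = mat 1"
  shows "logdet (mat 1 + (ctrans E ** K) ** Q ** ctrans (ctrans E ** K))
           \<le> logdet (Z + K ** Q ** ctrans K) - logdet Z"
proof -
  obtain B :: "complex^'t^'t" where B: "Q = B ** ctrans B" by (rule psd_factor[OF Q])
  define F where "F = K ** B"
  define Z' where "Z' = matrix_inv Z"
  define D where "D = Z' - E ** ctrans E"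
  have Z': "Z' ** Z = mat 1" "Z ** Z' = mat 1" "ctrans Z' = Z'"
    unfolding Z'_def by (intro matrix_inv_mul pdef_invertible Z psd_hermitian pdef_psd pdef_matrix_inv)+
  \<comment> \<open>Expanding with \<open>ctrans E ** Z ** E = mat 1\<close> gives
    \<open>D ** Z ** ctrans D = D\<close>, which exhibits \<open>D\<close> as a congruence of
    \<open>Z\<close>, hence positive semidefinite.\<close>
  have "D ** Z ** ctrans D = (Z' ** Z) ** Z' - (Z' ** Z) ** E ** ctrans E - E ** ctrans E ** (Z ** Z')
      + E ** (ctrans E ** Z ** E) ** ctrans E"
    by (simp add: D_def ctrans_diff ctrans_mul Z'(3) matrix_diff_ldistrib matrix_diff_rdistrib matrix_mul_assoc)
  then have "D = D ** Z ** ctrans D" by (simp add: Z' E D_def)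
  then have D: "psd D" using psd_congr[OF pdef_psd[OF Z], of D] by simp
  have "logdet (mat 1 + (ctrans E ** K) ** Q ** ctrans (ctrans E ** K))
      = logdet (mat 1 + (ctrans E ** F) ** ctrans (ctrans E ** F))"
    by (simp add: F_def B ctrans_mul matrix_mul_assoc)
  also have "\<dots> = logdet (mat 1 + ctrans (ctrans E ** F) ** (ctrans E ** F))" by (rule logdet_sylvester)
  also have "\<dots> \<le> logdet (mat 1 + ctrans F ** Z' ** F)"
  proof (rule logdet_mono)
    have "mat 1 + ctrans F ** Z' ** F - (mat 1 + ctrans (ctrans E ** F) ** (ctrans E ** F)) = ctrans F ** D ** F"
      by (simp add: D_def ctrans_mul matrix_diff_ldistrib matrix_diff_rdistrib matrix_mul_assoc)
    then show "psd (mat 1 + ctrans F ** Z' ** F - (mat 1 + ctrans (ctrans E ** F) ** (ctrans E ** F)))"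
      using psd_congr'[OF D] by simp
  qed (intro pdef_add_psd pdef_mat_1 psd_ctrans_mult)
  also have "\<dots> = logdet (Z + F ** ctrans F) - logdet Z" unfolding Z'_def by (rule logdet_ratio[OF Z, symmetric])
  finally show ?thesis by (simp add: F_def B ctrans_mul matrix_mul_assoc)
qed

lemma trace_sandwich:
  fixes G :: "complex^'t^'r" and M :: "complex^'t^'t" and T :: "complex^'r^'r"
  shows "trace (M ** (ctrans G ** T ** G)) = trace ((G ** M ** ctrans G) ** T)"
proof -
  have "trace (M ** (ctrans G ** T ** G)) = trace ((M ** ctrans G ** T) ** G)" by (simp add: matrix_mul_assoc)
  also have "\<dots> = trace (G ** (M ** ctrans G ** T))" by (rule trace_mul_sym)
  finally show ?thesis by (simp add: matrix_mul_assoc)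
qed

section \<open>Compactness of sets of covariances of bounded trace\<close>

lemma psd_entry_le_trace:
  fixes A :: "complex^'n^'n"
  assumes "psd A" shows "cmod (A $ i $ j) \<le> Re (trace A)"
proof -
  obtain B :: "complex^'n^'n" where B: "A = B ** ctrans B" by (rule psd_factor[OF assms])
  have A: "A $ i $ j = (\<Sum>k\<in>UNIV. B $ i $ k * cnj (B $ j $ k))" for i j
    by (simp add: B matrix_matrix_mult_def ctrans_def)
  have D: "Re (A $ i $ i) = (\<Sum>k\<in>UNIV. (cmod (B $ i $ k))\<^sup>2)" for i
    unfolding A by (simp add: complex_norm_square[symmetric] flip: of_real_sum of_real_power)
  have le: "Re (A $ i $ i) \<le> Re (trace A)" for i
    unfolding trace_def Re_sum by (rule member_le_sum) (auto simp: D intro!: sum_nonneg)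
  have "cmod (A $ i $ j) \<le> (\<Sum>k\<in>UNIV. cmod (B $ i $ k) * cmod (B $ j $ k))"
    unfolding A by (rule order_trans[OF norm_sum]) (simp add: norm_mult)
  also have "\<dots> \<le> (\<Sum>k\<in>UNIV. ((cmod (B $ i $ k))\<^sup>2 + (cmod (B $ j $ k))\<^sup>2) / 2)"
  proof (rule sum_mono)
    fix k
    show "cmod (B $ i $ k) * cmod (B $ j $ k) \<le> ((cmod (B $ i $ k))\<^sup>2 + (cmod (B $ j $ k))\<^sup>2) / 2"
      using sum_squares_bound[of "cmod (B $ i $ k)" "cmod (B $ j $ k)"] by simp
  qed
  also have "\<dots> = (Re (A $ i $ i) + Re (A $ j $ j)) / 2"
    by (simp add: D sum.distrib sum_divide_distrib[symmetric])
  also have "\<dots> \<le> (Re (trace A) + Re (trace A)) / 2"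
    by (intro divide_right_mono add_mono le) simp
  finally show ?thesis by simp
qed

lemma norm_matrix_le_sum: "norm (A::complex^'n^'m) \<le> (\<Sum>i\<in>UNIV. \<Sum>j\<in>UNIV. cmod (A $ i $ j))"
proof -
  have "norm A \<le> (\<Sum>i\<in>UNIV. norm (A $ i))" unfolding norm_vec_def by (rule L2_set_le_sum) simp
  also have "\<dots> \<le> (\<Sum>i\<in>UNIV. \<Sum>j\<in>UNIV. cmod (A $ i $ j))"
    by (intro sum_mono) (unfold norm_vec_def, rule L2_set_le_sum, simp)
  finally show ?thesis .
qed

lemma psd_norm_le:
  fixes A :: "complex^'n^'n"
  assumes "psd A" "Re (trace A) \<le> P"
  shows "norm A \<le> real (CARD('n) * CARD('n)) * P"
proof -
  have "norm A \<le> (\<Sum>i\<in>(UNIV::'n set). \<Sum>j\<in>(UNIV::'n set). P)"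
    by (rule order_trans[OF norm_matrix_le_sum])
       (intro sum_mono order_trans[OF psd_entry_le_trace[OF assms(1)] assms(2)])
  then show ?thesis by simp
qed

lemma continuous_on_matrix_mult [continuous_intros]:
  fixes f :: "'a::topological_space \<Rightarrow> complex^'n^'m" and g :: "'a \<Rightarrow> complex^'k^'n"
  assumes "continuous_on S f" "continuous_on S g"
  shows "continuous_on S (\<lambda>x. f x ** g x)"
  unfolding matrix_matrix_mult_def by (intro continuous_intros assms)

lemma continuous_on_logdet:
  fixes f :: "'a::topological_space \<Rightarrow> complex^'n^'n"
  assumes "continuous_on S f" "\<And>x. x \<in> S \<Longrightarrow> pdef (f x)"
  shows "continuous_on S (\<lambda>x. logdet (f x))"
proof -
  have "continuous_on S (\<lambda>x. Re (det (f x)))"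
    unfolding det_def by (intro continuous_intros assms(1))
  then show ?thesis
    unfolding logdet_def
    by (rule continuous_on_ln) (use assms(2) pdef_det_pos in \<open>metis less_irrefl\<close>)
qed

lemma closed_psd: "closed {A :: complex^'n^'n. psd A}"
proof -
  have "continuous_on UNIV (\<lambda>A :: complex^'n^'n. cquad A x)" for x
    unfolding cquad_def by (intro continuous_intros)
  then show ?thesis
    unfolding psd_def
    by (intro closed_Collect_all closed_Collect_conj closed_Collect_eq closed_Collect_le continuous_intros)
qed

lemma compact_psd_pairs:
  "compact {(A :: complex^'n^'n, B :: complex^'m^'m). psd A \<and> psd B \<and> Re (trace A) + Re (trace B) \<le> P}"
    (is "compact ?C")
proof -
  have "?C = {z. psd (fst z)} \<inter> {z. psd (snd z)} \<inter> {z. Re (trace (fst z)) + Re (trace (snd z)) \<le> P}"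
    by auto
  moreover have "closed {z :: (complex^'n^'n) \<times> (complex^'m^'m). psd (fst z)}"
    using closed_vimage[OF closed_psd continuous_on_fst[OF continuous_on_id]] by (simp add: vimage_def)
  moreover have "closed {z :: (complex^'n^'n) \<times> (complex^'m^'m). psd (snd z)}"
    using closed_vimage[OF closed_psd continuous_on_snd[OF continuous_on_id]] by (simp add: vimage_def)
  moreover have "closed {z :: (complex^'n^'n) \<times> (complex^'m^'m). Re (trace (fst z)) + Re (trace (snd z)) \<le> P}"
    unfolding trace_def by (intro closed_Collect_le continuous_intros)
  ultimately have "closed ?C" by auto
  moreover have "bounded ?C"
  proof -
    have "norm z \<le> real (CARD('n) * CARD('n)) * P + real (CARD('m) * CARD('m)) * P" if "z \<in> ?C" for z
    proof -
      obtain A B where z: "z = (A, B)" by force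
      have "norm A \<le> real (CARD('n) * CARD('n)) * P" "norm B \<le> real (CARD('m) * CARD('m)) * P"
        using that psd_trace_nonneg[of A] psd_trace_nonneg[of B] psd_norm_le[of A P] psd_norm_le[of B P] unfolding z by auto
      then show ?thesis using norm_Pair_le[of A B] z by simp
    qed
    then show ?thesis by (auto simp: bounded_iff)
  qed
  ultimately show ?thesis by (simp add: compact_eq_bounded_closed)
qed

section \<open>The dual multiple access problem\<close>

text \<open>Successive decoding gives user 1 the rate \<open>logdet N\<close>, free of interference,
  and user 2 the rate \<open>logdet M - logdet N\<close>, where \<open>N\<close> and
  \<open>M\<close> are the two matrices below. Regrouped in this way, the sum with weights
  \<open>\<mu>\<close> and \<open>1\<close> has no negative coefficient when
  \<open>1 \<le> \<mu>\<close>.\<close>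

definition mac_rate :: "real \<Rightarrow> complex^'t^'r \<Rightarrow> complex^'t^'s \<Rightarrow> complex^'r^'r \<Rightarrow> complex^'s^'s \<Rightarrow> real" where
  "mac_rate \<mu> G K S1 S2 = (\<mu> - 1) * logdet (mat 1 + ctrans G ** S1 ** G)
     + logdet (mat 1 + ctrans G ** S1 ** G + ctrans K ** S2 ** K)"

lemma mac_rate_attains_max:
  fixes G :: "complex^'t^'r" and K :: "complex^'t^'s"
  assumes "0 \<le> P"
  obtains S1 S2 where "psd S1" "psd S2" "Re (trace S1) + Re (trace S2) \<le> P"
    "\<And>T1 T2. psd T1 \<Longrightarrow> psd T2 \<Longrightarrow> Re (trace T1) + Re (trace T2) \<le> P \<Longrightarrow>
        mac_rate \<mu> G K T1 T2 \<le> mac_rate \<mu> G K S1 S2"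
proof -
  let ?C = "{(A :: complex^'r^'r, B :: complex^'s^'s). psd A \<and> psd B \<and> Re (trace A) + Re (trace B) \<le> P}"
  have cont: "continuous_on ?C (\<lambda>z. mac_rate \<mu> G K (fst z) (snd z))"
    unfolding mac_rate_def
    by (intro continuous_intros continuous_on_logdet)
       (auto intro!: pdef_add_psd psd_congr')
  have "(0, 0) \<in> ?C" using assms by (simp add: trace_def)
  then have "?C \<noteq> {}" by blast
  then obtain z where z: "z \<in> ?C" "\<And>y. y \<in> ?C \<Longrightarrow> mac_rate \<mu> G K (fst y) (snd y) \<le> mac_rate \<mu> G K (fst z) (snd z)"
    using continuous_attains_sup[OF compact_psd_pairs _ cont] by blast
  show ?thesis
  proof (rule that[of "fst z" "snd z"])
    fix T1 :: "complex^'r^'r" and T2 :: "complex^'s^'s"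
    assume "psd T1" "psd T2" "Re (trace T1) + Re (trace T2) \<le> P"
    then show "mac_rate \<mu> G K T1 T2 \<le> mac_rate \<mu> G K (fst z) (snd z)"
      using z(2)[of "(T1, T2)"] by simp
  qed (use z(1) in auto)
qed

text \<open>The two matrices traced against \<open>T1 - S1\<close> and \<open>T2 - S2\<close> are
  the gradients of \<open>mac_rate\<close>. Were the directional derivative positive, a short step
  along the segment, feasible by convexity, would exceed the maximum.\<close>

lemma mac_rate_first_order:
  fixes G :: "complex^'t^'r" and K :: "complex^'t^'s"
  defines "N S1 \<equiv> mat 1 + ctrans G ** S1 ** G"
    and "M S1 S2 \<equiv> mat 1 + ctrans G ** S1 ** G + ctrans K ** S2 ** K"
  assumes S: "psd S1" "psd S2" "Re (trace S1) + Re (trace S2) \<le> P"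
    and max: "\<And>T1 T2. psd T1 \<Longrightarrow> psd T2 \<Longrightarrow> Re (trace T1) + Re (trace T2) \<le> P \<Longrightarrow>
        mac_rate \<mu> G K T1 T2 \<le> mac_rate \<mu> G K S1 S2"
    and T: "psd T1" "psd T2" "Re (trace T1) + Re (trace T2) \<le> P"
  shows "Re (trace (((\<mu> - 1) *\<^sub>R (G ** matrix_inv (N S1) ** ctrans G) + G ** matrix_inv (M S1 S2) ** ctrans G) ** (T1 - S1)))
       + Re (trace ((K ** matrix_inv (M S1 S2) ** ctrans K) ** (T2 - S2))) \<le> 0"
    (is "?D1 + ?D2 \<le> 0")
proof (rule ccontr)
  assume pos: "\<not> ?D1 + ?D2 \<le> 0"
  define U1 where "U1 t = S1 + t *\<^sub>R (T1 - S1)" for t :: real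
  define U2 where "U2 t = S2 + t *\<^sub>R (T2 - S2)" for t :: real
  define f where "f t = mac_rate \<mu> G K (U1 t) (U2 t)" for t
  define X where "X = ctrans G ** (T1 - S1) ** G"
  define Y where "Y = ctrans G ** (T1 - S1) ** G + ctrans K ** (T2 - S2) ** K"
  have NU: "N (U1 t) = N S1 + t *\<^sub>R X" for t
    by (simp add: N_def U1_def X_def matrix_add_ldistrib matrix_add_rdistrib matrix_scaleR_left matrix_scaleR_right)
  have MU: "M (U1 t) (U2 t) = M S1 S2 + t *\<^sub>R Y" for t
    by (simp add: M_def U1_def U2_def Y_def matrix_add_ldistrib matrix_add_rdistrib matrix_scaleR_left
        matrix_scaleR_right scaleR_right_distrib)
  have hX: "ctrans X = X" and hY: "ctrans Y = Y"
    using S T by (simp_all add: X_def Y_def ctrans_mul ctrans_add ctrans_diff psd_hermitian matrix_mul_assoc)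
  have pN: "pdef (N S1)" and pM: "pdef (M S1 S2)"
    unfolding N_def M_def by (intro pdef_add_psd pdef_mat_1 psd_congr' S)+
  have f_eq: "f t = (\<mu> - 1) * logdet (N S1 + t *\<^sub>R X) + logdet (M S1 S2 + t *\<^sub>R Y)" for t
    unfolding NU[symmetric] MU[symmetric] by (simp add: f_def mac_rate_def N_def M_def)
  have "(f has_real_derivative (\<mu> - 1) * Re (trace (matrix_inv (N S1) ** X)) + Re (trace (matrix_inv (M S1 S2) ** Y))) (at 0)"
    unfolding f_eq by (intro DERIV_add DERIV_cmult logdet_line_derivative pN pM hX hY)
  moreover have "(\<mu> - 1) * Re (trace (matrix_inv (N S1) ** X)) + Re (trace (matrix_inv (M S1 S2) ** Y)) = ?D1 + ?D2"
    unfolding X_def Y_def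
    by (simp add: matrix_add_ldistrib matrix_add_rdistrib trace_add trace_sandwich matrix_scaleR_left trace_scaleR)
  ultimately have "(f has_real_derivative ?D1 + ?D2) (at 0)" by simp
  from DERIV_pos_inc_right[OF this] pos obtain d where d: "d > 0" "\<And>h. 0 < h \<Longrightarrow> h < d \<Longrightarrow> f 0 < f (0 + h)"
    by auto
  define h where "h = min (d / 2) 1"
  have h: "0 < h" "h < d" "h \<le> 1" using d(1) by (auto simp: h_def)
  have u: "U1 h = (1 - h) *\<^sub>R S1 + h *\<^sub>R T1" "U2 h = (1 - h) *\<^sub>R S2 + h *\<^sub>R T2"
    by (simp_all add: U1_def U2_def algebra_simps)
  have "Re (trace (U1 h)) + Re (trace (U2 h)) =
      (1 - h) * (Re (trace S1) + Re (trace S2)) + h * (Re (trace T1) + Re (trace T2))"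
    unfolding u trace_add trace_scaleR by (simp add: algebra_simps)
  also have "\<dots> \<le> (1 - h) * P + h * P"
    using h S(3) T(3) by (intro add_mono mult_left_mono) auto
  finally have "Re (trace (U1 h)) + Re (trace (U2 h)) \<le> P" by (simp add: algebra_simps)
  moreover have "psd (U1 h)" "psd (U2 h)"
    unfolding u using h by (auto intro!: psd_add psd_scaleR S T)
  ultimately have "f h \<le> f 0" using max by (simp add: f_def U1_def U2_def)
  with d(2)[of h] h show False by simp
qed

text \<open>Rank-one covariance of a beam in direction \<open>v\<close>. Spending all the power on
  it turns the first-order condition into a bound for a quadratic form at \<open>v\<close>.\<close>

definition outer :: "complex^'n \<Rightarrow> complex^'n^'n" where
  "outer v = (\<chi> i j. v $ i * cnj (v $ j))"

lemma cquad_outer: "cquad (outer v) x = of_real ((cmod (cinner v x))\<^sup>2)"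
proof -
  have "cquad (outer v) x = cnj (cinner v x) * cinner v x"
    by (simp add: cquad_def outer_def cinner_def sum_product algebra_simps)
  then show ?thesis by (simp only: complex_norm_square mult.commute)
qed

lemma psd_outer: "psd (outer v)"
  by (simp add: psd_def cquad_outer)

lemma trace_mult_outer: "trace (A ** outer v) = cquad A v"
  by (simp add: trace_def matrix_matrix_mult_def outer_def cquad_def algebra_simps)

lemma trace_outer: "trace (outer v) = of_real ((norm v)\<^sup>2)"
  using trace_mult_outer[of "mat 1" v] by (simp add: cquad_mat_1)

text \<open>Channel to a receiver that sees both outputs; for \<open>Galpha\<close> and
  \<open>Kalpha\<close> it is \<open>Kbar\<close>.\<close>

definition bcol :: "complex^'t^'r \<Rightarrow> complex^'t^'s \<Rightarrow> complex^'t^('r+'s)" where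
  "bcol G K = (\<chi> r. case r of Inl i \<Rightarrow> G $ i | Inr i \<Rightarrow> K $ i)"

definition upper :: "complex^('r::finite+'s::finite) \<Rightarrow> complex^'r" where "upper w = (\<chi> i. w $ Inl i)"
definition lower :: "complex^('r::finite+'s::finite) \<Rightarrow> complex^'s" where "lower w = (\<chi> i. w $ Inr i)"

lemma norm_vec_square: "(norm (w :: complex^'n))\<^sup>2 = (\<Sum>i\<in>UNIV. (cmod (w $ i))\<^sup>2)"
  unfolding norm_vec_def L2_set_def by (simp add: sum_nonneg)

lemma sum_UNIV_sum_type:
  fixes f :: "'r::finite + 's::finite \<Rightarrow> 'b::comm_monoid_add"
  shows "(\<Sum>k\<in>UNIV. f k) = (\<Sum>i\<in>UNIV. f (Inl i)) + (\<Sum>i\<in>UNIV. f (Inr i))"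
  unfolding UNIV_Plus_UNIV[symmetric] by (subst sum.Plus) simp_all

lemma ctrans_bcol_vec: "ctrans (bcol G K) *v w = ctrans G *v upper w + ctrans K *v lower w"
  by (simp add: vec_eq_iff matrix_vector_mult_def ctrans_def bcol_def upper_def lower_def sum_UNIV_sum_type)

lemma norm_upper_lower: "(norm w)\<^sup>2 = (norm (upper w))\<^sup>2 + (norm (lower w))\<^sup>2"
  by (simp add: norm_vec_square sum_UNIV_sum_type upper_def lower_def)

lemma cquad_bmat_corr:
  "cquad (bmat (mat 1) Q (ctrans Q) (mat 1)) w = of_real ((norm (upper w))\<^sup>2) + of_real ((norm (lower w))\<^sup>2)
     + cinner (upper w) (Q *v lower w) + cnj (cinner (upper w) (Q *v lower w))"
proof -
  have 1: "(bmat (mat 1) Q (ctrans Q) (mat 1) *v w) $ Inl i = upper w $ i + (Q *v lower w) $ i" for i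
    by (simp add: matrix_vector_mult_def bmat_def sum_UNIV_sum_type upper_def lower_def mat_def mult_delta_left)
  have 2: "(bmat (mat 1) Q (ctrans Q) (mat 1) *v w) $ Inr i = (ctrans Q *v upper w) $ i + lower w $ i" for i
    by (simp add: matrix_vector_mult_def bmat_def sum_UNIV_sum_type upper_def lower_def mat_def mult_delta_left)
  have 3: "cinner w x = (\<Sum>i\<in>UNIV. cnj (upper w $ i) * x $ Inl i) + (\<Sum>i\<in>UNIV. cnj (lower w $ i) * x $ Inr i)" for x
    by (simp add: cinner_def sum_UNIV_sum_type upper_def lower_def)
  have "cquad (bmat (mat 1) Q (ctrans Q) (mat 1)) w = cinner (upper w) (upper w + Q *v lower w)
      + cinner (lower w) (ctrans Q *v upper w + lower w)"
    unfolding cquad_cinner 3 1 2 by (simp add: cinner_def)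
  also have "\<dots> = cinner (upper w) (upper w) + cinner (lower w) (lower w) + cinner (upper w) (Q *v lower w)
      + cinner (lower w) (ctrans Q *v upper w)"
    by (simp add: cinner_add_right)
  also have "cinner (lower w) (ctrans Q *v upper w) = cnj (cinner (upper w) (Q *v lower w))"
    by (subst cinner_commute) (simp add: cinner_ctrans[of "upper w"])
  finally show ?thesis by (simp add: cinner_self)
qed

text \<open>The noise correlation comes from the KKT conditions of the dual problem: with the off-diagonal
  block \<open>G M\<^sup>-\<^sup>1 K\<^sup>\<dagger> / \<lambda>\<close> the optimal point for the receiver pair \<open>(G, K)\<close> remains a certificate
  when the second receiver also observes the output of the first one.\<close>
theorem mac_rate_cooperative_bound:
  fixes G :: "complex^'t^'r::finite" and K :: "complex^'t^'s::finite"
  assumes \<mu>: "1 \<le> \<mu>" and P: "0 < P" and e: "0 < e"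
    and S: "psd S1" "psd S2" "Re (trace S1) + Re (trace S2) \<le> P"
    and max: "\<And>T1 T2. psd T1 \<Longrightarrow> psd T2 \<Longrightarrow> Re (trace T1) + Re (trace T2) \<le> P \<Longrightarrow>
        mac_rate \<mu> G K T1 T2 \<le> mac_rate \<mu> G K S1 S2"
  obtains Q where "pdef (bmat (mat 1) Q (ctrans Q) (mat 1))"
    "\<And>T1 T2. psd T1 \<Longrightarrow> psd T2 \<Longrightarrow>
        Re (trace T1) + Re (trace (bmat (mat 1) Q (ctrans Q) (mat 1) ** T2)) \<le> P \<Longrightarrow>
        mac_rate \<mu> G (bcol G K) T1 T2 \<le> mac_rate \<mu> G K S1 S2 + e * P"
proof -
  define N where "N = mat 1 + ctrans G ** S1 ** G"
  define M where "M = mat 1 + ctrans G ** S1 ** G + ctrans K ** S2 ** K"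
  have pN: "pdef N" and pM: "pdef M"
    unfolding N_def M_def by (intro pdef_add_psd pdef_mat_1 psd_congr' S)+
  define N' where "N' = matrix_inv N"
  define M' where "M' = matrix_inv M"
  have N': "psd N'" and M': "psd M'" unfolding N'_def M'_def by (intro pdef_psd pdef_matrix_inv pN pM)+
  define D1 where "D1 = (\<mu> - 1) *\<^sub>R (G ** N' ** ctrans G) + G ** M' ** ctrans G"
  define D2 where "D2 = K ** M' ** ctrans K"
  \<comment> \<open>The multiplier of the power constraint, read off from complementary slackness:
    the gradients traced against the optimum sum to \<open>l * P\<close>.\<close>
  define l where "l = (Re (trace (D1 ** S1)) + Re (trace (D2 ** S2))) / P"
  have pD: "psd D1" "psd D2"
    unfolding D1_def D2_def using \<mu> by (auto intro!: psd_add psd_scaleR psd_congr N' M')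
  have l0: "0 \<le> l" unfolding l_def using P by (intro divide_nonneg_pos add_nonneg_nonneg psd_trace_mult_nonneg pD S)
  have fo: "Re (trace (D1 ** T1)) + Re (trace (D2 ** T2)) \<le> l * P"
    if "psd T1" "psd T2" "Re (trace T1) + Re (trace T2) \<le> P" for T1 T2
    using mac_rate_first_order[OF S max that] P
    by (simp add: D1_def D2_def N'_def M'_def N_def M_def l_def matrix_diff_ldistrib trace_sub)
  \<comment> \<open>Testing \<open>fo\<close> with all power in one direction bounds both gradients
    by \<open>l\<close> times the identity.\<close>
  have D1le: "Re (cquad D1 v) \<le> l * (norm v)\<^sup>2" and D2le: "Re (cquad D2 w) \<le> l * (norm w)\<^sup>2" for v w
  proof -
    show "Re (cquad D1 v) \<le> l * (norm v)\<^sup>2"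
    proof (cases "v = 0")
      case False
      then have "Re (trace (D1 ** ((P / (norm v)\<^sup>2) *\<^sub>R outer v))) + Re (trace (D2 ** 0)) \<le> l * P"
        using P by (intro fo psd_scaleR psd_outer psd_0)
           (auto simp: trace_scaleR trace_outer trace_def[of 0] simp del: of_real_power)
      then have "(P / (norm v)\<^sup>2) * Re (cquad D1 v) \<le> l * P"
        by (simp add: matrix_scaleR_right trace_scaleR trace_mult_outer trace_def[of 0])
      then show ?thesis using P False by (simp add: field_simps)
    qed (simp add: cquad_cinner)
    show "Re (cquad D2 w) \<le> l * (norm w)\<^sup>2"
    proof (cases "w = 0")
      case False
      then have "Re (trace (D1 ** 0)) + Re (trace (D2 ** ((P / (norm w)\<^sup>2) *\<^sub>R outer w))) \<le> l * P"
        using P by (intro fo psd_scaleR psd_outer psd_0)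
           (auto simp: trace_scaleR trace_outer trace_def[of 0] simp del: of_real_power)
      then have "(P / (norm w)\<^sup>2) * Re (cquad D2 w) \<le> l * P"
        by (simp add: matrix_scaleR_right trace_scaleR trace_mult_outer trace_def[of 0])
      then show ?thesis using P False by (simp add: field_simps)
    qed (simp add: cquad_cinner)
  qed
  \<comment> \<open>\<open>l\<close> vanishes for zero channels, and with \<open>k = l\<close> the
    matrix \<open>Z\<close> below could be singular. The surplus \<open>e\<close> makes
    \<open>k\<close> positive and \<open>Z\<close> strictly definite.\<close>
  define k where "k = l + e"
  have k: "0 < k" using l0 e by (simp add: k_def)
  define Q where "Q = (1 / k) *\<^sub>R (G ** M' ** ctrans K)"
  define Z where "Z = bmat (mat 1) Q (ctrans Q) (mat 1)"
  define B where "B = bcol G K"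
  \<comment> \<open>By the choice of \<open>Q\<close> the cross terms of
    \<open>k *\<^sub>R Z\<close> and \<open>B ** M' ** ctrans B\<close> cancel, so that the form of
    \<open>R\<close> splits into one summand for each receiver.\<close>
  define R where "R = k *\<^sub>R Z - B ** M' ** ctrans B"
  have R: "cquad R w = (of_real (k * (norm (upper w))\<^sup>2) - cquad (G ** M' ** ctrans G) (upper w))
      + (of_real (k * (norm (lower w))\<^sup>2) - cquad D2 (lower w))" for w
  proof -
    define x where "x = ctrans G *v upper w"
    define y where "y = ctrans K *v lower w"
    have hM: "ctrans M' = M'" using M' by (rule psd_hermitian)
    have Qk: "of_real k * cinner (upper w) (Q *v lower w) = cinner x (M' *v y)"
    proof -
      have "Q *v lower w = (1 / k) *\<^sub>R (G *v (M' *v y))"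
        by (simp add: Q_def matrix_scaleR_vector y_def matrix_vector_mul_assoc matrix_mul_assoc)
      then show ?thesis using k by (simp add: cinner_scaleR_right cinner_ctrans[of "upper w" G] x_def)
    qed
    have Qk': "of_real k * cnj (cinner (upper w) (Q *v lower w)) = cinner y (M' *v x)"
    proof -
      have "of_real k * cnj (cinner (upper w) (Q *v lower w)) = cnj (of_real k * cinner (upper w) (Q *v lower w))"
        by simp
      also have "\<dots> = cinner (M' *v y) x" unfolding Qk by (rule cinner_commute[symmetric])
      finally show ?thesis by (simp add: cinner_ctrans hM)
    qed
    have "cquad (B ** M' ** ctrans B) w = cquad M' (x + y)"
      by (simp add: cquad_congr B_def ctrans_bcol_vec x_def y_def)
    also have "\<dots> = cquad M' x + cquad M' y + cinner x (M' *v y) + cinner y (M' *v x)"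
      by (simp add: cquad_cinner matrix_vector_right_distrib cinner_add_left cinner_add_right)
    finally show ?thesis
      unfolding R_def cquad_diff cquad_scaleR Z_def cquad_bmat_corr D2_def cquad_congr
      using Qk Qk' by (simp add: algebra_simps x_def[symmetric] y_def[symmetric])
  qed
  have "pdef R"
    unfolding pdef_def
  proof (intro allI impI)
    fix w :: "complex^('r+'s)" assume "w \<noteq> 0"
    have im: "Im (cquad R w) = 0"
      unfolding R using pD psd_congr[OF M', of G] by (simp add: psd_def)
    \<comment> \<open>Here \<open>1 \<le> \<mu>\<close> enters: dropping the \<open>N'\<close> term
      of the first gradient only decreases it.\<close>
    have "cquad D1 v = of_real (\<mu> - 1) * cquad (G ** N' ** ctrans G) v + cquad (G ** M' ** ctrans G) v" for v
      by (simp add: D1_def cquad_add cquad_scaleR)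
    then have "Re (cquad (G ** M' ** ctrans G) v) \<le> Re (cquad D1 v)" for v
      using \<mu> psd_congr[OF N', of G] by (simp add: psd_def)
    then have "Re (cquad R w) \<ge> (k * (norm (upper w))\<^sup>2 - l * (norm (upper w))\<^sup>2) + (k * (norm (lower w))\<^sup>2 - l * (norm (lower w))\<^sup>2)"
      unfolding R using D1le[of "upper w"] D2le[of "lower w"]
      by (simp add: le_diff_eq del: of_real_mult of_real_power) (smt (verit, best))
    also have "(k * (norm (upper w))\<^sup>2 - l * (norm (upper w))\<^sup>2) + (k * (norm (lower w))\<^sup>2 - l * (norm (lower w))\<^sup>2) = e * (norm w)\<^sup>2"
      by (simp add: k_def norm_upper_lower algebra_simps)
    finally show "Im (cquad R w) = 0 \<and> 0 < Re (cquad R w)"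
      using im e \<open>w \<noteq> 0\<close> by (smt (verit) mult_pos_pos zero_less_norm_iff zero_less_power)
  qed
  have "pdef (R + B ** M' ** ctrans B)" by (intro pdef_add_psd \<open>pdef R\<close> psd_congr M')
  then have "pdef (k *\<^sub>R Z)" by (simp add: R_def)
  from pdef_scaleR[OF this, of "1 / k"] k have pZ: "pdef Z" by simp
  show ?thesis
  proof (rule that[of Q])
    show "pdef (bmat (mat 1) Q (ctrans Q) (mat 1))" using pZ by (simp add: Z_def)
    fix T1 :: "complex^'r^'r" and T2 :: "complex^('r+'s)^('r+'s)"
    assume T: "psd T1" "psd T2" "Re (trace T1) + Re (trace (bmat (mat 1) Q (ctrans Q) (mat 1) ** T2)) \<le> P"
    define n where "n = mat 1 + ctrans G ** T1 ** G"
    define m where "m = mat 1 + ctrans G ** T1 ** G + ctrans B ** T2 ** B"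
    have "pdef n" "pdef m" unfolding n_def m_def by (intro pdef_add_psd pdef_mat_1 psd_congr' T)+
    \<comment> \<open>Tangents at the optimum of the problem without cooperation. They still certify
      the cooperative problem, since the gradient \<open>B ** M' ** ctrans B\<close> of the latter
      is at most \<open>k *\<^sub>R Z\<close>.\<close>
    then have tn: "logdet n \<le> logdet N + Re (trace (N' ** (n - N)))"
      and tm: "logdet m \<le> logdet M + Re (trace (M' ** (m - M)))"
      unfolding N'_def M'_def by (intro logdet_tangent pN pM; simp)+
    have h1: "trace (N' ** (n - N)) = trace ((G ** N' ** ctrans G) ** T1) - trace ((G ** N' ** ctrans G) ** S1)"
      by (simp add: n_def N_def matrix_diff_ldistrib trace_sub trace_sandwich)
    have h2: "trace (M' ** (m - M)) = trace ((G ** M' ** ctrans G) ** T1) - trace ((G ** M' ** ctrans G) ** S1)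
        + trace ((B ** M' ** ctrans B) ** T2) - trace (D2 ** S2)"
    proof -
      have mM: "m - M = (ctrans G ** T1 ** G - ctrans G ** S1 ** G) + (ctrans B ** T2 ** B - ctrans K ** S2 ** K)"
        by (simp add: m_def M_def)
      show ?thesis
        unfolding mM D2_def matrix_add_ldistrib matrix_diff_ldistrib trace_add trace_sub trace_sandwich by simp
    qed
    have h3: "trace (D1 ** X) = (\<mu> - 1) *\<^sub>R trace ((G ** N' ** ctrans G) ** X) + trace ((G ** M' ** ctrans G) ** X)" for X
      by (simp add: D1_def matrix_add_rdistrib matrix_scaleR_left trace_add trace_scaleR)
    have lP: "l * P = Re (trace (D1 ** S1)) + Re (trace (D2 ** S2))" using P by (simp add: l_def)
    have "(\<mu> - 1) * Re (trace (N' ** (n - N))) + Re (trace (M' ** (m - M)))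
        = Re (trace (D1 ** T1)) + Re (trace ((B ** M' ** ctrans B) ** T2)) - l * P"
      unfolding lP h1 h2 h3 by (simp add: algebra_simps)
    moreover have "mac_rate \<mu> G B T1 T2 \<le> mac_rate \<mu> G K S1 S2
        + ((\<mu> - 1) * Re (trace (N' ** (n - N))) + Re (trace (M' ** (m - M))))"
    proof -
      have "(\<mu> - 1) * logdet n \<le> (\<mu> - 1) * (logdet N + Re (trace (N' ** (n - N))))"
        using \<mu> tn by (intro mult_left_mono) auto
      moreover have "mac_rate \<mu> G B T1 T2 = (\<mu> - 1) * logdet n + logdet m"
        "mac_rate \<mu> G K S1 S2 = (\<mu> - 1) * logdet N + logdet M"
        by (simp_all add: mac_rate_def n_def m_def N_def M_def)
      ultimately show ?thesis using tm by (simp add: algebra_simps)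
    qed
    moreover have "Re (trace (D1 ** T1)) \<le> k * Re (trace T1)"
    proof -
      have "psd (k *\<^sub>R mat 1 - D1)"
        unfolding psd_iff
      proof (intro conjI allI)
        show "ctrans (k *\<^sub>R mat 1 - D1) = k *\<^sub>R mat 1 - D1"
          using psd_hermitian[OF pD(1)] by (simp add: ctrans_diff ctrans_scaleR)
        fix x show "0 \<le> Re (cquad (k *\<^sub>R mat 1 - D1) x)"
        proof -
          have "Re (cquad (k *\<^sub>R mat 1 - D1) x) = k * (norm x)\<^sup>2 - Re (cquad D1 x)"
            unfolding cquad_diff cquad_scaleR cquad_mat_1 by (simp flip: of_real_mult of_real_power)
          moreover have "l * (norm x)\<^sup>2 \<le> k * (norm x)\<^sup>2"
            using e by (intro mult_right_mono) (auto simp: k_def)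
          ultimately show ?thesis using D1le[of x] by linarith
        qed
      qed
      from trace_mono[OF this T(1)] show ?thesis by (simp add: matrix_scaleR_left trace_scaleR)
    qed
    moreover have "Re (trace ((B ** M' ** ctrans B) ** T2)) \<le> k * Re (trace (Z ** T2))"
      using trace_mono[OF pdef_psd[OF \<open>pdef R\<close>, unfolded R_def] T(2)]
      by (simp add: matrix_scaleR_left trace_scaleR)
    moreover have "k * Re (trace T1) + k * Re (trace (Z ** T2)) \<le> k * P"
      using T(3) k by (simp add: Z_def distrib_left[symmetric])
    \<comment> \<open>Power is priced at \<open>k\<close>, while the optimum accounts for
      \<open>l * P\<close>; the difference is \<open>e * P\<close>.\<close>
    ultimately have "mac_rate \<mu> G B T1 T2 \<le> mac_rate \<mu> G K S1 S2 + (k * P - l * P)" by linarith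
    then show "mac_rate \<mu> G (bcol G K) T1 T2 \<le> mac_rate \<mu> G K S1 S2 + e * P"
      by (simp add: B_def k_def algebra_simps)
  qed
qed

section \<open>Broadcast--multiple access duality\<close>

text \<open>\<open>link_duality\<close> is applied to user 1 first, with the interference of user 2
  as part of the forward noise; the resulting \<open>S1\<close> fixes the reverse noise
  \<open>N\<close> for user 2. The noise \<open>Z\<close> of user 2 is arbitrary and appears as a
  weight on its dual power.\<close>

theorem bc_to_mac:
  fixes G :: "complex^'t^'r" and K :: "complex^'t^'s"
  assumes Q: "psd Qp" "psd Qc" and Z: "pdef Z"
  obtains S1 S2 where "psd S1" "psd S2"
    "Re (trace S1) + Re (trace (Z ** S2)) \<le> Re (trace Qp) + Re (trace Qc)"
    "\<mu> * (logdet (mat 1 + G ** (Qp + Qc) ** ctrans G) - logdet (mat 1 + G ** Qc ** ctrans G))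
       + (logdet (Z + K ** Qc ** ctrans K) - logdet Z) = mac_rate \<mu> G K S1 S2"
proof -
  define Z1 where "Z1 = mat 1 + G ** Qc ** ctrans G"
  have "pdef Z1" unfolding Z1_def by (intro pdef_add_psd pdef_mat_1 psd_congr Q)
  from link_duality[OF this pdef_mat_1 Q(1), of G]
  obtain S1 where S1: "psd S1" "Re (trace (Z1 ** S1)) \<le> Re (trace Qp)"
    "logdet (mat 1 + ctrans G ** S1 ** G) = logdet (Z1 + G ** Qp ** ctrans G) - logdet Z1" by auto
  define N where "N = mat 1 + ctrans G ** S1 ** G"
  have "pdef N" unfolding N_def by (intro pdef_add_psd pdef_mat_1 psd_congr' S1)
  from link_duality[OF Z this Q(2), of K]
  obtain S2 where S2: "psd S2" "Re (trace (Z ** S2)) \<le> Re (trace (N ** Qc))"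
    "logdet (N + ctrans K ** S2 ** K) - logdet N = logdet (Z + K ** Qc ** ctrans K) - logdet Z" by auto
  \<comment> \<open>The trace of the interference of \<open>Qc\<close> against \<open>S1\<close>
    lowers the dual power of user 1 and raises the bound for user 2 by the same amount, so it
    cancels in the sum.\<close>
  have "trace (Z1 ** S1) = trace S1 + trace ((G ** Qc ** ctrans G) ** S1)"
    by (simp add: Z1_def matrix_add_rdistrib trace_add)
  moreover have "trace (N ** Qc) = trace Qc + trace ((G ** Qc ** ctrans G) ** S1)"
  proof -
    have "trace (N ** Qc) = trace Qc + trace ((ctrans G ** S1 ** G) ** Qc)"
      by (simp add: N_def matrix_add_rdistrib trace_add)
    also have "trace ((ctrans G ** S1 ** G) ** Qc) = trace (Qc ** (ctrans G ** S1 ** G))" by (rule trace_mul_sym)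
    finally show ?thesis by (simp add: trace_sandwich)
  qed
  ultimately have "Re (trace S1) + Re (trace (Z ** S2)) \<le> Re (trace Qp) + Re (trace Qc)"
    using S1(2) S2(2) by simp
  moreover have Z1Q: "Z1 + G ** Qp ** ctrans G = mat 1 + G ** (Qp + Qc) ** ctrans G"
    by (simp add: Z1_def matrix_add_ldistrib matrix_add_rdistrib)
  moreover have "mac_rate \<mu> G K S1 S2 = \<mu> * logdet N + (logdet (N + ctrans K ** S2 ** K) - logdet N)"
    by (simp add: mac_rate_def N_def algebra_simps)
  ultimately show ?thesis
    using S1(1) S2(1) S1(3)[folded N_def] S2(3) by (intro that[of S1 S2]) (simp_all add: Z1_def add.assoc)
qed

text \<open>The same two links in the opposite order: \<open>Qc\<close> must come first, because the
  forward noise \<open>Z1\<close> of user 1 contains its interference, while \<open>N\<close>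
  depends on \<open>S1\<close> alone.\<close>

theorem mac_to_bc:
  fixes G :: "complex^'t^'r" and K :: "complex^'t^'s"
  assumes S: "psd S1" "psd S2"
  obtains Qp Qc where "psd Qp" "psd Qc"
    "Re (trace Qp) + Re (trace Qc) \<le> Re (trace S1) + Re (trace S2)"
    "\<mu> * (logdet (mat 1 + G ** (Qp + Qc) ** ctrans G) - logdet (mat 1 + G ** Qc ** ctrans G))
       + logdet (mat 1 + K ** Qc ** ctrans K) = mac_rate \<mu> G K S1 S2"
proof -
  define N where "N = mat 1 + ctrans G ** S1 ** G"
  have "pdef N" unfolding N_def by (intro pdef_add_psd pdef_mat_1 psd_congr' S)
  from link_duality[OF this pdef_mat_1 S(2), of "ctrans K"]
  obtain Qc where Qc: "psd Qc" "Re (trace (N ** Qc)) \<le> Re (trace S2)"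
    "logdet (mat 1 + K ** Qc ** ctrans K) = logdet (N + ctrans K ** S2 ** K) - logdet N" by auto
  define Z1 where "Z1 = mat 1 + G ** Qc ** ctrans G"
  have "pdef Z1" unfolding Z1_def by (intro pdef_add_psd pdef_mat_1 psd_congr Qc)
  from link_duality[OF pdef_mat_1 this S(1), of "ctrans G"]
  obtain Qp where Qp: "psd Qp" "Re (trace Qp) \<le> Re (trace (Z1 ** S1))"
    "logdet (Z1 + G ** Qp ** ctrans G) - logdet Z1 = logdet N" by (auto simp: N_def)
  have "trace (Z1 ** S1) = trace S1 + trace ((G ** Qc ** ctrans G) ** S1)"
    by (simp add: Z1_def matrix_add_rdistrib trace_add)
  moreover have "trace (N ** Qc) = trace Qc + trace ((G ** Qc ** ctrans G) ** S1)"
  proof -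
    have "trace (N ** Qc) = trace Qc + trace ((ctrans G ** S1 ** G) ** Qc)"
      by (simp add: N_def matrix_add_rdistrib trace_add)
    also have "trace ((ctrans G ** S1 ** G) ** Qc) = trace (Qc ** (ctrans G ** S1 ** G))" by (rule trace_mul_sym)
    finally show ?thesis by (simp add: trace_sandwich)
  qed
  ultimately have "Re (trace Qp) + Re (trace Qc) \<le> Re (trace S1) + Re (trace S2)"
    using Qc(2) Qp(2) by simp
  moreover have "Z1 + G ** Qp ** ctrans G = mat 1 + G ** (Qp + Qc) ** ctrans G"
    by (simp add: Z1_def matrix_add_ldistrib matrix_add_rdistrib)
  moreover have "mac_rate \<mu> G K S1 S2 = \<mu> * logdet N + (logdet (N + ctrans K ** S2 ** K) - logdet N)"
    by (simp add: mac_rate_def N_def algebra_simps)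
  ultimately show ?thesis
    using Qc(1,3) Qp(1,3) by (intro that[of Qp Qc]) (simp_all add: Z1_def add.assoc)
qed

section \<open>A one-shot coding theorem\<close>

text \<open>Fubini with coordinate \<open>j\<close> innermost. A wrong codeword is independent of
  all that the transmission depends on, so a bound for one redrawn coordinate, uniform in the
  others, bounds the whole average.\<close>

lemma nn_integral_PiM_le_resample:
  fixes f :: "('i \<Rightarrow> 'a) \<Rightarrow> ennreal"
  assumes "prob_space M" "finite J" "j \<in> J"
    and f: "f \<in> borel_measurable (PiM J (\<lambda>_. M))"
    and le: "\<And>x. x \<in> space (PiM (J - {j}) (\<lambda>_. M)) \<Longrightarrow> (\<integral>\<^sup>+y. f (x(j := y)) \<partial>M) \<le> c"
  shows "(\<integral>\<^sup>+x. f x \<partial>PiM J (\<lambda>_. M)) \<le> c"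
proof -
  interpret prob_space M by fact
  interpret product_prob_space "\<lambda>_. M" ..
  have J: "insert j (J - {j}) = J" using assms(3) by auto
  have "(\<integral>\<^sup>+x. f x \<partial>PiM J (\<lambda>_. M)) = (\<integral>\<^sup>+x. (\<integral>\<^sup>+y. f (x(j := y)) \<partial>M) \<partial>PiM (J - {j}) (\<lambda>_. M))"
    using product_nn_integral_insert[of "J - {j}" j f] f assms(2) unfolding J by simp
  also have "\<dots> \<le> (\<integral>\<^sup>+x. c \<partial>PiM (J - {j}) (\<lambda>_. M))"
    by (intro nn_integral_mono le)
  also have "\<dots> = c"
    by (simp add: prob_space.emeasure_space_1[OF prob_space_PiM[OF assms(1)]])
  finally show ?thesis .
qed

lemma nn_integral_PiM_component:
  fixes F :: "'a \<Rightarrow> ennreal"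
  assumes "prob_space M" "finite J" "j \<in> J" and F: "F \<in> borel_measurable M"
  shows "(\<integral>\<^sup>+x. F (x j) \<partial>PiM J (\<lambda>_. M)) = (\<integral>\<^sup>+y. F y \<partial>M)"
proof -
  interpret prob_space M by fact
  interpret product_prob_space "\<lambda>_. M" ..
  have "(\<integral>\<^sup>+x. F (x j) \<partial>PiM J (\<lambda>_. M)) = (\<integral>\<^sup>+x. (\<Prod>i\<in>J. (if i = j then F (x i) else 1)) \<partial>PiM J (\<lambda>_. M))"
    using assms by (simp add: prod.delta)
  also have "\<dots> = (\<Prod>i\<in>J. \<integral>\<^sup>+y. (if i = j then F y else 1) \<partial>M)"
    by (rule product_nn_integral_prod) (use assms in auto)
  also have "\<dots> = (\<Prod>i\<in>J. (if i = j then \<integral>\<^sup>+y. F y \<partial>M else 1))"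
    by (intro prod.cong) (auto simp: prob_space.emeasure_space_1[OF assms(1)])
  finally show ?thesis using assms by (simp add: prod.delta)
qed

text \<open>Covering estimate: \<open>p\<close> is the chance that an independent word fits,
  \<open>k\<close> the chance under the joint law, \<open>c\<close> a bound for the density between
  them. After \<open>1 - p \<le> exp (- p)\<close>, convexity of \<open>exp\<close> on the segment
  from 0 to \<open>- L / c\<close> separates the two failure terms.\<close>

lemma covering_bound:
  fixes p k c :: real
  assumes "0 \<le> p" "p \<le> 1" "0 \<le> k" "k \<le> 1" "0 < c" "k \<le> c * p"
  shows "(1 - p) ^ L \<le> (1 - k) + exp (- real L / c)"
proof -
  define x where "x = real L / c"
  have "(1 - p) ^ L \<le> exp (- p) ^ L"
    using assms exp_ge_add_one_self[of "- p"] by (intro power_mono) auto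
  also have "\<dots> = exp (- (real L * p))" by (simp flip: exp_of_nat_mult)
  also have "\<dots> \<le> exp (- (k * x))"
  proof -
    have "k / c \<le> p" using assms by (simp add: field_simps)
    then have "real L * (k / c) \<le> real L * p" by (intro mult_left_mono) auto
    then show ?thesis by (simp add: x_def algebra_simps)
  qed
  also have "\<dots> \<le> (1 - k) * exp 0 + k * exp (- x)"
    using convex_onD[OF exp_convex, of k 0 "- x"] assms by simp
  also have "\<dots> \<le> (1 - k) + 1 * exp (- x)" using assms by (intro add_mono mult_right_mono) auto
  finally show ?thesis by (simp add: x_def)
qed

lemma nn_integral_of_bool_eq:
  assumes "Measurable.pred M P"
  shows "(\<integral>\<^sup>+x. of_bool (P x) \<partial>M) = emeasure M {x \<in> space M. P x}"
proof -
  have "(\<integral>\<^sup>+x. of_bool (P x) \<partial>M) = (\<integral>\<^sup>+x. indicator {x \<in> space M. P x} x \<partial>M)"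
    by (intro nn_integral_cong) (auto simp: indicator_def)
  then show ?thesis using assms by simp
qed

lemma measurable_curry2:
  assumes "(\<lambda>(a, b). f a b) \<in> measurable (M1 \<Otimes>\<^sub>M M2) N" "g \<in> measurable K M1" "h \<in> measurable K M2"
  shows "(\<lambda>x. f (g x) (h x)) \<in> measurable K N"
  using measurable_compose[OF measurable_Pair[OF assms(2,3)] assms(1)] by simp

lemma measurable_curry3:
  assumes "(\<lambda>(a, b, c). f a b c) \<in> measurable (M1 \<Otimes>\<^sub>M M2 \<Otimes>\<^sub>M M3) N"
    "g \<in> measurable K M1" "h \<in> measurable K M2" "k \<in> measurable K M3"
  shows "(\<lambda>x. f (g x) (h x) (k x)) \<in> measurable K N"
  using measurable_compose[OF measurable_Pair[OF assms(2) measurable_Pair[OF assms(3,4)]] assms(1)] by simp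

lemma pred_ge_const:
  fixes f :: "'a \<Rightarrow> real"
  shows "f \<in> borel_measurable M \<Longrightarrow> Measurable.pred M (\<lambda>x. c \<le> f x)"
  by measurable

lemma borel_measurable_of_bool_ennreal:
  "Measurable.pred M P \<Longrightarrow> (\<lambda>x. of_bool (P x) :: ennreal) \<in> borel_measurable M"
  by measurable

lemma pred_neq_disj:
  fixes f g :: "'a \<Rightarrow> nat"
  assumes [measurable]: "f \<in> measurable M (count_space UNIV)" "g \<in> measurable M (count_space UNIV)"
  shows "Measurable.pred M (\<lambda>x. f x \<noteq> m \<or> g x \<noteq> k)"
  by measurable

text \<open>Markov's inequality in the form \<open>1 \<le> w / c\<close> on the event, after
  exchanging the integrals so that the codeword \<open>a\<close>, independent of the output, is
  averaged first.\<close>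

lemma likelihood_false_alarm:
  fixes w :: "'a \<Rightarrow> 'y \<Rightarrow> real"
  assumes A: "prob_space A" and Z: "prob_space Z" and y: "y \<in> measurable Z Y"
    and w: "(\<lambda>(a, y). w a y) \<in> borel_measurable (A \<Otimes>\<^sub>M Y)"
    and int: "\<And>y. y \<in> space Y \<Longrightarrow> (\<integral>\<^sup>+a. ennreal (w a y) \<partial>A) \<le> 1" and c: "0 < c"
  shows "(\<integral>\<^sup>+a. \<integral>\<^sup>+z. of_bool (c \<le> w a (y z)) \<partial>Z \<partial>A) \<le> ennreal (1 / c)"
proof -
  interpret A: prob_space A by fact
  interpret Z: prob_space Z by fact
  interpret AZ: pair_sigma_finite A Z ..
  note [measurable (raw)] = measurable_curry2[OF w]
  have "(\<integral>\<^sup>+a. \<integral>\<^sup>+z. of_bool (c \<le> w a (y z)) \<partial>Z \<partial>A) = (\<integral>\<^sup>+z. \<integral>\<^sup>+a. of_bool (c \<le> w a (y z)) \<partial>A \<partial>Z)"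
    by (rule AZ.Fubini'[symmetric]) (use y in measurable)
  also have "\<dots> \<le> (\<integral>\<^sup>+z. \<integral>\<^sup>+a. ennreal (1 / c) * ennreal (w a (y z)) \<partial>A \<partial>Z)"
    using c by (intro nn_integral_mono)
      (auto simp: ennreal_mult'[symmetric] ennreal_1[symmetric] field_simps simp del: ennreal_1 intro!: ennreal_leI)
  also have "\<dots> \<le> (\<integral>\<^sup>+z. ennreal (1 / c) * 1 \<partial>Z)"
  proof (intro nn_integral_mono)
    fix z assume "z \<in> space Z"
    then have yz: "y z \<in> space Y" by (rule measurable_space[OF y])
    have wm: "(\<lambda>a. w a (y z)) \<in> borel_measurable A"
      by (rule measurable_curry2[OF w _ measurable_const[OF yz]]) simp
    have "(\<integral>\<^sup>+a. ennreal (1 / c) * ennreal (w a (y z)) \<partial>A) = ennreal (1 / c) * (\<integral>\<^sup>+a. ennreal (w a (y z)) \<partial>A)"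
      by (rule nn_integral_cmult) (rule measurable_compose[OF wm measurable_ennreal])
    then show "(\<integral>\<^sup>+a. ennreal (1 / c) * ennreal (w a (y z)) \<partial>A) \<le> ennreal (1 / c) * 1"
      using int[OF yz] by (simp add: mult_left_mono del: mult_1_right)
  qed
  finally show ?thesis by (simp add: Z.emeasure_space_1)
qed

text \<open>Superposition of a codeword \<open>a m1\<close> with a codeword \<open>u (m2, l)\<close> whose index \<open>l\<close> is selected by
  the encoder so that \<open>(a, u)\<close> looks as if it was drawn from the joint law, i.e. \<open>u = \<tau> a b\<close>.  Only
  the density \<open>w0\<close> of that law with respect to independent drawing, and the likelihood ratios \<open>w1\<close>,
  \<open>w2\<close> used by the two decoders, enter the bound.\<close>
theorem one_shot_broadcast_code:
  fixes A :: "'a measure" and U :: "'u measure" and B :: "'b measure" and Z :: "'z measure"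
    and Y1 :: "'y1 measure" and Y2 :: "'y2 measure"
    and w0 :: "'a \<Rightarrow> 'u \<Rightarrow> real" and w1 :: "'a \<Rightarrow> 'y1 \<Rightarrow> real" and w2 :: "'u \<Rightarrow> 'y2 \<Rightarrow> real"
  assumes A: "prob_space A" and U: "prob_space U" and B: "prob_space B" and Z: "prob_space Z"
    and \<tau>: "(\<lambda>(a, b). \<tau> a b) \<in> measurable (A \<Otimes>\<^sub>M B) U"
    and y1: "(\<lambda>(a, u, z). y1 a u z) \<in> measurable (A \<Otimes>\<^sub>M U \<Otimes>\<^sub>M Z) Y1"
    and y2: "(\<lambda>(a, u, z). y2 a u z) \<in> measurable (A \<Otimes>\<^sub>M U \<Otimes>\<^sub>M Z) Y2"
    and ok: "Measurable.pred (A \<Otimes>\<^sub>M U) (\<lambda>(a, u). ok a u)"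
    and w0: "(\<lambda>(a, u). w0 a u) \<in> borel_measurable (A \<Otimes>\<^sub>M U)"
    and w1: "(\<lambda>(a, y). w1 a y) \<in> borel_measurable (A \<Otimes>\<^sub>M Y1)"
    and w2: "(\<lambda>(u, y). w2 u y) \<in> borel_measurable (U \<Otimes>\<^sub>M Y2)"
    and law: "\<And>a S. a \<in> space A \<Longrightarrow> S \<in> sets U \<Longrightarrow>
        emeasure B {b \<in> space B. \<tau> a b \<in> S} \<le> (\<integral>\<^sup>+u. ennreal (w0 a u) * indicator S u \<partial>U)"
    and int1: "\<And>y. y \<in> space Y1 \<Longrightarrow> (\<integral>\<^sup>+a. ennreal (w1 a y) \<partial>A) \<le> 1"
    and int2: "\<And>y. y \<in> space Y2 \<Longrightarrow> (\<integral>\<^sup>+u. ennreal (w2 u y) \<partial>U) \<le> 1"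
    and c: "0 < c0" "0 < c1" "0 < c2" and s: "0 < s" "s < 1"
    and typical: "(\<integral>\<^sup>+a. \<integral>\<^sup>+b. \<integral>\<^sup>+z. of_bool (\<not> ok a (\<tau> a b) \<or> c0 < w0 a (\<tau> a b) \<or>
          w1 a (y1 a (\<tau> a b) z) < c1 \<or> w2 (\<tau> a b) (y2 a (\<tau> a b) z) < c2) \<partial>Z \<partial>B \<partial>A) \<le> ennreal (s\<^sup>2)"
    and M: "1 \<le> M1" "1 \<le> M2" "1 \<le> L"
  obtains g1 g2 a u good where
    "g1 \<in> measurable Y1 (count_space UNIV)" "g2 \<in> measurable Y2 (count_space UNIV)"
    "\<forall>m1<M1. \<forall>m2<M2. good m1 m2 \<longrightarrow> ok (a m1) (u m1 m2)"
    "(1 / real (M1 * M2)) * (\<Sum>m1<M1. \<Sum>m2<M2. if good m1 m2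
        then measure Z {z \<in> space Z. g1 (y1 (a m1) (u m1 m2) z) \<noteq> m1 \<or> g2 (y2 (a m1) (u m1 m2) z) \<noteq> m2} else 1)
      \<le> 3 * s + exp (- real L / c0) + (real M1 - 1) / c1 + (real M2 - 1) * real L / c2"
proof -
  interpret A: prob_space A by fact
  interpret U: prob_space U by fact
  interpret B: prob_space B by fact
  interpret Z: prob_space Z by fact
  note [measurable (raw)] = measurable_curry2[OF \<tau>] measurable_curry3[OF y1] measurable_curry3[OF y2]
    measurable_curry2[OF ok] measurable_curry2[OF w0] measurable_curry2[OF w1] measurable_curry2[OF w2]
  define E where "E a u z \<longleftrightarrow> \<not> ok a u \<or> c0 < w0 a u \<or> w1 a (y1 a u z) < c1 \<or> w2 u (y2 a u z) < c2" for a u z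
  have E: "(\<lambda>(a, u, z). E a u z) \<in> measurable (A \<Otimes>\<^sub>M U \<Otimes>\<^sub>M Z) (count_space UNIV)"
    unfolding E_def by measurable
  note [measurable (raw)] = measurable_curry3[OF E]
  \<comment> \<open>\<open>H a u\<close> is the conditional probability, over the noise, of an
    atypical event for a given pair; \<open>T\<close> below keeps the pairs where it is at most
    \<open>s\<close>. As the average is at most \<open>s\<^sup>2\<close>, Markov's inequality leaves
    bad pairs of joint probability at most \<open>s\<close>.\<close>
  define H where "H a u = (\<integral>\<^sup>+z. of_bool (E a u z) \<partial>Z)" for a u
  have H: "(\<lambda>(a, u). H a u) \<in> borel_measurable (A \<Otimes>\<^sub>M U)"
    unfolding H_def by measurable
  note [measurable (raw)] = measurable_curry2[OF H]
  define T where "T a u \<longleftrightarrow> H a u \<le> ennreal s" for a u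
  have T: "(\<lambda>(a, u). T a u) \<in> measurable (A \<Otimes>\<^sub>M U) (count_space UNIV)"
    unfolding T_def by measurable
  note [measurable (raw)] = measurable_curry2[OF T]
  \<comment> \<open>Failure of \<open>ok\<close> or of the density bound does not depend on the
    noise, so it makes \<open>H a u\<close> equal to 1, beyond \<open>s\<close>.\<close>
  have T_imp: "ok a u \<and> w0 a u \<le> c0" if "T a u" for a u
  proof (rule ccontr)
    assume "\<not> (ok a u \<and> w0 a u \<le> c0)"
    then have "H a u = 1" by (auto simp: H_def E_def Z.emeasure_space_1)
    with that s show False by (simp add: T_def)
  qed
  have F1: "(\<integral>\<^sup>+a. \<integral>\<^sup>+b. of_bool (\<not> T a (\<tau> a b)) \<partial>B \<partial>A) \<le> ennreal s"
  proof -
    have "ennreal s * (\<integral>\<^sup>+a. \<integral>\<^sup>+b. of_bool (\<not> T a (\<tau> a b)) \<partial>B \<partial>A)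
        = (\<integral>\<^sup>+a. \<integral>\<^sup>+b. ennreal s * of_bool (\<not> T a (\<tau> a b)) \<partial>B \<partial>A)"
      by (simp add: nn_integral_cmult cong: nn_integral_cong)
    also have "\<dots> \<le> (\<integral>\<^sup>+a. \<integral>\<^sup>+b. H a (\<tau> a b) \<partial>B \<partial>A)"
      by (intro nn_integral_mono) (auto simp: T_def)
    also have "\<dots> \<le> ennreal (s\<^sup>2)" using typical by (simp add: H_def E_def)
    also have "\<dots> = ennreal s * ennreal s" using s by (simp add: power2_eq_square ennreal_mult)
    finally show ?thesis using s by (simp add: ennreal_mult_le_mult_iff)
  qed
  \<comment> \<open>The set of good \<open>u\<close> has, given \<open>a\<close>, a probability
    under the joint law of at most \<open>c0\<close> times that under independent drawing, as
    \<open>w0\<close> is at most \<open>c0\<close> on it; this is the situation of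
    \<open>covering_bound\<close>.\<close>
  have F2: "(\<integral>\<^sup>+u. of_bool (\<not> T a u) \<partial>U) ^ L \<le> (\<integral>\<^sup>+b. of_bool (\<not> T a (\<tau> a b)) \<partial>B) + ennreal (exp (- real L / c0))"
    if a: "a \<in> space A" for a
  proof -
    note [measurable] = measurable_const[OF a]
    define S where "S = {u \<in> space U. T a u}"
    define S' where "S' = {b \<in> space B. T a (\<tau> a b)}"
    have S: "S \<in> sets U" and S': "S' \<in> sets B" unfolding S_def S'_def using a by measurable
    have \<tau>a: "\<tau> a b \<in> space U" if "b \<in> space B" for b
      using measurable_space[OF \<tau>, of "(a, b)"] a that by (simp add: space_pair_measure)
    have "(\<integral>\<^sup>+u. of_bool (\<not> T a u) \<partial>U) = emeasure U (space U - S)"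
      by (subst nn_integral_of_bool_eq) (use a in \<open>auto simp: S_def intro!: arg_cong[where f = "emeasure U"]\<close>)
    then have 1: "(\<integral>\<^sup>+u. of_bool (\<not> T a u) \<partial>U) = ennreal (1 - U.prob S)"
      using S by (simp add: U.emeasure_eq_measure U.prob_compl)
    have "(\<integral>\<^sup>+b. of_bool (\<not> T a (\<tau> a b)) \<partial>B) = emeasure B (space B - S')"
      by (subst nn_integral_of_bool_eq) (use a in \<open>auto simp: S'_def intro!: arg_cong[where f = "emeasure B"]\<close>)
    then have 2: "(\<integral>\<^sup>+b. of_bool (\<not> T a (\<tau> a b)) \<partial>B) = ennreal (1 - B.prob S')"
      using S' by (simp add: B.emeasure_eq_measure B.prob_compl)
    have "S' = {b \<in> space B. \<tau> a b \<in> S}" using \<tau>a by (auto simp: S'_def S_def)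
    then have "emeasure B S' \<le> (\<integral>\<^sup>+u. ennreal (w0 a u) * indicator S u \<partial>U)" using law[OF a S] by simp
    also have "\<dots> \<le> (\<integral>\<^sup>+u. ennreal c0 * indicator S u \<partial>U)"
      by (intro nn_integral_mono) (auto simp: S_def indicator_def ennreal_leI dest: T_imp)
    also have "\<dots> = ennreal (c0 * U.prob S)"
      using S c by (simp add: nn_integral_cmult U.emeasure_eq_measure ennreal_mult)
    finally have "B.prob S' \<le> c0 * U.prob S"
      using c by (simp add: B.emeasure_eq_measure ennreal_le_iff)
    then have "(1 - U.prob S) ^ L \<le> (1 - B.prob S') + exp (- real L / c0)"
      by (intro covering_bound) (use c in auto)
    then show ?thesis unfolding 1 2 by (simp add: ennreal_power ennreal_leI flip: ennreal_plus)
  qed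
  define \<psi>1 where "\<psi>1 a' a u = (\<integral>\<^sup>+z. of_bool (c1 \<le> w1 a' (y1 a u z)) \<partial>Z)" for a' a u
  define \<psi>2 where "\<psi>2 u' a u = (\<integral>\<^sup>+z. of_bool (c2 \<le> w2 u' (y2 a u z)) \<partial>Z)" for u' a u
  have \<psi>1: "(\<lambda>(a', a, u). \<psi>1 a' a u) \<in> borel_measurable (A \<Otimes>\<^sub>M A \<Otimes>\<^sub>M U)"
    unfolding \<psi>1_def by measurable
  have \<psi>2: "(\<lambda>(u', a, u). \<psi>2 u' a u) \<in> borel_measurable (U \<Otimes>\<^sub>M A \<Otimes>\<^sub>M U)"
    unfolding \<psi>2_def by measurable
  note [measurable (raw)] = measurable_curry3[OF \<psi>1] measurable_curry3[OF \<psi>2]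
  have F3: "(\<integral>\<^sup>+a'. \<psi>1 a' a u \<partial>A) \<le> ennreal (1 / c1)" if a: "a \<in> space A" and u: "u \<in> space U" for a u
    unfolding \<psi>1_def
    by (rule likelihood_false_alarm[OF A Z measurable_curry3[OF y1 measurable_const[OF a] measurable_const[OF u]] w1 int1 c(2)]) simp_all
  have F4: "(\<integral>\<^sup>+u'. \<psi>2 u' a u \<partial>U) \<le> ennreal (1 / c2)" if a: "a \<in> space A" and u: "u \<in> space U" for a u
    unfolding \<psi>2_def
    by (rule likelihood_false_alarm[OF U Z measurable_curry3[OF y2 measurable_const[OF a] measurable_const[OF u]] w2 int2 c(3)]) simp_all
  define J where "J = {..<M2} \<times> {..<L}"
  have finJ: "finite J" by (simp add: J_def)
  define PA where "PA = PiM {..<M1} (\<lambda>_. A)"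
  define PU where "PU = PiM J (\<lambda>_. U)"
  interpret PA: prob_space PA unfolding PA_def by (intro prob_space_PiM A)
  interpret PU: prob_space PU unfolding PU_def by (intro prob_space_PiM U)
  interpret C: pair_prob_space PA PU ..
  have PAc: "(\<lambda>c. c m) \<in> measurable PA A" if "m < M1" for m
    unfolding PA_def using that by (intro measurable_component_singleton) simp
  have PUc: "(\<lambda>c. c j) \<in> measurable PU U" if "j \<in> J" for j
    unfolding PU_def using that by (intro measurable_component_singleton) simp
  have PAs: "ca m \<in> space A" if "ca \<in> space PA" "m < M1" for ca m
    using measurable_space[OF PAc that(1)] that(2) by simp
  have PUs: "cu j \<in> space U" if "cu \<in> space PU" "j \<in> J" for cu j
    using measurable_space[OF PUc that(1)] that(2) by simp
  \<comment> \<open>First index whose word is good together with \<open>a\<close>; the last index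
    \<open>L - 1\<close> serves as default, so that the selection always stays below
    \<open>L\<close>.\<close>
  define sel where "sel m2 a cu = (LEAST l. L - 1 \<le> l \<or> T a (cu (m2, l)))" for m2 a and cu :: "nat \<times> nat \<Rightarrow> 'u"
  have sel_lt: "sel m2 a cu < L" for m2 a cu
  proof -
    have "sel m2 a cu \<le> L - 1" unfolding sel_def by (rule Least_le) simp
    then show ?thesis using M(3) by linarith
  qed
  have sel_T: "T a (cu (m2, sel m2 a cu))" if "l < L" "T a (cu (m2, l))" for l m2 a cu
  proof -
    have "L - 1 \<le> sel m2 a cu \<or> T a (cu (m2, sel m2 a cu))"
      unfolding sel_def by (rule LeastI[of _ "L - 1"]) simp
    moreover have "sel m2 a cu \<le> l" unfolding sel_def by (rule Least_le) (simp add: that)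
    ultimately show ?thesis
    proof (elim disjE)
      assume "L - 1 \<le> sel m2 a cu" "sel m2 a cu \<le> l"
      then have "sel m2 a cu = l" using that(1) by linarith
      then show ?thesis using that(2) by simp
    qed simp
  qed
  define uh where "uh m2 a cu = cu (m2, sel m2 a cu)" for m2 a and cu :: "nat \<times> nat \<Rightarrow> 'u"
  have inJ: "(m2, l) \<in> J" if "m2 < M2" "l < L" for m2 l using that by (simp add: J_def)
  have uh_space: "uh m2 a cu \<in> space U" if "cu \<in> space PU" "m2 < M2" for m2 a cu
    unfolding uh_def by (intro PUs that inJ sel_lt)
  have uh_m: "(\<lambda>(a, cu). uh m2 a cu) \<in> measurable (A \<Otimes>\<^sub>M PU) U" if m2: "m2 < M2" for m2
  proof -
    have P: "Measurable.pred (A \<Otimes>\<^sub>M PU) (\<lambda>x. L - 1 \<le> l \<or> T (fst x) (snd x (m2, l)))" for l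
    proof (cases "L - 1 \<le> l")
      case False
      then have "(m2, l) \<in> J" using m2 by (intro inJ) auto
      from measurable_curry2[OF T measurable_fst measurable_compose[OF measurable_snd PUc[OF this]]]
      show ?thesis using False by simp
    qed simp
    have "(\<lambda>x. sel m2 (fst x) (snd x)) \<in> measurable (A \<Otimes>\<^sub>M PU) (count_space UNIV)"
      unfolding sel_def by (rule measurable_Least) (rule P)
    then have "(\<lambda>x. sel m2 (fst x) (snd x)) \<in> measurable (A \<Otimes>\<^sub>M PU) (count_space {..<L})"
      using sel_lt by (auto simp: measurable_count_space_eq_countable)
    from measurable_compose_countable'[OF _ this, of "\<lambda>l x. snd x (m2, l)" U]
    have "(\<lambda>x. snd x (m2, sel m2 (fst x) (snd x))) \<in> measurable (A \<Otimes>\<^sub>M PU) U"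
      using measurable_compose[OF measurable_snd PUc[OF inJ[OF m2]]] by auto
    then show ?thesis by (simp add: uh_def split_beta')
  qed
  \<comment> \<open>The three sources of failure for one code \<open>c\<close>: no good index, a
    wrong \<open>a\<close> passing the first threshold, a wrong \<open>u\<close> passing the
    second.\<close>
  define \<Phi>0 where "\<Phi>0 m1 m2 c = (\<Prod>l<L. of_bool (\<not> T (fst c m1) (snd c (m2, l))) :: ennreal)"
    for m1 m2 and c :: "(nat \<Rightarrow> 'a) \<times> (nat \<times> nat \<Rightarrow> 'u)"
  define \<Phi>1 where "\<Phi>1 m1 m2 m' c = \<psi>1 (fst c m') (fst c m1) (uh m2 (fst c m1) (snd c))"
    for m1 m2 m' and c :: "(nat \<Rightarrow> 'a) \<times> (nat \<times> nat \<Rightarrow> 'u)"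
  define \<Phi>2 where "\<Phi>2 m1 m2 j c = \<psi>2 (snd c j) (fst c m1) (uh m2 (fst c m1) (snd c))"
    for m1 m2 j and c :: "(nat \<Rightarrow> 'a) \<times> (nat \<times> nat \<Rightarrow> 'u)"
  have fm: "(\<lambda>c. fst c m) \<in> measurable (PA \<Otimes>\<^sub>M PU) A" if "m < M1" for m
    by (rule measurable_compose[OF measurable_fst PAc[OF that]])
  have sm: "(\<lambda>c. snd c j) \<in> measurable (PA \<Otimes>\<^sub>M PU) U" if "j \<in> J" for j
    by (rule measurable_compose[OF measurable_snd PUc[OF that]])
  have um: "(\<lambda>c. uh m2 (fst c m1) (snd c)) \<in> measurable (PA \<Otimes>\<^sub>M PU) U" if "m1 < M1" "m2 < M2" for m1 m2
    by (rule measurable_curry2[OF uh_m[OF that(2)] fm[OF that(1)] measurable_snd])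
  have nT: "(\<lambda>(a, u). of_bool (\<not> T a u) :: ennreal) \<in> borel_measurable (A \<Otimes>\<^sub>M U)"
    by measurable
  have \<Phi>0_m: "\<Phi>0 m1 m2 \<in> borel_measurable (PA \<Otimes>\<^sub>M PU)" if "m1 < M1" "m2 < M2" for m1 m2
    unfolding \<Phi>0_def
    by (intro borel_measurable_prod_ennreal measurable_curry2[OF nT] fm sm inJ that) simp
  have \<Phi>1_m: "\<Phi>1 m1 m2 m' \<in> borel_measurable (PA \<Otimes>\<^sub>M PU)" if "m1 < M1" "m2 < M2" "m' < M1" for m1 m2 m'
    unfolding \<Phi>1_def by (intro measurable_curry3[OF \<psi>1] fm um that)
  have \<Phi>2_m: "\<Phi>2 m1 m2 j \<in> borel_measurable (PA \<Otimes>\<^sub>M PU)" if "m1 < M1" "m2 < M2" "j \<in> J" for m1 m2 j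
    unfolding \<Phi>2_def by (intro measurable_curry3[OF \<psi>2] fm um sm that)
  have I0: "(\<integral>\<^sup>+c. \<Phi>0 m1 m2 c \<partial>(PA \<Otimes>\<^sub>M PU)) \<le> ennreal s + ennreal (exp (- real L / c0))"
    if m: "m1 < M1" "m2 < M2" for m1 m2
  proof -
    have q: "(\<lambda>u. of_bool (\<not> T a u) :: ennreal) \<in> borel_measurable U" if "a \<in> space A" for a
      by (rule measurable_curry2[OF nT measurable_const[OF that]]) simp
    have "(\<integral>\<^sup>+c. \<Phi>0 m1 m2 c \<partial>(PA \<Otimes>\<^sub>M PU)) = (\<integral>\<^sup>+ca. \<integral>\<^sup>+cu. \<Phi>0 m1 m2 (ca, cu) \<partial>PU \<partial>PA)"
      by (rule PU.nn_integral_fst[symmetric]) (rule \<Phi>0_m[OF m])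
    \<comment> \<open>With \<open>ca\<close> frozen, the \<open>L\<close> candidate words of
      \<open>m2\<close> are independent, hence the power.\<close>
    also have "\<dots> = (\<integral>\<^sup>+ca. (\<integral>\<^sup>+u. of_bool (\<not> T (ca m1) u) \<partial>U) ^ L \<partial>PA)"
    proof (rule nn_integral_cong)
      fix ca assume ca: "ca \<in> space PA"
      interpret UP: product_prob_space "\<lambda>_. U" ..
      define h where "h j u = (if fst j = m2 then of_bool (\<not> T (ca m1) u) else 1 :: ennreal)" for j :: "nat \<times> nat" and u
      have "\<Phi>0 m1 m2 (ca, cu) = (\<Prod>j\<in>J. h j (cu j))" for cu
      proof -
        have "(\<Prod>j\<in>J. h j (cu j)) = (\<Prod>j\<in>{m2} \<times> {..<L}. h j (cu j))"
          using m by (intro prod.mono_neutral_right finJ) (auto simp: J_def h_def)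
        also have "\<dots> = (\<Prod>l<L. h (m2, l) (cu (m2, l)))"
          by (rule prod.reindex_bij_witness[of _ "\<lambda>l. (m2, l)" snd]) auto
        finally show ?thesis by (simp add: \<Phi>0_def h_def)
      qed
      then have "(\<integral>\<^sup>+cu. \<Phi>0 m1 m2 (ca, cu) \<partial>PU) = (\<integral>\<^sup>+cu. (\<Prod>j\<in>J. h j (cu j)) \<partial>PU)" by simp
      also have "\<dots> = (\<Prod>j\<in>J. \<integral>\<^sup>+u. h j u \<partial>U)"
        unfolding PU_def
        by (rule UP.product_nn_integral_prod[OF finJ]) (use q[OF PAs[OF ca m(1)]] in \<open>auto simp: h_def\<close>)
      also have "\<dots> = (\<Prod>j\<in>{m2} \<times> {..<L}. \<integral>\<^sup>+u. h j u \<partial>U)"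
      proof -
        have h1: "(\<integral>\<^sup>+u. h j u \<partial>U) = 1" if "fst j \<noteq> m2" for j
          using that by (simp add: h_def U.emeasure_space_1)
        show ?thesis
        proof (rule prod.mono_neutral_right[OF finJ])
          show "\<forall>j\<in>J - {m2} \<times> {..<L}. (\<integral>\<^sup>+u. h j u \<partial>U) = 1"
          proof
            fix j assume "j \<in> J - {m2} \<times> {..<L}"
            then have "fst j \<noteq> m2" by (auto simp: J_def)
            then show "(\<integral>\<^sup>+u. h j u \<partial>U) = 1" by (rule h1)
          qed
        qed (use m in \<open>auto simp: J_def\<close>)
      qed
      also have "\<dots> = (\<Prod>l<L. \<integral>\<^sup>+u. h (m2, l) u \<partial>U)"
        by (rule prod.reindex_bij_witness[of _ "\<lambda>l. (m2, l)" snd]) auto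
      finally show "(\<integral>\<^sup>+cu. \<Phi>0 m1 m2 (ca, cu) \<partial>PU) = (\<integral>\<^sup>+u. of_bool (\<not> T (ca m1) u) \<partial>U) ^ L"
        by (simp add: h_def)
    qed
    also have "\<dots> \<le> (\<integral>\<^sup>+ca. (\<integral>\<^sup>+b. of_bool (\<not> T (ca m1) (\<tau> (ca m1) b)) \<partial>B) + ennreal (exp (- real L / c0)) \<partial>PA)"
      by (intro nn_integral_mono F2 PAs m)
    also have "\<dots> = (\<integral>\<^sup>+a. (\<integral>\<^sup>+b. of_bool (\<not> T a (\<tau> a b)) \<partial>B) + ennreal (exp (- real L / c0)) \<partial>A)"
      unfolding PA_def by (rule nn_integral_PiM_component[OF A]) (use m in auto)
    also have "\<dots> = (\<integral>\<^sup>+a. (\<integral>\<^sup>+b. of_bool (\<not> T a (\<tau> a b)) \<partial>B) \<partial>A) + ennreal (exp (- real L / c0))"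
      by (subst nn_integral_add) (auto simp: A.emeasure_space_1)
    finally show ?thesis using F1 by (meson add_right_mono order_trans)
  qed
  \<comment> \<open>Redrawing the wrong word \<open>m'\<close> affects neither the transmitted
    \<open>a\<close> nor the selected \<open>u\<close>, because of all the first user's words the
    selection reads only number \<open>m1\<close>.\<close>
  have I1: "(\<integral>\<^sup>+c. \<Phi>1 m1 m2 m' c \<partial>(PA \<Otimes>\<^sub>M PU)) \<le> ennreal (1 / c1)"
    if m: "m1 < M1" "m2 < M2" "m' < M1" "m' \<noteq> m1" for m1 m2 m'
  proof -
    have "(\<integral>\<^sup>+c. \<Phi>1 m1 m2 m' c \<partial>(PA \<Otimes>\<^sub>M PU)) = (\<integral>\<^sup>+cu. \<integral>\<^sup>+ca. \<Phi>1 m1 m2 m' (ca, cu) \<partial>PA \<partial>PU)"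
      by (rule C.nn_integral_snd[symmetric]) (rule \<Phi>1_m[OF m(1-3)])
    also have "\<dots> \<le> (\<integral>\<^sup>+cu. ennreal (1 / c1) \<partial>PU)"
    proof (rule nn_integral_mono)
      fix cu assume cu: "cu \<in> space PU"
      show "(\<integral>\<^sup>+ca. \<Phi>1 m1 m2 m' (ca, cu) \<partial>PA) \<le> ennreal (1 / c1)"
        unfolding PA_def
      proof (rule nn_integral_PiM_le_resample[OF A, of _ m'])
        show "(\<lambda>ca. \<Phi>1 m1 m2 m' (ca, cu)) \<in> borel_measurable (Pi\<^sub>M {..<M1} (\<lambda>_. A))"
          using measurable_compose[OF measurable_Pair2'[OF cu, of PA] \<Phi>1_m[OF m(1-3)]] by (simp add: PA_def)
        fix x assume x: "x \<in> space (Pi\<^sub>M ({..<M1} - {m'}) (\<lambda>_. A))"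
        have "x m1 \<in> space A" using x m by (auto simp: space_PiM)
        then have "(\<integral>\<^sup>+y. \<psi>1 y (x m1) (uh m2 (x m1) cu) \<partial>A) \<le> ennreal (1 / c1)"
          by (intro F3 uh_space cu m)
        then show "(\<integral>\<^sup>+y. \<Phi>1 m1 m2 m' (x(m' := y), cu) \<partial>A) \<le> ennreal (1 / c1)"
          using m by (simp add: \<Phi>1_def)
      qed (use m in auto)
    qed
    finally show ?thesis by (simp add: PU.emeasure_space_1)
  qed
  \<comment> \<open>Only words of other messages count, \<open>fst j \<noteq> m2\<close>: the
    selection for \<open>m2\<close> does not read them, and a wrong index within the same message is
    no error.\<close>
  have I2: "(\<integral>\<^sup>+c. \<Phi>2 m1 m2 j c \<partial>(PA \<Otimes>\<^sub>M PU)) \<le> ennreal (1 / c2)"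
    if m: "m1 < M1" "m2 < M2" "j \<in> J" "fst j \<noteq> m2" for m1 m2 j
  proof -
    have "(\<integral>\<^sup>+c. \<Phi>2 m1 m2 j c \<partial>(PA \<Otimes>\<^sub>M PU)) = (\<integral>\<^sup>+ca. \<integral>\<^sup>+cu. \<Phi>2 m1 m2 j (ca, cu) \<partial>PU \<partial>PA)"
      by (rule PU.nn_integral_fst[symmetric]) (rule \<Phi>2_m[OF m(1-3)])
    also have "\<dots> \<le> (\<integral>\<^sup>+ca. ennreal (1 / c2) \<partial>PA)"
    proof (rule nn_integral_mono)
      fix ca assume ca: "ca \<in> space PA"
      show "(\<integral>\<^sup>+cu. \<Phi>2 m1 m2 j (ca, cu) \<partial>PU) \<le> ennreal (1 / c2)"
        unfolding PU_def
      proof (rule nn_integral_PiM_le_resample[OF U finJ m(3)])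
        show "(\<lambda>cu. \<Phi>2 m1 m2 j (ca, cu)) \<in> borel_measurable (Pi\<^sub>M J (\<lambda>_. U))"
          using measurable_compose[OF measurable_Pair1'[OF ca, of PU] \<Phi>2_m[OF m(1-3)]] by (simp add: PU_def)
        fix x assume x: "x \<in> space (Pi\<^sub>M (J - {j}) (\<lambda>_. U))"
        have upd: "(x(j := y)) (m2, l) = x (m2, l)" for y l using m(4) by auto
        have uhx: "uh m2 (ca m1) (x(j := y)) = uh m2 (ca m1) x" for y
          unfolding uh_def sel_def upd by simp
        have "(m2, sel m2 (ca m1) x) \<in> J - {j}" using m sel_lt by (auto simp: J_def)
        then have "uh m2 (ca m1) x \<in> space U" using x unfolding uh_def space_PiM by (auto dest: PiE_mem)
        then have "(\<integral>\<^sup>+y. \<psi>2 y (ca m1) (uh m2 (ca m1) x) \<partial>U) \<le> ennreal (1 / c2)"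
          by (intro F4 PAs ca m)
        then show "(\<integral>\<^sup>+y. \<Phi>2 m1 m2 j (ca, x(j := y)) \<partial>U) \<le> ennreal (1 / c2)"
          by (simp add: \<Phi>2_def uhx)
      qed
    qed
    finally show ?thesis by (simp add: PA.emeasure_space_1)
  qed
  define \<Phi> where "\<Phi> m1 m2 c = \<Phi>0 m1 m2 c + ennreal s + (\<Sum>m'\<in>{..<M1} - {m1}. \<Phi>1 m1 m2 m' c)
      + (\<Sum>j\<in>({..<M2} - {m2}) \<times> {..<L}. \<Phi>2 m1 m2 j c)" for m1 m2 c
  \<comment> \<open>One \<open>s\<close> here is for covering and one for the noise on good pairs.
    The third in the final bound is slack: the mean failure is at most \<open>\<beta>\<close>, so
    some code lies strictly below \<open>\<beta> + s\<close>.\<close>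
  define \<beta> where "\<beta> = 2 * s + exp (- real L / c0) + (real M1 - 1) / c1 + (real M2 - 1) * real L / c2"
  have \<Phi>_m: "\<Phi> m1 m2 \<in> borel_measurable (PA \<Otimes>\<^sub>M PU)" if "m1 < M1" "m2 < M2" for m1 m2
    unfolding \<Phi>_def using that
    by (intro borel_measurable_add borel_measurable_const borel_measurable_sum \<Phi>0_m \<Phi>1_m \<Phi>2_m) (auto simp: J_def)
  have I\<Phi>: "(\<integral>\<^sup>+c. \<Phi> m1 m2 c \<partial>(PA \<Otimes>\<^sub>M PU)) \<le> ennreal \<beta>" if m: "m1 < M1" "m2 < M2" for m1 m2
  proof -
    have mm: "(\<lambda>c. \<Sum>m'\<in>{..<M1} - {m1}. \<Phi>1 m1 m2 m' c) \<in> borel_measurable (PA \<Otimes>\<^sub>M PU)"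
      "(\<lambda>c. \<Sum>j\<in>({..<M2} - {m2}) \<times> {..<L}. \<Phi>2 m1 m2 j c) \<in> borel_measurable (PA \<Otimes>\<^sub>M PU)"
      using m by (intro borel_measurable_sum \<Phi>1_m \<Phi>2_m; auto simp: J_def)+
    have "(\<integral>\<^sup>+c. \<Phi> m1 m2 c \<partial>(PA \<Otimes>\<^sub>M PU)) = (\<integral>\<^sup>+c. \<Phi>0 m1 m2 c \<partial>(PA \<Otimes>\<^sub>M PU)) + ennreal s
        + (\<Sum>m'\<in>{..<M1} - {m1}. \<integral>\<^sup>+c. \<Phi>1 m1 m2 m' c \<partial>(PA \<Otimes>\<^sub>M PU))
        + (\<Sum>j\<in>({..<M2} - {m2}) \<times> {..<L}. \<integral>\<^sup>+c. \<Phi>2 m1 m2 j c \<partial>(PA \<Otimes>\<^sub>M PU))"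
    proof -
      have "(\<integral>\<^sup>+c. (\<Sum>m'\<in>{..<M1} - {m1}. \<Phi>1 m1 m2 m' c) \<partial>(PA \<Otimes>\<^sub>M PU)) =
          (\<Sum>m'\<in>{..<M1} - {m1}. \<integral>\<^sup>+c. \<Phi>1 m1 m2 m' c \<partial>(PA \<Otimes>\<^sub>M PU))"
        using m by (intro nn_integral_sum \<Phi>1_m) auto
      moreover have "(\<integral>\<^sup>+c. (\<Sum>j\<in>({..<M2} - {m2}) \<times> {..<L}. \<Phi>2 m1 m2 j c) \<partial>(PA \<Otimes>\<^sub>M PU)) =
          (\<Sum>j\<in>({..<M2} - {m2}) \<times> {..<L}. \<integral>\<^sup>+c. \<Phi>2 m1 m2 j c \<partial>(PA \<Otimes>\<^sub>M PU))"
        using m by (intro nn_integral_sum \<Phi>2_m) (auto simp: J_def)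
      ultimately show ?thesis
        unfolding \<Phi>_def
        by (simp add: nn_integral_add mm \<Phi>0_m[OF m] C.emeasure_space_1 borel_measurable_add)
    qed
    also have "\<dots> \<le> (ennreal s + ennreal (exp (- real L / c0))) + ennreal s
        + (\<Sum>m'\<in>{..<M1} - {m1}. ennreal (1 / c1)) + (\<Sum>j\<in>({..<M2} - {m2}) \<times> {..<L}. ennreal (1 / c2))"
      using m by (intro add_mono sum_mono I0 I1 I2 order_refl) (auto simp: J_def)
    also have "\<dots> = ennreal \<beta>"
    proof -
      have 1: "(\<Sum>m'\<in>{..<M1} - {m1}. ennreal (1 / c1)) = ennreal ((real M1 - 1) / c1)"
        using m c M by (subst sum_ennreal) (auto simp: of_nat_diff)
      have 2: "(\<Sum>j\<in>({..<M2} - {m2}) \<times> {..<L}. ennreal (1 / c2)) = ennreal ((real M2 - 1) * real L / c2)"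
        using m c M by (subst sum_ennreal) (auto simp: of_nat_diff card_cartesian_product)
      show ?thesis unfolding 1 2 \<beta>_def using s c M by (simp flip: ennreal_plus)
    qed
    finally show ?thesis .
  qed
  define F where "F c = (\<Sum>m1<M1. \<Sum>m2<M2. \<Phi> m1 m2 c)" for c
  have \<beta>0: "0 < \<beta>" unfolding \<beta>_def using s c M by (intro add_pos_nonneg) auto
  have "\<exists>c\<in>space (PA \<Otimes>\<^sub>M PU). F c < ennreal (real (M1 * M2) * (\<beta> + s))"
  proof (rule ccontr)
    assume "\<not> ?thesis"
    then have ge: "ennreal (real (M1 * M2) * (\<beta> + s)) \<le> F c" if "c \<in> space (PA \<Otimes>\<^sub>M PU)" for c
      using that by (auto simp: not_less)
    have "ennreal (real (M1 * M2) * (\<beta> + s)) = (\<integral>\<^sup>+c. ennreal (real (M1 * M2) * (\<beta> + s)) \<partial>(PA \<Otimes>\<^sub>M PU))"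
      by (simp add: C.emeasure_space_1)
    also have "\<dots> \<le> (\<integral>\<^sup>+c. F c \<partial>(PA \<Otimes>\<^sub>M PU))" by (intro nn_integral_mono ge)
    also have "\<dots> = (\<Sum>m1<M1. \<Sum>m2<M2. \<integral>\<^sup>+c. \<Phi> m1 m2 c \<partial>(PA \<Otimes>\<^sub>M PU))"
    proof -
      have "(\<integral>\<^sup>+c. F c \<partial>(PA \<Otimes>\<^sub>M PU)) = (\<Sum>m1<M1. \<integral>\<^sup>+c. (\<Sum>m2<M2. \<Phi> m1 m2 c) \<partial>(PA \<Otimes>\<^sub>M PU))"
        unfolding F_def by (intro nn_integral_sum borel_measurable_sum \<Phi>_m) auto
      also have "\<dots> = (\<Sum>m1<M1. \<Sum>m2<M2. \<integral>\<^sup>+c. \<Phi> m1 m2 c \<partial>(PA \<Otimes>\<^sub>M PU))"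
        by (intro sum.cong refl nn_integral_sum \<Phi>_m) auto
      finally show ?thesis .
    qed
    also have "\<dots> \<le> (\<Sum>m1<M1. \<Sum>m2<M2. ennreal \<beta>)" by (intro sum_mono I\<Phi>) auto
    also have "\<dots> = ennreal (real (M1 * M2) * \<beta>)"
      using \<beta>0 by (simp add: ennreal_mult ennreal_of_nat_eq_real_of_nat mult.assoc)
    finally have "real (M1 * M2) * (\<beta> + s) \<le> real (M1 * M2) * \<beta>"
      using \<beta>0 by (subst (asm) ennreal_le_iff) auto
    then show False using M s by (simp add: mult_le_cancel_left)
  qed
  then obtain c where c_space: "c \<in> space (PA \<Otimes>\<^sub>M PU)" and cF: "F c < ennreal (real (M1 * M2) * (\<beta> + s))"
    by blast
  define ca where "ca = fst c"
  define cu where "cu = snd c"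
  have ca: "ca \<in> space PA" and cu: "cu \<in> space PU"
    using c_space by (auto simp: ca_def cu_def space_pair_measure)
  define u where "u m1 m2 = uh m2 (ca m1) cu" for m1 m2
  define good where "good m1 m2 \<longleftrightarrow> T (ca m1) (u m1 m2)" for m1 m2
  \<comment> \<open>Both decoders return the least message that passes its threshold;
    \<open>M1\<close> and \<open>M2\<close> stop the search when none passes.\<close>
  define g1 where "g1 y = (LEAST m. M1 \<le> m \<or> c1 \<le> w1 (ca m) y)" for y
  define g2 where "g2 y = (LEAST m. M2 \<le> m \<or> (\<exists>l<L. c2 \<le> w2 (cu (m, l)) y))" for y
  have w1m: "(\<lambda>y. w1 a y) \<in> borel_measurable Y1" if "a \<in> space A" for a
    by (rule measurable_curry2[OF w1 measurable_const[OF that]]) simp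
  have w2m: "(\<lambda>y. w2 u y) \<in> borel_measurable Y2" if "u \<in> space U" for u
    by (rule measurable_curry2[OF w2 measurable_const[OF that]]) simp
  have "Measurable.pred Y1 (\<lambda>y. M1 \<le> m \<or> c1 \<le> w1 (ca m) y)" for m
  proof (cases "M1 \<le> m")
    case False
    then have "(\<lambda>y. w1 (ca m) y) \<in> borel_measurable Y1" by (intro w1m PAs ca) simp
    then have "Measurable.pred Y1 (\<lambda>y. c1 \<le> w1 (ca m) y)" by (rule pred_ge_const)
    moreover have "(\<lambda>y. M1 \<le> m \<or> c1 \<le> w1 (ca m) y) = (\<lambda>y. c1 \<le> w1 (ca m) y)" using False by simp
    ultimately show ?thesis by (simp only:)
  qed simp
  then have g1_m: "g1 \<in> measurable Y1 (count_space UNIV)"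
    unfolding g1_def by (rule measurable_Least)
  have "Measurable.pred Y2 (\<lambda>y. M2 \<le> m \<or> (\<exists>l<L. c2 \<le> w2 (cu (m, l)) y))" for m
  proof (cases "M2 \<le> m")
    case False
    have "Measurable.pred Y2 (\<lambda>y. \<exists>l\<in>{..<L}. c2 \<le> w2 (cu (m, l)) y)"
    proof (rule pred_intros_finite)
      fix l assume "l \<in> {..<L}"
      then have "(\<lambda>y. w2 (cu (m, l)) y) \<in> borel_measurable Y2" using False by (intro w2m PUs cu inJ) auto
      then show "Measurable.pred Y2 (\<lambda>y. c2 \<le> w2 (cu (m, l)) y)" by (rule pred_ge_const)
    qed simp
    moreover have "(\<lambda>y. M2 \<le> m \<or> (\<exists>l<L. c2 \<le> w2 (cu (m, l)) y)) = (\<lambda>y. \<exists>l\<in>{..<L}. c2 \<le> w2 (cu (m, l)) y)"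
      using False by auto
    ultimately show ?thesis by (simp only:)
  qed simp
  then have g2_m: "g2 \<in> measurable Y2 (count_space UNIV)"
    unfolding g2_def by (rule measurable_Least)
  define err where "err m1 m2 = (if good m1 m2
      then measure Z {z \<in> space Z. g1 (y1 (ca m1) (u m1 m2) z) \<noteq> m1 \<or> g2 (y2 (ca m1) (u m1 m2) z) \<noteq> m2} else 1)"
    for m1 m2
  have err_le: "ennreal (err m1 m2) \<le> \<Phi> m1 m2 c" if m: "m1 < M1" "m2 < M2" for m1 m2
  proof (cases "good m1 m2")
    case False
    then have "\<not> T (ca m1) (cu (m2, l))" if "l < L" for l
      using sel_T[OF that] by (auto simp: good_def u_def uh_def)
    then have "\<Phi>0 m1 m2 c = 1" by (simp add: \<Phi>0_def ca_def cu_def)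
    then show ?thesis using False by (simp add: err_def \<Phi>_def add.assoc)
  next
    case True
    let ?y1 = "\<lambda>z. y1 (ca m1) (u m1 m2) z" and ?y2 = "\<lambda>z. y2 (ca m1) (u m1 m2) z"
    have sp: "ca m1 \<in> space A" "u m1 m2 \<in> space U"
      unfolding u_def by (intro PAs ca m uh_space cu)+
    have y1z: "?y1 \<in> measurable Z Y1"
      by (rule measurable_curry3[OF y1 measurable_const[OF sp(1)] measurable_const[OF sp(2)]]) simp
    have y2z: "?y2 \<in> measurable Z Y2"
      by (rule measurable_curry3[OF y2 measurable_const[OF sp(1)] measurable_const[OF sp(2)]]) simp
    have Ez: "Measurable.pred Z (E (ca m1) (u m1 m2))"
      by (rule measurable_curry3[OF E measurable_const[OF sp(1)] measurable_const[OF sp(2)]]) simp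
    define f1 where "f1 m' z = (of_bool (c1 \<le> w1 (ca m') (?y1 z)) :: ennreal)" for m' z
    define f2 where "f2 j z = (of_bool (c2 \<le> w2 (cu j) (?y2 z)) :: ennreal)" for j z
    have f1m: "f1 m' \<in> borel_measurable Z" if "m' < M1" for m'
    proof -
      have "(\<lambda>z. w1 (ca m') (?y1 z)) \<in> borel_measurable Z"
        by (rule measurable_compose[OF y1z w1m[OF PAs[OF ca that]]])
      then show ?thesis
        unfolding f1_def by (intro borel_measurable_of_bool_ennreal pred_ge_const)
    qed
    have f2m: "f2 j \<in> borel_measurable Z" if "j \<in> J" for j
    proof -
      have "(\<lambda>z. w2 (cu j) (?y2 z)) \<in> borel_measurable Z"
        by (rule measurable_compose[OF y2z w2m[OF PUs[OF cu that]]])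
      then show ?thesis
        unfolding f2_def by (intro borel_measurable_of_bool_ennreal pred_ge_const)
    qed
    have em: "(\<lambda>z. of_bool (E (ca m1) (u m1 m2) z) :: ennreal) \<in> borel_measurable Z"
      by (rule borel_measurable_of_bool_ennreal[OF Ez])
    have Jsub: "j \<in> J" if "j \<in> ({..<M2} - {m2}) \<times> {..<L}" for j using that by (auto simp: J_def)
    let ?err = "\<lambda>z. g1 (?y1 z) \<noteq> m1 \<or> g2 (?y2 z) \<noteq> m2"
    \<comment> \<open>If the true pair passes both thresholds, a wrong output is a smaller message
      that passes as well, and its term in the union bound equals 1.\<close>
    have pt: "of_bool (?err z) \<le> of_bool (E (ca m1) (u m1 m2) z) + (\<Sum>m'\<in>{..<M1} - {m1}. f1 m' z)
        + (\<Sum>j\<in>({..<M2} - {m2}) \<times> {..<L}. f2 j z)" for z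
    proof (cases "?err z \<and> \<not> E (ca m1) (u m1 m2) z")
      case err: True
      then have pass: "c1 \<le> w1 (ca m1) (?y1 z)" "c2 \<le> w2 (u m1 m2) (?y2 z)" by (auto simp: E_def)
      from err consider "g1 (?y1 z) \<noteq> m1" | "g2 (?y2 z) \<noteq> m2" by blast
      then show ?thesis
      proof cases
        case 1
        let ?m = "g1 (?y1 z)"
        have "?m \<le> m1" unfolding g1_def by (rule Least_le) (simp add: pass)
        moreover have "M1 \<le> ?m \<or> c1 \<le> w1 (ca ?m) (?y1 z)"
          unfolding g1_def by (rule LeastI[of _ m1]) (simp add: pass)
        ultimately have "?m \<in> {..<M1} - {m1}" "f1 ?m z = 1" using 1 m by (auto simp: f1_def)
        then have "1 \<le> (\<Sum>m'\<in>{..<M1} - {m1}. f1 m' z)"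
          using member_le_sum[of ?m "{..<M1} - {m1}" "\<lambda>m'. f1 m' z"] by simp
        then have "1 \<le> of_bool (E (ca m1) (u m1 m2) z) + (\<Sum>m'\<in>{..<M1} - {m1}. f1 m' z)"
          by (rule add_increasing[rotated]) simp
        then have "1 \<le> of_bool (E (ca m1) (u m1 m2) z) + (\<Sum>m'\<in>{..<M1} - {m1}. f1 m' z)
            + (\<Sum>j\<in>({..<M2} - {m2}) \<times> {..<L}. f2 j z)"
          by (rule add_increasing2[rotated]) simp
        then show ?thesis by (rule order_trans[rotated]) simp
      next
        case 2
        let ?m = "g2 (?y2 z)"
        have w: "\<exists>l<L. c2 \<le> w2 (cu (m2, l)) (?y2 z)"
          using pass(2) sel_lt unfolding u_def uh_def by blast
        have "?m \<le> m2" unfolding g2_def by (rule Least_le) (simp add: w)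
        moreover have "M2 \<le> ?m \<or> (\<exists>l<L. c2 \<le> w2 (cu (?m, l)) (?y2 z))"
          unfolding g2_def by (rule LeastI[of _ m2]) (simp add: w)
        ultimately obtain l where l: "l < L" "c2 \<le> w2 (cu (?m, l)) (?y2 z)" "?m < M2" "?m \<noteq> m2" using 2 m by auto
        then have "(?m, l) \<in> ({..<M2} - {m2}) \<times> {..<L}" "f2 (?m, l) z = 1" by (auto simp: f2_def)
        then have "1 \<le> (\<Sum>j\<in>({..<M2} - {m2}) \<times> {..<L}. f2 j z)"
          using member_le_sum[of "(?m, l)" "({..<M2} - {m2}) \<times> {..<L}" "\<lambda>j. f2 j z"] by simp
        then have "1 \<le> of_bool (E (ca m1) (u m1 m2) z) + (\<Sum>m'\<in>{..<M1} - {m1}. f1 m' z)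
            + (\<Sum>j\<in>({..<M2} - {m2}) \<times> {..<L}. f2 j z)"
          by (rule add_increasing[rotated]) simp
        then show ?thesis by (rule order_trans[rotated]) simp
      qed
    next
      case False
      then have "of_bool (?err z) \<le> (of_bool (E (ca m1) (u m1 m2) z) :: ennreal)" by auto
      then show ?thesis by (simp add: add.assoc add_increasing2)
    qed
    have errm: "Measurable.pred Z ?err"
      by (rule pred_neq_disj[OF measurable_compose[OF y1z g1_m] measurable_compose[OF y2z g2_m]])
    have "ennreal (err m1 m2) = (\<integral>\<^sup>+z. of_bool (?err z) \<partial>Z)"
      using True nn_integral_of_bool_eq[OF errm] by (simp add: err_def Z.emeasure_eq_measure)
    also have "\<dots> \<le> (\<integral>\<^sup>+z. of_bool (E (ca m1) (u m1 m2) z) + (\<Sum>m'\<in>{..<M1} - {m1}. f1 m' z)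
        + (\<Sum>j\<in>({..<M2} - {m2}) \<times> {..<L}. f2 j z) \<partial>Z)"
      by (intro nn_integral_mono pt)
    also have "\<dots> = H (ca m1) (u m1 m2) + (\<Sum>m'\<in>{..<M1} - {m1}. \<integral>\<^sup>+z. f1 m' z \<partial>Z)
        + (\<Sum>j\<in>({..<M2} - {m2}) \<times> {..<L}. \<integral>\<^sup>+z. f2 j z \<partial>Z)"
    proof -
      have "(\<integral>\<^sup>+z. (\<Sum>m'\<in>{..<M1} - {m1}. f1 m' z) \<partial>Z) = (\<Sum>m'\<in>{..<M1} - {m1}. \<integral>\<^sup>+z. f1 m' z \<partial>Z)"
        by (intro nn_integral_sum f1m) simp
      moreover have "(\<integral>\<^sup>+z. (\<Sum>j\<in>({..<M2} - {m2}) \<times> {..<L}. f2 j z) \<partial>Z) = (\<Sum>j\<in>({..<M2} - {m2}) \<times> {..<L}. \<integral>\<^sup>+z. f2 j z \<partial>Z)"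
        by (intro nn_integral_sum f2m Jsub)
      moreover have "(\<lambda>z. \<Sum>m'\<in>{..<M1} - {m1}. f1 m' z) \<in> borel_measurable Z"
        by (intro borel_measurable_sum f1m) simp
      moreover have "(\<lambda>z. \<Sum>j\<in>({..<M2} - {m2}) \<times> {..<L}. f2 j z) \<in> borel_measurable Z"
        by (intro borel_measurable_sum f2m Jsub)
      ultimately show ?thesis by (simp add: nn_integral_add em borel_measurable_add H_def)
    qed
    also have "\<dots> \<le> ennreal s + (\<Sum>m'\<in>{..<M1} - {m1}. \<integral>\<^sup>+z. f1 m' z \<partial>Z)
        + (\<Sum>j\<in>({..<M2} - {m2}) \<times> {..<L}. \<integral>\<^sup>+z. f2 j z \<partial>Z)"
      using True by (intro add_right_mono) (simp add: good_def T_def)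
    also have "\<dots> \<le> \<Phi> m1 m2 c"
      unfolding \<Phi>_def \<Phi>1_def \<Phi>2_def \<psi>1_def \<psi>2_def f1_def f2_def u_def ca_def[symmetric] cu_def[symmetric]
      by (intro add_right_mono) simp
    finally show ?thesis .
  qed
  have "ennreal (\<Sum>m1<M1. \<Sum>m2<M2. err m1 m2) \<le> F c"
  proof -
    have "0 \<le> err m1 m2" for m1 m2 by (simp add: err_def)
    then have "ennreal (\<Sum>m1<M1. \<Sum>m2<M2. err m1 m2) = (\<Sum>m1<M1. \<Sum>m2<M2. ennreal (err m1 m2))"
      by (simp add: sum_ennreal sum_nonneg)
    also have "\<dots> \<le> F c" unfolding F_def by (intro sum_mono err_le) auto
    finally show ?thesis .
  qed
  with cF have "ennreal (\<Sum>m1<M1. \<Sum>m2<M2. err m1 m2) < ennreal (real (M1 * M2) * (\<beta> + s))" by simp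
  then have "(\<Sum>m1<M1. \<Sum>m2<M2. err m1 m2) < real (M1 * M2) * (\<beta> + s)"
    using \<beta>0 s by (subst (asm) ennreal_less_iff) (auto simp: err_def intro!: sum_nonneg)
  then have fin: "(1 / real (M1 * M2)) * (\<Sum>m1<M1. \<Sum>m2<M2. err m1 m2) \<le> \<beta> + s"
    using M by (simp add: field_simps)
  show ?thesis
  proof (rule that[of g1 g2 good ca u])
    show "(1 / real (M1 * M2)) * (\<Sum>m1<M1. \<Sum>m2<M2. if good m1 m2
        then measure Z {z \<in> space Z. g1 (y1 (ca m1) (u m1 m2) z) \<noteq> m1 \<or> g2 (y2 (ca m1) (u m1 m2) z) \<noteq> m2} else 1)
      \<le> 3 * s + exp (- real L / c0) + (real M1 - 1) / c1 + (real M2 - 1) * real L / c2"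
      using fin by (simp add: err_def \<beta>_def)
  qed (auto simp: g1_m g2_m good_def dest: T_imp)
qed

section \<open>Gaussian measures\<close>

lemma PiM_density:
  fixes g :: "'i \<Rightarrow> 'a \<Rightarrow> ennreal"
  assumes I: "finite I" and M: "sigma_finite_measure M"
    and g: "\<And>i. g i \<in> borel_measurable M" and D: "\<And>i. sigma_finite_measure (density M (g i))"
  shows "PiM I (\<lambda>i. density M (g i)) = density (PiM I (\<lambda>_. M)) (\<lambda>x. \<Prod>i\<in>I. g i (x i))"
proof -
  interpret M: product_sigma_finite "\<lambda>_. M" using M by (simp add: product_sigma_finite_def)
  interpret D: product_sigma_finite "\<lambda>i. density M (g i)" using D by (simp add: product_sigma_finite_def)
  have gm: "(\<lambda>x. \<Prod>i\<in>I. g i (x i)) \<in> borel_measurable (PiM I (\<lambda>_. M))"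
    by (intro borel_measurable_prod_ennreal measurable_compose[OF _ g] measurable_component_singleton)
  show ?thesis
  proof (rule D.PiM_eqI[OF I, symmetric])
    show "sets (density (PiM I (\<lambda>_. M)) (\<lambda>x. \<Prod>i\<in>I. g i (x i))) = sets (PiM I (\<lambda>i. density M (g i)))"
      unfolding sets_density by (intro sets_PiM_cong) auto
    fix A assume "\<And>i. i \<in> I \<Longrightarrow> A i \<in> sets (density M (g i))"
    then have A: "\<And>i. i \<in> I \<Longrightarrow> A i \<in> sets M" by simp
    have "emeasure (density (PiM I (\<lambda>_. M)) (\<lambda>x. \<Prod>i\<in>I. g i (x i))) (Pi\<^sub>E I A)
        = (\<integral>\<^sup>+x. (\<Prod>i\<in>I. g i (x i)) * indicator (Pi\<^sub>E I A) x \<partial>PiM I (\<lambda>_. M))"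
      by (rule emeasure_density[OF gm]) (intro sets_PiM_I_finite I A)
    also have "\<dots> = (\<integral>\<^sup>+x. (\<Prod>i\<in>I. g i (x i) * indicator (A i) (x i)) \<partial>PiM I (\<lambda>_. M))"
    proof (rule nn_integral_cong)
      fix x assume "x \<in> space (PiM I (\<lambda>_. M))"
      then have "(indicator (Pi\<^sub>E I A) x :: ennreal) = (\<Prod>i\<in>I. indicator (A i) (x i))"
        using I by (auto simp: indicator_def space_PiM PiE_iff prod_zero_iff)
      then show "(\<Prod>i\<in>I. g i (x i)) * indicator (Pi\<^sub>E I A) x = (\<Prod>i\<in>I. g i (x i) * indicator (A i) (x i))"
        by (simp add: prod.distrib)
    qed
    also have "\<dots> = (\<Prod>i\<in>I. \<integral>\<^sup>+x. g i x * indicator (A i) x \<partial>M)"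
      by (rule M.product_nn_integral_prod[OF I])
         (intro borel_measurable_times_ennreal g borel_measurable_indicator A)
    also have "\<dots> = (\<Prod>i\<in>I. emeasure (density M (g i)) (A i))"
      by (intro prod.cong refl emeasure_density[symmetric] g A)
    finally show "emeasure (density (PiM I (\<lambda>_. M)) (\<lambda>x. \<Prod>i\<in>I. g i (x i))) (Pi\<^sub>E I A)
        = (\<Prod>i\<in>I. emeasure (density M (g i)) (A i))" .
  qed
qed

text \<open>Compared on rectangles, where both sides factor over the coordinates. It converts a pair
  of independent blocks into one block of i.i.d. pairs, the form in which laws of large numbers
  apply.\<close>

lemma distr_PiM_zip:
  assumes M: "prob_space M" and N: "prob_space N" and I: "finite I"
  shows "distr (PiM I (\<lambda>_. M) \<Otimes>\<^sub>M PiM I (\<lambda>_. N)) (PiM I (\<lambda>_. M \<Otimes>\<^sub>M N)) (\<lambda>p. \<lambda>i\<in>I. (fst p i, snd p i))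
           = PiM I (\<lambda>_. M \<Otimes>\<^sub>M N)"
proof -
  interpret M: prob_space M by fact
  interpret N: prob_space N by fact
  interpret MN: pair_prob_space M N ..
  interpret PM: product_prob_space "\<lambda>_. M" ..
  interpret PN: product_prob_space "\<lambda>_. N" ..
  interpret PMN: product_prob_space "\<lambda>_. M \<Otimes>\<^sub>M N" ..
  have zm: "(\<lambda>p. \<lambda>i\<in>I. (fst p i, snd p i)) \<in> measurable (PiM I (\<lambda>_. M) \<Otimes>\<^sub>M PiM I (\<lambda>_. N)) (PiM I (\<lambda>_. M \<Otimes>\<^sub>M N))"
    by measurable
  show ?thesis
  proof (rule PMN.PiM_eqI[OF I])
    fix A assume A: "\<And>i. i \<in> I \<Longrightarrow> A i \<in> sets (M \<Otimes>\<^sub>M N)"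
    let ?X = "(\<lambda>p. \<lambda>i\<in>I. (fst p i, snd p i)) -` Pi\<^sub>E I A \<inter> space (PiM I (\<lambda>_. M) \<Otimes>\<^sub>M PiM I (\<lambda>_. N))"
    have X: "?X \<in> sets (PiM I (\<lambda>_. M) \<Otimes>\<^sub>M PiM I (\<lambda>_. N))"
      by (rule measurable_sets[OF zm]) (intro sets_PiM_I_finite I A)
    have ind: "(indicator ?X (f, g) :: ennreal) = (\<Prod>i\<in>I. indicator (A i) (f i, g i))"
      if "f \<in> space (PiM I (\<lambda>_. M))" "g \<in> space (PiM I (\<lambda>_. N))" for f g
      using that I by (auto simp: indicator_def space_pair_measure PiE_iff prod_zero_iff restrict_def extensional_def)
    have Ai: "(\<lambda>y. indicator (A i) (x, y) :: ennreal) \<in> borel_measurable N" if "i \<in> I" "x \<in> space M" for i x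
      using A[OF that(1)] that(2) by measurable
    have Ai2: "(\<lambda>x. \<integral>\<^sup>+y. indicator (A i) (x, y) \<partial>N) \<in> borel_measurable M" if "i \<in> I" for i
      using A[OF that] by measurable
    have "emeasure (distr (PiM I (\<lambda>_. M) \<Otimes>\<^sub>M PiM I (\<lambda>_. N)) (PiM I (\<lambda>_. M \<Otimes>\<^sub>M N)) (\<lambda>p. \<lambda>i\<in>I. (fst p i, snd p i))) (Pi\<^sub>E I A)
        = emeasure (PiM I (\<lambda>_. M) \<Otimes>\<^sub>M PiM I (\<lambda>_. N)) ?X"
      by (rule emeasure_distr[OF zm]) (intro sets_PiM_I_finite I A)
    also have "\<dots> = (\<integral>\<^sup>+f. \<integral>\<^sup>+g. indicator ?X (f, g) \<partial>PiM I (\<lambda>_. N) \<partial>PiM I (\<lambda>_. M))"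
      by (rule sigma_finite_measure.emeasure_pair_measure[OF prob_space_imp_sigma_finite[OF prob_space_PiM[OF N]] X])
    also have "\<dots> = (\<integral>\<^sup>+f. \<integral>\<^sup>+g. (\<Prod>i\<in>I. indicator (A i) (f i, g i)) \<partial>PiM I (\<lambda>_. N) \<partial>PiM I (\<lambda>_. M))"
      by (intro nn_integral_cong ind)
    also have "\<dots> = (\<integral>\<^sup>+f. (\<Prod>i\<in>I. \<integral>\<^sup>+y. indicator (A i) (f i, y) \<partial>N) \<partial>PiM I (\<lambda>_. M))"
      by (intro nn_integral_cong PN.product_nn_integral_prod[OF I] Ai) (auto simp: space_PiM)
    also have "\<dots> = (\<Prod>i\<in>I. \<integral>\<^sup>+x. \<integral>\<^sup>+y. indicator (A i) (x, y) \<partial>N \<partial>M)"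
      by (rule PM.product_nn_integral_prod[OF I Ai2])
    also have "\<dots> = (\<Prod>i\<in>I. emeasure (M \<Otimes>\<^sub>M N) (A i))"
      by (intro prod.cong refl sigma_finite_measure.emeasure_pair_measure[OF prob_space_imp_sigma_finite[OF N], symmetric] A)
    finally show "emeasure (distr (PiM I (\<lambda>_. M) \<Otimes>\<^sub>M PiM I (\<lambda>_. N)) (PiM I (\<lambda>_. M \<Otimes>\<^sub>M N)) (\<lambda>p. \<lambda>i\<in>I. (fst p i, snd p i))) (Pi\<^sub>E I A)
        = (\<Prod>i\<in>I. emeasure (M \<Otimes>\<^sub>M N) (A i))" .
  qed simp
qed

text \<open>Exponents in indicator form treat \<open>i = j\<close>, where the powers add, together
  with \<open>i \<noteq> j\<close>, so that a mixed moment is one product over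
  \<open>I\<close>.\<close>

lemma prod_power_two_deltas:
  fixes x :: "'i \<Rightarrow> 'a::comm_semiring_1"
  assumes "finite I" "i \<in> I" "j \<in> I"
  shows "(\<Prod>k\<in>I. x k ^ (p * of_bool (k = i) + q * of_bool (k = j))) = x i ^ p * x j ^ q"
proof -
  have "(\<Prod>k\<in>I. x k ^ (p * of_bool (k = i) + q * of_bool (k = j)))
      = (\<Prod>k\<in>I. if k = i then x k ^ p else 1) * (\<Prod>k\<in>I. if k = j then x k ^ q else 1)"
    by (auto simp: power_add prod.distrib[symmetric] intro!: prod.cong)
  then show ?thesis using assms by (simp add: prod.delta)
qed

lemma PiM_moment:
  fixes g :: "'a \<Rightarrow> real"
  assumes "prob_space M" "finite I" "i \<in> I" "j \<in> I"
    and int: "\<And>k. k \<le> p + q \<Longrightarrow> integrable M (\<lambda>x. g x ^ k)"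
  shows "integrable (PiM I (\<lambda>_. M)) (\<lambda>x. g (x i) ^ p * g (x j) ^ q)"
    and "(\<integral>x. g (x i) ^ p * g (x j) ^ q \<partial>PiM I (\<lambda>_. M)) =
      (if i = j then (\<integral>x. g x ^ (p + q) \<partial>M) else (\<integral>x. g x ^ p \<partial>M) * (\<integral>x. g x ^ q \<partial>M))"
proof -
  interpret prob_space M by fact
  interpret P: product_prob_space "\<lambda>_. M" ..
  let ?k = "\<lambda>k. p * of_bool (k = i) + q * of_bool (k = j)"
  have eq: "g (x i) ^ p * g (x j) ^ q = (\<Prod>k\<in>I. g (x k) ^ ?k k)" for x
    using prod_power_two_deltas[OF assms(2-4), of "\<lambda>k. g (x k)" p q] by simp
  have i: "integrable M (\<lambda>x. g x ^ ?k k)" for k by (intro int) auto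
  show "integrable (PiM I (\<lambda>_. M)) (\<lambda>x. g (x i) ^ p * g (x j) ^ q)"
    unfolding eq by (rule P.product_integrable_prod[OF assms(2) i])
  have "(\<integral>x. g (x i) ^ p * g (x j) ^ q \<partial>PiM I (\<lambda>_. M)) = (\<Prod>k\<in>I. \<integral>x. g x ^ ?k k \<partial>M)"
    unfolding eq by (rule P.product_integral_prod[OF assms(2) i])
  also have "\<dots> = (if i = j then (\<integral>x. g x ^ (p + q) \<partial>M) else (\<integral>x. g x ^ p \<partial>M) * (\<integral>x. g x ^ q \<partial>M))"
  proof (cases "i = j")
    case True
    have "(\<Prod>k\<in>I. \<integral>x. g x ^ ?k k \<partial>M) = (\<Prod>k\<in>I. if k = i then (\<integral>x. g x ^ (p + q) \<partial>M) else 1)"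
      using True by (intro prod.cong) (auto simp: prob_space)
    then show ?thesis using True assms by (simp add: prod.delta)
  next
    case False
    have "(\<Prod>k\<in>I. \<integral>x. g x ^ ?k k \<partial>M) = (\<Prod>k\<in>I. (if k = i then (\<integral>x. g x ^ p \<partial>M) else 1) * (if k = j then (\<integral>x. g x ^ q \<partial>M) else 1))"
      using False by (intro prod.cong) (auto simp: prob_space)
    then show ?thesis using False assms by (simp add: prod.distrib prod.delta)
  qed
  finally show "(\<integral>x. g (x i) ^ p * g (x j) ^ q \<partial>PiM I (\<lambda>_. M)) =
      (if i = j then (\<integral>x. g x ^ (p + q) \<partial>M) else (\<integral>x. g x ^ p \<partial>M) * (\<integral>x. g x ^ q \<partial>M))" .
qed

text \<open>Chebyshev's inequality: centred products vanish off the diagonal, so the second moment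
  of the sum is \<open>n\<close> times the variance \<open>C\<close>. A constant independent of
  \<open>n\<close> and \<open>\<delta>\<close> lets the block length be chosen after the
  margin.\<close>

theorem weak_law_PiM:
  fixes h :: "'a \<Rightarrow> real"
  assumes M: "prob_space M" and h: "integrable M h" "integrable M (\<lambda>x. (h x)\<^sup>2)"
  obtains C where "0 \<le> C" "\<And>(n::nat) (\<delta>::real). 0 < n \<Longrightarrow> 0 < \<delta> \<Longrightarrow>
    measure (PiM {..<n} (\<lambda>_. M)) {x \<in> space (PiM {..<n} (\<lambda>_. M)). real n * \<delta> \<le> \<bar>(\<Sum>i<n. h (x i)) - real n * (\<integral>x. h x \<partial>M)\<bar>}
      \<le> C / (real n * \<delta>\<^sup>2)"
proof -
  interpret prob_space M by fact
  define m where "m = (\<integral>x. h x \<partial>M)"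
  define g where "g x = h x - m" for x
  define C where "C = (\<integral>x. (g x)\<^sup>2 \<partial>M)"
  have g1: "integrable M g" unfolding g_def using h by simp
  have g2: "integrable M (\<lambda>x. (g x)\<^sup>2)"
    unfolding g_def power2_diff
    by (intro Bochner_Integration.integrable_add Bochner_Integration.integrable_diff
        integrable_mult_left integrable_mult_right h integrable_const)
  have gk: "integrable M (\<lambda>x. g x ^ k)" if "k \<le> 1 + 1" for k
  proof -
    have "k = 0 \<or> k = 1 \<or> k = 2" using that by auto
    then show ?thesis using g1 g2 by auto
  qed
  have g0: "(\<integral>x. g x \<partial>M) = 0" unfolding g_def using h by (simp add: m_def prob_space)
  have C0: "0 \<le> C" unfolding C_def by simp
  show ?thesis
  proof (rule that[OF C0])
    fix n :: nat and \<delta> :: real assume n: "0 < n" and \<delta>: "0 < \<delta>"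
    interpret P: prob_space "PiM {..<n} (\<lambda>_. M)" by (intro prob_space_PiM M)
    define S where "S x = (\<Sum>i<n. g (x i))" for x
    have comp: "(\<lambda>x. x i) \<in> measurable (PiM {..<n} (\<lambda>_. M)) M" if "i < n" for i
      by (rule measurable_component_singleton) (simp add: that)
    have gi: "(\<lambda>x. g (x i)) \<in> borel_measurable (PiM {..<n} (\<lambda>_. M))" if "i < n" for i
      by (rule measurable_compose[OF comp[OF that] borel_measurable_integrable[OF g1]])
    have Sm: "S \<in> borel_measurable (PiM {..<n} (\<lambda>_. M))"
      unfolding S_def by (intro borel_measurable_sum gi) simp
    have S2: "(S x)\<^sup>2 = (\<Sum>i<n. \<Sum>j<n. g (x i) ^ 1 * g (x j) ^ 1)" for x
      by (simp add: S_def power2_eq_square sum_product)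
    have int2: "integrable (PiM {..<n} (\<lambda>_. M)) (\<lambda>x. (S x)\<^sup>2)"
      unfolding S2 by (intro Bochner_Integration.integrable_sum PiM_moment(1)[OF M] gk) auto
    have "(\<integral>x. (S x)\<^sup>2 \<partial>PiM {..<n} (\<lambda>_. M)) = (\<Sum>i<n. \<Sum>j<n. \<integral>x. g (x i) ^ 1 * g (x j) ^ 1 \<partial>PiM {..<n} (\<lambda>_. M))"
      unfolding S2
      by (subst Bochner_Integration.integral_sum, intro Bochner_Integration.integrable_sum PiM_moment(1)[OF M] gk, auto)+
         (auto intro!: sum.cong Bochner_Integration.integral_sum PiM_moment(1)[OF M, of _ _ _ 1 1, simplified] gk[simplified])
    also have "\<dots> = (\<Sum>i<n. \<Sum>j<n. if i = j then C else 0)"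
    proof (intro sum.cong refl)
      fix i j assume "i \<in> {..<n}" "j \<in> {..<n}"
      then show "(\<integral>x. g (x i) ^ 1 * g (x j) ^ 1 \<partial>PiM {..<n} (\<lambda>_. M)) = (if i = j then C else 0)"
        using PiM_moment(2)[OF M _ _ _ gk, of "{..<n}" i j 1 1] by (simp add: C_def g0 numeral_2_eq_2)
    qed
    also have "\<dots> = real n * C" by simp
    finally have ES2: "(\<integral>x. (S x)\<^sup>2 \<partial>PiM {..<n} (\<lambda>_. M)) = real n * C" .
    have "P.prob {x \<in> space (PiM {..<n} (\<lambda>_. M)). real n * \<delta> \<le> \<bar>S x\<bar>} \<le> P.expectation (\<lambda>x. (S x)\<^sup>2) / (real n * \<delta>)\<^sup>2"
    proof -
      have "{x \<in> space (PiM {..<n} (\<lambda>_. M)). real n * \<delta> \<le> \<bar>S x\<bar>} = {x \<in> space (PiM {..<n} (\<lambda>_. M)). (real n * \<delta>)\<^sup>2 \<le> (S x)\<^sup>2}"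
        using n \<delta> by (auto simp: abs_le_square_iff[symmetric])
      then show ?thesis
        using integral_Markov_inequality_measure[OF int2 sets.empty_sets, of "(real n * \<delta>)\<^sup>2"] n \<delta> by simp
    qed
    also have "\<dots> = C / (real n * \<delta>\<^sup>2)" unfolding ES2 using n \<delta> by (simp add: power2_eq_square)
    finally show "measure (PiM {..<n} (\<lambda>_. M)) {x \<in> space (PiM {..<n} (\<lambda>_. M)). real n * \<delta> \<le> \<bar>(\<Sum>i<n. h (x i)) - real n * (\<integral>x. h x \<partial>M)\<bar>}
      \<le> C / (real n * \<delta>\<^sup>2)"
      by (simp add: S_def g_def sum_subtractf m_def)
  qed
qed

section \<open>The standard complex Gaussian as a product over a real basis\<close>

definition half_normal :: "real measure" where
  "half_normal = density lborel (\<lambda>x. ennreal (normal_density 0 (1 / sqrt 2) x))"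

text \<open>Variance one half in each real direction, so that a complex coordinate has mean square
  1, as in \<open>cnormal_vec\<close>. Any Euclidean space is allowed, so that pairs of vectors are
  covered by the same measure.\<close>

definition gaussm :: "'a::euclidean_space measure" where
  "gaussm = density lborel (\<lambda>x. \<Prod>b\<in>Basis. ennreal (normal_density 0 (1 / sqrt 2) (x \<bullet> b)))"

lemma half_normal_density: "normal_density 0 (1 / sqrt 2) x = exp (- x\<^sup>2) / sqrt pi"
  by (simp add: normal_density_def power_divide)

lemma gaussm_density:
  fixes x :: "'a::euclidean_space"
  shows "(\<Prod>b\<in>Basis. normal_density 0 (1 / sqrt 2) (x \<bullet> b)) = exp (- (norm x)\<^sup>2) / sqrt pi ^ DIM('a)"
proof -
  have "(norm x)\<^sup>2 = (\<Sum>b\<in>Basis. (x \<bullet> b)\<^sup>2)"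
    unfolding power2_norm_eq_inner by (subst euclidean_inner) (simp add: power2_eq_square)
  then show ?thesis by (simp add: half_normal_density prod_dividef exp_sum[symmetric] sum_negf)
qed

lemma prob_space_half_normal: "prob_space half_normal"
  unfolding half_normal_def by (rule prob_space_normal_density) simp

lemma gaussm_eq_distr:
  "(gaussm :: 'a::euclidean_space measure) = distr (PiM Basis (\<lambda>_. half_normal)) borel (\<lambda>f. \<Sum>b\<in>Basis. f b *\<^sub>R b)"
proof -
  have sm: "(\<lambda>f. \<Sum>b\<in>Basis. f b *\<^sub>R b) \<in> measurable (PiM Basis (\<lambda>_. lborel)) (borel :: 'a measure)"
    by measurable
  have "PiM (Basis :: 'a set) (\<lambda>_. half_normal)
      = density (PiM Basis (\<lambda>_. lborel)) (\<lambda>x. \<Prod>b\<in>Basis. ennreal (normal_density 0 (1 / sqrt 2) (x b)))"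
    unfolding half_normal_def
    by (rule PiM_density) (auto simp: lborel.sigma_finite_measure_axioms
        intro!: prob_space_imp_sigma_finite prob_space_normal_density)
  moreover have "(\<Prod>b\<in>Basis. ennreal (normal_density 0 (1 / sqrt 2) ((\<Sum>c\<in>Basis. f c *\<^sub>R c) \<bullet> b)))
      = (\<Prod>b\<in>Basis. ennreal (normal_density 0 (1 / sqrt 2) (f b)))" for f :: "'a \<Rightarrow> real"
    by (intro prod.cong) simp_all
  moreover have "(gaussm :: 'a measure) = distr (density (PiM Basis (\<lambda>_. lborel))
      (\<lambda>f. \<Prod>b\<in>Basis. ennreal (normal_density 0 (1 / sqrt 2) ((\<Sum>c\<in>Basis. f c *\<^sub>R c) \<bullet> b)))) borel (\<lambda>f. \<Sum>b\<in>Basis. f b *\<^sub>R b)"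
    unfolding gaussm_def by (subst lborel_eq, subst density_distr) (auto simp: comp_def)
  ultimately show ?thesis by simp
qed

lemma sets_gaussm [simp, measurable_cong]: "sets gaussm = sets borel"
  and space_gaussm [simp]: "space gaussm = UNIV"
  by (simp_all add: gaussm_def)

lemma prob_space_gaussm: "prob_space gaussm"
  unfolding gaussm_eq_distr
  by (intro prob_space.prob_space_distr prob_space_PiM prob_space_half_normal)
     (simp add: half_normal_def measurable_def space_PiM, measurable)

lemma half_normal_moments:
  "integrable half_normal (\<lambda>x. x ^ k)" "(\<integral>x. x \<partial>half_normal) = 0" "(\<integral>x. x\<^sup>2 \<partial>half_normal) = 1 / 2"
proof -
  show "integrable half_normal (\<lambda>x. x ^ k)"
    unfolding half_normal_def
    using integrable_normal_moment[of "1 / sqrt 2" 0 k] by (simp add: integrable_density mult.commute)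
  have "(\<integral>x. x \<partial>half_normal) = (\<integral>x. normal_density 0 (1 / sqrt 2) x * x \<partial>lborel)"
    unfolding half_normal_def by (subst integral_density) auto
  also have "\<dots> = 0" using normal_moment_odd[of "1 / sqrt 2" 0 0] by (simp add: has_bochner_integral_integral_eq)
  finally show "(\<integral>x. x \<partial>half_normal) = 0" .
  have "(\<integral>x. x\<^sup>2 \<partial>half_normal) = (\<integral>x. normal_density 0 (1 / sqrt 2) x * x\<^sup>2 \<partial>lborel)"
    unfolding half_normal_def by (subst integral_density) auto
  also have "\<dots> = 1 / 2" using normal_moment_even[of "1 / sqrt 2" 0 1]
    by (simp add: has_bochner_integral_integral_eq power_divide)
  finally show "(\<integral>x. x\<^sup>2 \<partial>half_normal) = 1 / 2" .
qed

lemma gaussm_sum_measurable: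
  "(\<lambda>f. \<Sum>b\<in>Basis. f b *\<^sub>R b) \<in> measurable (PiM Basis (\<lambda>_. half_normal)) (borel :: 'a::euclidean_space measure)"
proof -
  have "sets (PiM Basis (\<lambda>_. half_normal)) = sets (PiM (Basis::'a set) (\<lambda>_. borel :: real measure))"
    by (intro sets_PiM_cong) (auto simp: half_normal_def)
  then show ?thesis by (subst measurable_cong_sets) (auto, measurable)
qed

lemma gaussm_moments:
  fixes b c :: "'a::euclidean_space"
  assumes "b \<in> Basis" "c \<in> Basis"
  shows "integrable gaussm (\<lambda>x. (x \<bullet> b) ^ p * (x \<bullet> c) ^ q)"
    and "(\<integral>x. (x \<bullet> b) * (x \<bullet> c) \<partial>gaussm) = (if b = c then 1 / 2 else 0)"
proof -
  have m: "(\<lambda>x. (x \<bullet> b) ^ p * (x \<bullet> c) ^ q) \<in> borel_measurable borel" for p q by measurable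
  have s: "(\<Sum>b\<in>Basis. f b *\<^sub>R b) \<bullet> c = f c" if "c \<in> Basis" for f and c :: 'a using that by simp
  show "integrable gaussm (\<lambda>x. (x \<bullet> b) ^ p * (x \<bullet> c) ^ q)"
    unfolding gaussm_eq_distr integrable_distr_eq[OF gaussm_sum_measurable m] s[OF assms(1)] s[OF assms(2)]
    by (intro PiM_moment(1)[where g = "\<lambda>x. x"] prob_space_half_normal assms half_normal_moments) simp
  have "(\<integral>x. (x \<bullet> b) ^ 1 * (x \<bullet> c) ^ 1 \<partial>gaussm) = (\<integral>f. f b ^ 1 * f c ^ 1 \<partial>PiM Basis (\<lambda>_. half_normal))"
    unfolding gaussm_eq_distr integral_distr[OF gaussm_sum_measurable m] s[OF assms(1)] s[OF assms(2)] ..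
  also have "\<dots> = (if b = c then 1 / 2 else 0)"
    by (subst PiM_moment(2)[where g = "\<lambda>x. x"])
       (auto simp: prob_space_half_normal assms half_normal_moments half_normal_moments(3)[unfolded power2_eq_square])
  finally show "(\<integral>x. (x \<bullet> b) * (x \<bullet> c) \<partial>gaussm) = (if b = c then 1 / 2 else 0)" by simp
qed

text \<open>Expanding in the basis reduces the mean to covariances of coordinates. The fourth
  moment, estimated through a bound of \<open>L\<close>, provides the finite variance that
  \<open>weak_law_PiM\<close> asks for.\<close>

lemma gaussm_linear_second_moment:
  fixes L :: "'a::euclidean_space \<Rightarrow> 'b::euclidean_space"
  assumes L: "linear L"
  shows "integrable gaussm (\<lambda>x. (norm (L x))\<^sup>2)" "integrable gaussm (\<lambda>x. ((norm (L x))\<^sup>2)\<^sup>2)"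
    "(\<integral>x. (norm (L x))\<^sup>2 \<partial>gaussm) = (\<Sum>b\<in>Basis. (norm (L b))\<^sup>2) / 2"
proof -
  have eq: "(norm (L x))\<^sup>2 = (\<Sum>b\<in>Basis. \<Sum>c\<in>Basis. (L b \<bullet> L c) * ((x \<bullet> b) ^ 1 * (x \<bullet> c) ^ 1))" for x
  proof -
    have "L x = L (\<Sum>b\<in>Basis. (x \<bullet> b) *\<^sub>R b)" by (simp add: euclidean_representation)
    also have "\<dots> = (\<Sum>b\<in>Basis. (x \<bullet> b) *\<^sub>R L b)" using L by (simp add: linear_sum linear_scale)
    finally have Lx: "L x = (\<Sum>b\<in>Basis. (x \<bullet> b) *\<^sub>R L b)" .
    have "(\<Sum>b\<in>Basis. u b) \<bullet> (\<Sum>c\<in>Basis. u c) = (\<Sum>b\<in>Basis. \<Sum>c\<in>Basis. u b \<bullet> u c)" for u :: "'a \<Rightarrow> 'b"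
      by (simp only: inner_sum_left, simp only: inner_sum_right)
    then show ?thesis
      unfolding power2_norm_eq_inner Lx by (simp add: algebra_simps)
  qed
  show i1: "integrable gaussm (\<lambda>x. (norm (L x))\<^sup>2)"
    unfolding eq by (intro Bochner_Integration.integrable_sum integrable_mult_right gaussm_moments(1))
  have "(\<integral>x. (norm (L x))\<^sup>2 \<partial>gaussm) = (\<Sum>b\<in>Basis. \<Sum>c\<in>Basis. (L b \<bullet> L c) * (if b = c then 1 / 2 else 0))"
    unfolding eq
    by (subst Bochner_Integration.integral_sum, intro Bochner_Integration.integrable_sum integrable_mult_right gaussm_moments(1), assumption, assumption,
        intro sum.cong refl,
        subst Bochner_Integration.integral_sum, intro Bochner_Integration.integrable_sum integrable_mult_right gaussm_moments(1), assumption, assumption,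
        intro sum.cong refl)
       (simp add: gaussm_moments(2))
  also have "\<dots> = (\<Sum>b\<in>Basis. (norm (L b))\<^sup>2) / 2"
    by (simp add: if_distrib power2_norm_eq_inner sum_divide_distrib cong: if_cong)
  finally show "(\<integral>x. (norm (L x))\<^sup>2 \<partial>gaussm) = (\<Sum>b\<in>Basis. (norm (L b))\<^sup>2) / 2" .
  obtain K where K: "\<And>x. norm (L x) \<le> norm x * K" "0 \<le> K"
    using bounded_linear.nonneg_bounded[OF linear_conv_bounded_linear[THEN iffD1, OF L]] by blast
  have n4: "((norm (x::'a))\<^sup>2)\<^sup>2 = (\<Sum>b\<in>Basis. \<Sum>c\<in>Basis. (x \<bullet> b) ^ 2 * (x \<bullet> c) ^ 2)" for x
  proof -
    have "(norm x)\<^sup>2 = (\<Sum>b\<in>Basis. (x \<bullet> b)\<^sup>2)"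
      unfolding power2_norm_eq_inner by (subst euclidean_inner) (simp add: power2_eq_square)
    then show ?thesis by (simp add: power2_eq_square[of "sum _ _"] sum_product)
  qed
  have "integrable gaussm (\<lambda>x::'a. (K\<^sup>2)\<^sup>2 * ((norm x)\<^sup>2)\<^sup>2)"
    unfolding n4 by (intro integrable_mult_right Bochner_Integration.integrable_sum gaussm_moments(1))
  then show "integrable gaussm (\<lambda>x. ((norm (L x))\<^sup>2)\<^sup>2)"
  proof (rule Bochner_Integration.integrable_bound)
    show "(\<lambda>x. ((norm (L x))\<^sup>2)\<^sup>2) \<in> borel_measurable gaussm"
      using borel_measurable_integrable[OF i1] by (rule borel_measurable_power)
    show "AE x in gaussm. norm (((norm (L x))\<^sup>2)\<^sup>2) \<le> norm ((K\<^sup>2)\<^sup>2 * ((norm x)\<^sup>2)\<^sup>2)"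
    proof (rule AE_I2)
      fix x :: 'a
      have "((norm (L x))\<^sup>2)\<^sup>2 \<le> ((norm x * K)\<^sup>2)\<^sup>2" by (intro power_mono K) auto
      then show "norm (((norm (L x))\<^sup>2)\<^sup>2) \<le> norm ((K\<^sup>2)\<^sup>2 * ((norm x)\<^sup>2)\<^sup>2)"
        by (simp add: power_mult_distrib mult.commute)
    qed
  qed
qed

lemma gaussm_pair: "gaussm \<Otimes>\<^sub>M gaussm = (gaussm :: ('a::euclidean_space \<times> 'b::euclidean_space) measure)"
proof -
  have "gaussm \<Otimes>\<^sub>M gaussm = density (lborel \<Otimes>\<^sub>M lborel)
     (\<lambda>(x::'a, y::'b). (\<Prod>b\<in>Basis. ennreal (normal_density 0 (1 / sqrt 2) (x \<bullet> b))) * (\<Prod>b\<in>Basis. ennreal (normal_density 0 (1 / sqrt 2) (y \<bullet> b))))"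
    unfolding gaussm_def
    by (rule pair_measure_density)
       (auto simp: lborel.sigma_finite_measure_axioms gaussm_def[symmetric] prob_space_gaussm
         intro!: prob_space_imp_sigma_finite)
  also have "\<dots> = gaussm"
    unfolding gaussm_def lborel_prod
  proof (rule density_cong)
    have "((\<Prod>b\<in>Basis. ennreal (normal_density 0 (1 / sqrt 2) (x \<bullet> b))) * (\<Prod>b\<in>Basis. ennreal (normal_density 0 (1 / sqrt 2) (y \<bullet> b))))
        = (\<Prod>b\<in>Basis. ennreal (normal_density 0 (1 / sqrt 2) ((x, y) \<bullet> b)))" for x :: 'a and y :: 'b
    proof -
      have "(\<Prod>b\<in>(Basis :: ('a \<times> 'b) set). ennreal (normal_density 0 (1 / sqrt 2) ((x, y) \<bullet> b)))
        = (\<Prod>b\<in>(\<lambda>u. (u, 0)) ` Basis. ennreal (normal_density 0 (1 / sqrt 2) ((x, y) \<bullet> b)))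
        * (\<Prod>b\<in>(\<lambda>v. (0, v)) ` Basis. ennreal (normal_density 0 (1 / sqrt 2) ((x, y) \<bullet> b)))"
        unfolding Basis_prod_def by (rule prod.union_disjoint) (auto dest: nonzero_Basis)
      then show ?thesis by (simp add: prod.reindex inj_on_def)
    qed
    then show "AE z in lborel. (case z of (x::'a, y::'b) \<Rightarrow> (\<Prod>b\<in>Basis. ennreal (normal_density 0 (1 / sqrt 2) (x \<bullet> b)))
       * (\<Prod>b\<in>Basis. ennreal (normal_density 0 (1 / sqrt 2) (y \<bullet> b))))
       = (\<Prod>b\<in>Basis. ennreal (normal_density 0 (1 / sqrt 2) (z \<bullet> b)))"
      by auto
    have "(\<lambda>z. (\<Prod>b\<in>Basis. ennreal (normal_density 0 (1 / sqrt 2) (fst z \<bullet> b))) * (\<Prod>b\<in>Basis. ennreal (normal_density 0 (1 / sqrt 2) (snd z \<bullet> b))))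
        \<in> borel_measurable (borel \<Otimes>\<^sub>M borel :: ('a \<times> 'b) measure)" by measurable
    then show "(\<lambda>(x, y). (\<Prod>b\<in>Basis. ennreal (normal_density 0 (1 / sqrt 2) (x \<bullet> b))) * (\<Prod>b\<in>Basis. ennreal (normal_density 0 (1 / sqrt 2) (y \<bullet> b))))
        \<in> borel_measurable (lborel :: ('a \<times> 'b) measure)"
      unfolding borel_prod by (simp add: split_beta')
  qed auto
  finally show ?thesis .
qed

lemma sum_Basis_cvec:
  fixes f :: "complex^'t \<Rightarrow> 'b::comm_monoid_add"
  shows "(\<Sum>b\<in>Basis. f b) = (\<Sum>i\<in>UNIV. f (axis i 1) + f (axis i \<i>))"
proof -
  have "(\<Sum>b\<in>Basis. f b) = (\<Sum>p\<in>UNIV \<times> {1, \<i>}. f (axis (fst p) (snd p)))"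
  proof (rule sum.reindex_cong[of "\<lambda>p. axis (fst p) (snd p)"])
    show "inj_on (\<lambda>p. axis (fst p) (snd p)) (UNIV \<times> {1, \<i>})"
      by (auto simp: inj_on_def axis_eq_axis)
    show "Basis = (\<lambda>p. axis (fst p) (snd p)) ` (UNIV \<times> {1, \<i>})"
      by (auto simp: Basis_vec_def Basis_complex_def image_def)
  qed simp
  also have "\<dots> = (\<Sum>i\<in>UNIV. \<Sum>u\<in>{1, \<i>}. f (axis i u))"
    by (simp only: sum.cartesian_product split_beta')
  finally show ?thesis by simp
qed

lemma prod_Basis_cvec:
  fixes f :: "complex^'t \<Rightarrow> 'b::comm_monoid_mult"
  shows "(\<Prod>b\<in>Basis. f b) = (\<Prod>i\<in>UNIV. f (axis i 1) * f (axis i \<i>))"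
proof -
  have "(\<Prod>b\<in>Basis. f b) = (\<Prod>p\<in>UNIV \<times> {1, \<i>}. f (axis (fst p) (snd p)))"
  proof (rule prod.reindex_cong[of "\<lambda>p. axis (fst p) (snd p)"])
    show "inj_on (\<lambda>p. axis (fst p) (snd p)) (UNIV \<times> {1, \<i>})"
      by (auto simp: inj_on_def axis_eq_axis)
    show "Basis = (\<lambda>p. axis (fst p) (snd p)) ` (UNIV \<times> {1, \<i>})"
      by (auto simp: Basis_vec_def Basis_complex_def image_def)
  qed simp
  also have "\<dots> = (\<Prod>i\<in>UNIV. \<Prod>u\<in>{1, \<i>}. f (axis i u))"
    by (simp only: prod.cartesian_product split_beta')
  finally show ?thesis by simp
qed

lemma inner_axis_cvec: "x \<bullet> axis i (1::complex) = Re (x $ i)" "x \<bullet> axis i \<i> = Im (x $ i)"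
  by (simp_all add: inner_axis inner_complex_def)

lemma cnormal_vec_eq_gaussm: "cnormal_vec = (gaussm :: (complex^'r) measure)"
  unfolding cnormal_vec_def gaussm_def
proof (rule density_cong)
  have eq: "ennreal (\<Prod>i\<in>UNIV. exp (- (cmod (z $ i))\<^sup>2) / pi) = (\<Prod>b\<in>Basis. ennreal (normal_density 0 (1 / sqrt 2) (z \<bullet> b)))"
    for z :: "complex^'r"
  proof -
    have "(exp (- (Re (z $ i))\<^sup>2) / sqrt pi) * (exp (- (Im (z $ i))\<^sup>2) / sqrt pi) = exp (- (cmod (z $ i))\<^sup>2) / pi" for i
      by (simp add: cmod_power2 exp_add[symmetric] algebra_simps)
    then have "(\<Prod>b\<in>Basis. normal_density 0 (1 / sqrt 2) (z \<bullet> b)) = (\<Prod>i\<in>UNIV. exp (- (cmod (z $ i))\<^sup>2) / pi)"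
      unfolding prod_Basis_cvec inner_axis_cvec half_normal_density by simp
    then show ?thesis by (simp add: prod_ennreal)
  qed
  show "AE z in lborel. ennreal (\<Prod>i\<in>UNIV. exp (- (cmod (z $ i))\<^sup>2) / pi)
      = (\<Prod>b\<in>Basis. ennreal (normal_density 0 (1 / sqrt 2) ((z :: complex^'r) \<bullet> b)))"
    by (rule AE_I2) (rule eq)
  have "(\<lambda>z :: complex^'r. \<Prod>i\<in>UNIV. exp (- (cmod (z $ i))\<^sup>2) / pi) \<in> borel_measurable borel"
    by (intro borel_measurable_continuous_onI continuous_intros) simp
  then show "(\<lambda>z :: complex^'r. ennreal (\<Prod>i\<in>UNIV. exp (- (cmod (z $ i))\<^sup>2) / pi)) \<in> borel_measurable lborel"
    by simp
qed auto

text \<open>Translation invariance of Lebesgue measure leaves a quotient of two Gaussian densities.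
  Products of such factors form the density of the selected auxiliary word relative to an
  independent one.\<close>

lemma gaussm_shift:
  fixes v :: "'a::euclidean_space"
  shows "distr gaussm borel (\<lambda>b. v + b) = density gaussm (\<lambda>u. ennreal (exp ((norm u)\<^sup>2 - (norm (u - v))\<^sup>2)))"
proof -
  define g where "g x = ennreal (exp (- (norm x)\<^sup>2) / sqrt pi ^ DIM('a))" for x :: 'a
  have [measurable]: "g \<in> borel_measurable borel" unfolding g_def by measurable
  have G: "gaussm = density lborel g"
    unfolding gaussm_def g_def gaussm_density[symmetric] by (simp add: prod_ennreal)
  have "distr (density lborel g) borel (\<lambda>b. v + b) = density (distr lborel borel (\<lambda>b. v + b)) (\<lambda>u. g (u - v))"
    by (subst density_distr) auto
  also have "distr lborel borel (\<lambda>b. v + b) = lborel" by (rule lborel_distr_plus)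
  also have "density lborel (\<lambda>u. g (u - v)) = density (density lborel g) (\<lambda>u. ennreal (exp ((norm u)\<^sup>2 - (norm (u - v))\<^sup>2)))"
  proof (subst density_density_eq)
    have "g u * ennreal (exp ((norm u)\<^sup>2 - (norm (u - v))\<^sup>2)) = g (u - v)" for u
      by (simp add: g_def ennreal_mult'[symmetric] exp_diff exp_minus field_simps)
    then show "density lborel (\<lambda>u. g (u - v)) = density lborel (\<lambda>x. g x * ennreal (exp ((norm x)\<^sup>2 - (norm (x - v))\<^sup>2)))"
      by simp
  qed auto
  finally show ?thesis unfolding G .
qed

lemma gaussm_PiM_shift:
  fixes v :: "'i \<Rightarrow> 'a::euclidean_space"
  assumes I: "finite I" and S: "S \<in> sets (PiM I (\<lambda>_. gaussm))"
  shows "emeasure (PiM I (\<lambda>_. gaussm)) {b \<in> space (PiM I (\<lambda>_. gaussm)). (\<lambda>i\<in>I. v i + b i) \<in> S}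
     = (\<integral>\<^sup>+u. ennreal (exp (\<Sum>i\<in>I. (norm (u i))\<^sup>2 - (norm (u i - v i))\<^sup>2)) * indicator S u \<partial>PiM I (\<lambda>_. gaussm))"
proof -
  let ?\<gamma> = "gaussm :: 'a measure"
  let ?w = "\<lambda>i u. ennreal (exp ((norm u)\<^sup>2 - (norm (u - v i))\<^sup>2))"
  interpret \<gamma>: prob_space ?\<gamma> by (rule prob_space_gaussm)
  interpret P: product_prob_space "\<lambda>_. ?\<gamma>" ..
  have Dp: "prob_space (density ?\<gamma> (?w i))" for i
    unfolding gaussm_shift[symmetric] by (intro prob_space.prob_space_distr prob_space_gaussm) simp
  interpret D: product_prob_space "\<lambda>i. density ?\<gamma> (?w i)" using Dp by (intro product_prob_spaceI)
  have m: "(\<lambda>b. \<lambda>i\<in>I. v i + b i) \<in> measurable (PiM I (\<lambda>_. ?\<gamma>)) (PiM I (\<lambda>_. ?\<gamma>))"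
    by measurable
  have "distr (PiM I (\<lambda>_. ?\<gamma>)) (PiM I (\<lambda>_. ?\<gamma>)) (\<lambda>b. \<lambda>i\<in>I. v i + b i) = PiM I (\<lambda>i. density ?\<gamma> (?w i))"
  proof (rule D.PiM_eqI[OF I])
    show "sets (distr (PiM I (\<lambda>_. ?\<gamma>)) (PiM I (\<lambda>_. ?\<gamma>)) (\<lambda>b. \<lambda>i\<in>I. v i + b i)) = sets (PiM I (\<lambda>i. density ?\<gamma> (?w i)))"
      unfolding sets_distr by (intro sets_PiM_cong) auto
    fix A assume "\<And>i. i \<in> I \<Longrightarrow> A i \<in> sets (density ?\<gamma> (?w i))"
    then have A: "\<And>i. i \<in> I \<Longrightarrow> A i \<in> sets borel" by simp
    let ?A = "\<lambda>i. (\<lambda>b. v i + b) -` A i"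
    have A': "?A i \<in> sets ?\<gamma>" if "i \<in> I" for i
      using measurable_sets[of "\<lambda>b. v i + b" ?\<gamma> borel "A i"] A[OF that] by simp
    have "emeasure (distr (PiM I (\<lambda>_. ?\<gamma>)) (PiM I (\<lambda>_. ?\<gamma>)) (\<lambda>b. \<lambda>i\<in>I. v i + b i)) (Pi\<^sub>E I A)
        = emeasure (PiM I (\<lambda>_. ?\<gamma>)) ((\<lambda>b. \<lambda>i\<in>I. v i + b i) -` Pi\<^sub>E I A \<inter> space (PiM I (\<lambda>_. ?\<gamma>)))"
      by (rule emeasure_distr[OF m]) (auto intro!: sets_PiM_I_finite I A)
    also have "(\<lambda>b. \<lambda>i\<in>I. v i + b i) -` Pi\<^sub>E I A \<inter> space (PiM I (\<lambda>_. ?\<gamma>)) = Pi\<^sub>E I ?A"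
      by (auto simp: space_PiM PiE_iff)
    also have "emeasure (PiM I (\<lambda>_. ?\<gamma>)) (Pi\<^sub>E I ?A) = (\<Prod>i\<in>I. emeasure ?\<gamma> (?A i))"
      by (rule P.emeasure_PiM[OF I A'])
    also have "\<dots> = (\<Prod>i\<in>I. emeasure (density ?\<gamma> (?w i)) (A i))"
      unfolding gaussm_shift[symmetric] by (intro prod.cong refl) (simp add: emeasure_distr A)
    finally show "emeasure (distr (PiM I (\<lambda>_. ?\<gamma>)) (PiM I (\<lambda>_. ?\<gamma>)) (\<lambda>b. \<lambda>i\<in>I. v i + b i)) (Pi\<^sub>E I A)
        = (\<Prod>i\<in>I. emeasure (density ?\<gamma> (?w i)) (A i))" .
  qed
  also have "PiM I (\<lambda>i. density ?\<gamma> (?w i)) = density (PiM I (\<lambda>_. ?\<gamma>)) (\<lambda>u. \<Prod>i\<in>I. ?w i (u i))"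
    by (rule PiM_density[OF I]) (auto intro!: prob_space_imp_sigma_finite prob_space_gaussm Dp)
  finally have eq: "distr (PiM I (\<lambda>_. ?\<gamma>)) (PiM I (\<lambda>_. ?\<gamma>)) (\<lambda>b. \<lambda>i\<in>I. v i + b i)
      = density (PiM I (\<lambda>_. ?\<gamma>)) (\<lambda>u. \<Prod>i\<in>I. ?w i (u i))" .
  have "emeasure (PiM I (\<lambda>_. ?\<gamma>)) {b \<in> space (PiM I (\<lambda>_. ?\<gamma>)). (\<lambda>i\<in>I. v i + b i) \<in> S}
      = emeasure (distr (PiM I (\<lambda>_. ?\<gamma>)) (PiM I (\<lambda>_. ?\<gamma>)) (\<lambda>b. \<lambda>i\<in>I. v i + b i)) S"
    by (subst emeasure_distr[OF m S]) (auto intro!: arg_cong[where f = "emeasure _"])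
  also have "\<dots> = (\<integral>\<^sup>+u. (\<Prod>i\<in>I. ?w i (u i)) * indicator S u \<partial>PiM I (\<lambda>_. ?\<gamma>))"
    unfolding eq by (rule emeasure_density[OF _ S]) measurable
  finally show ?thesis using I by (simp add: prod_ennreal exp_sum)
qed

text \<open>Relative to the standard measure, the integrand is the density of a Gaussian with centre
  \<open>v\<close> and mean square \<open>1 / d i\<close> in coordinate \<open>i\<close>; hence
  total mass 1 for every \<open>v\<close>. The decoders use it with \<open>v\<close> estimated from
  the output.\<close>

lemma gaussm_diag_likelihood:
  fixes d :: "'t::finite \<Rightarrow> real" and v :: "complex^'t"
  assumes d: "\<And>i. 0 < d i"
  shows "(\<integral>\<^sup>+u. ennreal (exp ((norm u)\<^sup>2 + (\<Sum>i\<in>UNIV. ln (d i)) - (\<Sum>i\<in>UNIV. d i * (cmod ((u - v) $ i))\<^sup>2))) \<partial>gaussm) = 1"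
proof -
  \<comment> \<open>Both real directions of coordinate \<open>i\<close> carry the same
    \<open>d i\<close>; as a quadratic form, \<open>e\<close> assigns it to each basis vector
    without naming the coordinate.\<close>
  define e where "e b = (\<Sum>i\<in>UNIV. d i * (cmod (b $ i))\<^sup>2)" for b :: "complex^'t"
  have e: "e (axis i 1) = d i" "e (axis i \<i>) = d i" for i
  proof -
    have "(cmod (axis i x $ j))\<^sup>2 = (if j = i then (cmod x)\<^sup>2 else 0)" for j x by (simp add: axis_def)
    then show "e (axis i 1) = d i" "e (axis i \<i>) = d i" by (simp_all add: e_def mult_delta_right)
  qed
  have epos: "0 < e b" if "b \<in> Basis" for b
    using that d by (auto simp: Basis_vec_def Basis_complex_def e)
  define f where "f b x = ennreal (normal_density (v \<bullet> b) (1 / sqrt (2 * e b)) x)" for b x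
  have sum_ln: "exp (\<Sum>i\<in>UNIV. ln (d i)) = (\<Prod>i\<in>UNIV. d i)" using d by (simp add: exp_sum)
  have q: "(\<Sum>i\<in>UNIV. d i * (cmod (w $ i))\<^sup>2) = (\<Sum>i\<in>UNIV. d i * (Re (w $ i))\<^sup>2 + d i * (Im (w $ i))\<^sup>2)" for w :: "complex^'t"
    by (simp add: cmod_power2 algebra_simps)
  have "(\<integral>\<^sup>+u. ennreal (exp ((norm u)\<^sup>2 + (\<Sum>i\<in>UNIV. ln (d i)) - (\<Sum>i\<in>UNIV. d i * (cmod ((u - v) $ i))\<^sup>2))) \<partial>gaussm)
      = (\<integral>\<^sup>+u. (\<Prod>b\<in>Basis. ennreal (normal_density 0 (1 / sqrt 2) (u \<bullet> b))) *
          ennreal (exp ((norm u)\<^sup>2 + (\<Sum>i\<in>UNIV. ln (d i)) - (\<Sum>i\<in>UNIV. d i * (cmod ((u - v) $ i))\<^sup>2))) \<partial>lborel)"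
  proof -
    have "(\<lambda>u. exp ((norm u)\<^sup>2 + (\<Sum>i\<in>UNIV. ln (d i)) - (\<Sum>i\<in>UNIV. d i * (cmod ((u - v) $ i))\<^sup>2))) \<in> borel_measurable borel"
      by (intro borel_measurable_continuous_onI continuous_intros)
    then show ?thesis unfolding gaussm_def by (subst nn_integral_density) auto
  qed
  also have "\<dots> = (\<integral>\<^sup>+u. (\<Prod>b\<in>Basis. f b (u \<bullet> b)) \<partial>lborel)"
  proof (rule nn_integral_cong)
    fix u :: "complex^'t"
    have nd: "normal_density m (1 / sqrt (2 * c)) x = sqrt c / sqrt pi * exp (- c * (x - m)\<^sup>2)" if "0 < c" for m c x :: real
      using that by (simp add: normal_density_def power_divide real_sqrt_divide real_sqrt_mult field_simps)
    have "(\<Prod>b\<in>Basis. normal_density (v \<bullet> b) (1 / sqrt (2 * e b)) (u \<bullet> b))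
        = (\<Prod>i\<in>UNIV. (d i / pi) * exp (- (d i * (cmod ((u - v) $ i))\<^sup>2)))"
      unfolding prod_Basis_cvec e inner_axis_cvec
    proof (intro prod.cong refl)
      fix i
      show "normal_density (Re (v $ i)) (1 / sqrt (2 * d i)) (Re (u $ i)) * normal_density (Im (v $ i)) (1 / sqrt (2 * d i)) (Im (u $ i))
          = (d i / pi) * exp (- (d i * (cmod ((u - v) $ i))\<^sup>2))"
      proof -
        have "sqrt (d i) * sqrt (d i) = d i" using d[of i] by simp
        moreover have "exp (- d i * (Re (u $ i) - Re (v $ i))\<^sup>2) * exp (- d i * (Im (u $ i) - Im (v $ i))\<^sup>2)
            = exp (- (d i * (cmod ((u - v) $ i))\<^sup>2))"
          by (simp add: cmod_power2 exp_add[symmetric] algebra_simps)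
        ultimately show ?thesis unfolding nd[OF d] by (simp add: field_simps)
      qed
    qed
    also have "\<dots> = (\<Prod>i\<in>UNIV. d i) * exp (- (\<Sum>i\<in>UNIV. d i * (cmod ((u - v) $ i))\<^sup>2)) / pi ^ CARD('t)"
      by (simp add: prod.distrib prod_dividef exp_sum[symmetric] sum_negf)
    also have "\<dots> = (exp (- (norm u)\<^sup>2) / sqrt pi ^ DIM(complex^'t)) *
       exp ((norm u)\<^sup>2 + (\<Sum>i\<in>UNIV. ln (d i)) - (\<Sum>i\<in>UNIV. d i * (cmod ((u - v) $ i))\<^sup>2))"
    proof -
      have "sqrt pi ^ DIM(complex^'t) = pi ^ CARD('t)" by (simp add: power_mult mult.commute[of _ 2])
      moreover have "exp (- (norm u)\<^sup>2) * exp ((norm u)\<^sup>2 + (\<Sum>i\<in>UNIV. ln (d i)) - (\<Sum>i\<in>UNIV. d i * (cmod ((u - v) $ i))\<^sup>2))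
          = (\<Prod>i\<in>UNIV. d i) * exp (- (\<Sum>i\<in>UNIV. d i * (cmod ((u - v) $ i))\<^sup>2))"
        unfolding sum_ln[symmetric] exp_add[symmetric] by simp
      ultimately show ?thesis by simp
    qed
    finally have "(\<Prod>b\<in>Basis. normal_density (v \<bullet> b) (1 / sqrt (2 * e b)) (u \<bullet> b)) =
       (\<Prod>b\<in>Basis. normal_density 0 (1 / sqrt 2) (u \<bullet> b)) *
       exp ((norm u)\<^sup>2 + (\<Sum>i\<in>UNIV. ln (d i)) - (\<Sum>i\<in>UNIV. d i * (cmod ((u - v) $ i))\<^sup>2))"
      by (simp add: gaussm_density)
    then show "(\<Prod>b\<in>Basis. ennreal (normal_density 0 (1 / sqrt 2) (u \<bullet> b))) *
          ennreal (exp ((norm u)\<^sup>2 + (\<Sum>i\<in>UNIV. ln (d i)) - (\<Sum>i\<in>UNIV. d i * (cmod ((u - v) $ i))\<^sup>2))) = (\<Prod>b\<in>Basis. f b (u \<bullet> b))"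
      by (simp add: f_def prod_ennreal ennreal_mult'[symmetric] prod_nonneg)
  qed
  also have "\<dots> = (\<Prod>b\<in>Basis. (\<integral>\<^sup>+x. f b x \<partial>lborel))"
    by (rule nn_integral_lborel_prod) (auto simp: f_def)
  also have "\<dots> = 1"
  proof (rule prod.neutral, rule ballI)
    fix b :: "complex^'t" assume "b \<in> Basis"
    then have "prob_space (density lborel (\<lambda>x. ennreal (normal_density (v \<bullet> b) (1 / sqrt (2 * e b)) x)))"
      using epos by (intro prob_space_normal_density) simp
    from prob_space.emeasure_space_1[OF this] show "(\<integral>\<^sup>+x. f b x \<partial>lborel) = 1"
      by (simp add: emeasure_density f_def)
  qed
  finally show ?thesis .
qed

section \<open>Mean squares of linear images of Gaussian vectors\<close>

definition frob :: "complex^'n^'m \<Rightarrow> real" where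
  "frob F = (\<Sum>i\<in>UNIV. \<Sum>j\<in>UNIV. (cmod (F $ i $ j))\<^sup>2)"

lemma frob_eq_trace: "frob F = Re (trace (F ** ctrans F))"
  by (simp add: frob_def trace_def matrix_matrix_mult_def ctrans_def complex_norm_square[symmetric]
      flip: of_real_power of_real_sum)

lemma frob_uminus [simp]: "frob (- F) = frob F"
  by (simp add: frob_def)

lemma frob_mat_1 [simp]: "frob (mat 1 :: complex^'n^'n) = CARD('n)"
  by (simp add: frob_eq_trace trace_I)

lemma frob_0 [simp]: "frob 0 = 0"
  by (simp add: frob_def)

lemma sum_Basis_frob: "(\<Sum>b\<in>Basis. (norm (F *v b))\<^sup>2) = 2 * frob (F :: complex^'n^'m)"
proof -
  have c: "(norm (F *v axis j x))\<^sup>2 = (cmod x)\<^sup>2 * (\<Sum>i\<in>UNIV. (cmod (F $ i $ j))\<^sup>2)" for j x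
  proof -
    have "(F *v axis j x) $ i = F $ i $ j * x" for i
    proof -
      have "(F *v axis j x) $ i = (\<Sum>k\<in>UNIV. F $ i $ k * (if k = j then x else 0))"
        by (simp add: matrix_vector_mult_def axis_def)
      then show ?thesis by (simp add: mult_delta_right)
    qed
    then show ?thesis
      by (simp add: norm_vec_square norm_mult power_mult_distrib sum_distrib_left mult.commute)
  qed
  have "(\<Sum>b\<in>Basis. (norm (F *v b))\<^sup>2) = (\<Sum>j\<in>UNIV. 2 * (\<Sum>i\<in>UNIV. (cmod (F $ i $ j))\<^sup>2))"
    unfolding sum_Basis_cvec c by simp
  also have "\<dots> = 2 * (\<Sum>j\<in>UNIV. \<Sum>i\<in>UNIV. (cmod (F $ i $ j))\<^sup>2)" by (simp add: sum_distrib_left)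
  also have "(\<Sum>j\<in>UNIV. \<Sum>i\<in>UNIV. (cmod (F $ i $ j))\<^sup>2) = frob F" unfolding frob_def by (rule sum.swap)
  finally show ?thesis .
qed

lemma sum_Basis_prod:
  fixes f :: "'a::euclidean_space \<times> 'b::euclidean_space \<Rightarrow> 'c::comm_monoid_add"
  shows "(\<Sum>e\<in>Basis. f e) = (\<Sum>u\<in>Basis. f (u, 0)) + (\<Sum>v\<in>Basis. f (0, v))"
proof -
  have "(\<Sum>e\<in>Basis. f e) = (\<Sum>e\<in>(\<lambda>u. (u, 0)) ` Basis. f e) + (\<Sum>e\<in>(\<lambda>v. (0, v)) ` Basis. f e)"
    unfolding Basis_prod_def by (rule sum.union_disjoint) (auto dest: nonzero_Basis)
  then show ?thesis by (simp add: sum.reindex inj_on_def)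
qed

text \<open>The arguments are the independent symbols: \<open>a\<close> and \<open>b\<close> of the
  two users and the noises of the two receivers. Everything that encoder and decoders test is built
  from squared norms of such combinations, with means given by four \<open>frob\<close>
  terms.\<close>

definition lin4 :: "complex^'a^'m \<Rightarrow> complex^'b^'m \<Rightarrow> complex^'c^'m \<Rightarrow> complex^'d^'m
    \<Rightarrow> ((complex^'a) \<times> (complex^'b)) \<times> ((complex^'c) \<times> (complex^'d)) \<Rightarrow> complex^'m" where
  "lin4 F1 F2 F3 F4 \<omega> = F1 *v fst (fst \<omega>) + F2 *v snd (fst \<omega>) + (F3 *v fst (snd \<omega>) + F4 *v snd (snd \<omega>))"

lemma linear_lin4: "linear (lin4 F1 F2 F3 F4)"
  by (rule linearI) (simp_all add: lin4_def matrix_vector_right_distrib matrix_vector_scaleR algebra_simps)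

lemma lin4_mean:
  "(\<integral>\<omega>. (norm (lin4 F1 F2 F3 F4 \<omega>))\<^sup>2 \<partial>gaussm) = frob F1 + frob F2 + frob F3 + frob F4"
  unfolding gaussm_linear_second_moment(3)[OF linear_lin4] sum_Basis_prod
  by (simp add: lin4_def sum_Basis_frob sum.distrib)

lemma measurable_zip_gaussm:
  "(\<lambda>p. \<lambda>i\<in>I. (fst p i, snd p i)) \<in> measurable (PiM I (\<lambda>_. gaussm) \<Otimes>\<^sub>M PiM I (\<lambda>_. gaussm))
     (PiM I (\<lambda>_. gaussm :: ('x::euclidean_space \<times> 'y::euclidean_space) measure))"
  unfolding gaussm_pair[symmetric] by measurable

lemma nn_integral_zip_gaussm:
  fixes F :: "('i \<Rightarrow> ('x::euclidean_space \<times> 'y::euclidean_space)) \<Rightarrow> ennreal"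
  assumes I: "finite I" and F: "F \<in> borel_measurable (PiM I (\<lambda>_. gaussm))"
  shows "(\<integral>\<^sup>+\<omega>. F \<omega> \<partial>PiM I (\<lambda>_. gaussm))
    = (\<integral>\<^sup>+p. F (\<lambda>i\<in>I. (fst p i, snd p i)) \<partial>(PiM I (\<lambda>_. gaussm) \<Otimes>\<^sub>M PiM I (\<lambda>_. gaussm)))"
    and "(\<integral>\<^sup>+p. F (\<lambda>i\<in>I. (fst p i, snd p i)) \<partial>(PiM I (\<lambda>_. gaussm) \<Otimes>\<^sub>M PiM I (\<lambda>_. gaussm))) = (\<integral>\<^sup>+x. \<integral>\<^sup>+y. F (\<lambda>i\<in>I. (x i, y i)) \<partial>PiM I (\<lambda>_. gaussm) \<partial>PiM I (\<lambda>_. gaussm))"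
proof -
  have z: "distr (PiM I (\<lambda>_. gaussm) \<Otimes>\<^sub>M PiM I (\<lambda>_. gaussm)) (PiM I (\<lambda>_. gaussm :: ('x \<times> 'y) measure)) (\<lambda>p. \<lambda>i\<in>I. (fst p i, snd p i))
      = PiM I (\<lambda>_. gaussm)"
    using distr_PiM_zip[OF prob_space_gaussm prob_space_gaussm I] by (simp only: gaussm_pair)
  show "(\<integral>\<^sup>+\<omega>. F \<omega> \<partial>PiM I (\<lambda>_. gaussm)) = (\<integral>\<^sup>+p. F (\<lambda>i\<in>I. (fst p i, snd p i)) \<partial>(PiM I (\<lambda>_. gaussm) \<Otimes>\<^sub>M PiM I (\<lambda>_. gaussm)))"
    by (subst z[symmetric], rule nn_integral_distr) (use F measurable_zip_gaussm in simp_all)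
  show "(\<integral>\<^sup>+p. F (\<lambda>i\<in>I. (fst p i, snd p i)) \<partial>(PiM I (\<lambda>_. gaussm) \<Otimes>\<^sub>M PiM I (\<lambda>_. gaussm))) = (\<integral>\<^sup>+x. \<integral>\<^sup>+y. F (\<lambda>i\<in>I. (x i, y i)) \<partial>PiM I (\<lambda>_. gaussm) \<partial>PiM I (\<lambda>_. gaussm))"
    using sigma_finite_measure.nn_integral_fst[OF prob_space_imp_sigma_finite[OF prob_space_PiM[OF prob_space_gaussm]]
        measurable_compose[OF measurable_zip_gaussm F]] by simp
qed

text \<open>Rewrites the iterated average of the one-shot bound, over whole blocks of
  \<open>a\<close>, \<open>b\<close> and noise, as one over i.i.d. quadruples, which is the form of
  the weak law.\<close>

lemma gaussm_quadruple:
  fixes F :: "('i \<Rightarrow> ('a::euclidean_space \<times> 'b::euclidean_space) \<times> ('c::euclidean_space \<times> 'd::euclidean_space)) \<Rightarrow> ennreal"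
  assumes I: "finite I" and F: "F \<in> borel_measurable (PiM I (\<lambda>_. gaussm))"
  shows "(\<integral>\<^sup>+a. \<integral>\<^sup>+b. \<integral>\<^sup>+z. F (\<lambda>i\<in>I. ((a i, b i), (fst z i, snd z i))) \<partial>(PiM I (\<lambda>_. gaussm) \<Otimes>\<^sub>M PiM I (\<lambda>_. gaussm))
      \<partial>PiM I (\<lambda>_. gaussm) \<partial>PiM I (\<lambda>_. gaussm)) = (\<integral>\<^sup>+\<omega>. F \<omega> \<partial>PiM I (\<lambda>_. gaussm))"
proof -
  define H where "H ab = (\<integral>\<^sup>+cd. F (\<lambda>i\<in>I. (ab i, cd i)) \<partial>PiM I (\<lambda>_. gaussm :: ('c \<times> 'd) measure))" for ab :: "'i \<Rightarrow> 'a \<times> 'b"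
  have Fz: "(\<lambda>p. F (\<lambda>i\<in>I. (fst p i, snd p i))) \<in> borel_measurable (PiM I (\<lambda>_. gaussm) \<Otimes>\<^sub>M PiM I (\<lambda>_. gaussm))"
    by (rule measurable_compose[OF measurable_zip_gaussm F])
  have H: "H \<in> borel_measurable (PiM I (\<lambda>_. gaussm))"
    unfolding H_def
    using sigma_finite_measure.borel_measurable_nn_integral_fst[OF prob_space_imp_sigma_finite[OF prob_space_PiM[OF prob_space_gaussm]] Fz]
    by simp
  have "(\<integral>\<^sup>+\<omega>. F \<omega> \<partial>PiM I (\<lambda>_. gaussm)) = (\<integral>\<^sup>+ab. H ab \<partial>PiM I (\<lambda>_. gaussm))"
    unfolding H_def nn_integral_zip_gaussm(1)[OF I F] nn_integral_zip_gaussm(2)[OF I F] ..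
  also have "\<dots> = (\<integral>\<^sup>+a. \<integral>\<^sup>+b. H (\<lambda>i\<in>I. (a i, b i)) \<partial>PiM I (\<lambda>_. gaussm) \<partial>PiM I (\<lambda>_. gaussm))"
    unfolding nn_integral_zip_gaussm(1)[OF I H] nn_integral_zip_gaussm(2)[OF I H] ..
  also have "\<dots> = (\<integral>\<^sup>+a. \<integral>\<^sup>+b. \<integral>\<^sup>+z. F (\<lambda>i\<in>I. ((a i, b i), (fst z i, snd z i))) \<partial>(PiM I (\<lambda>_. gaussm) \<Otimes>\<^sub>M PiM I (\<lambda>_. gaussm))
      \<partial>PiM I (\<lambda>_. gaussm) \<partial>PiM I (\<lambda>_. gaussm))"
  proof (intro nn_integral_cong)
    fix a :: "'i \<Rightarrow> 'a" and b :: "'i \<Rightarrow> 'b"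
    let ?ab = "\<lambda>i\<in>I. (a i, b i)"
    have ab: "?ab \<in> space (PiM I (\<lambda>_. gaussm))" by (auto simp: space_PiM)
    have m: "(\<lambda>cd. F (\<lambda>i\<in>I. (?ab i, cd i))) \<in> borel_measurable (PiM I (\<lambda>_. gaussm))"
      using measurable_compose[OF measurable_Pair1'[OF ab] Fz] by simp
    have "H ?ab = (\<integral>\<^sup>+p. F (\<lambda>i\<in>I. (?ab i, (\<lambda>i\<in>I. (fst p i, snd p i)) i)) \<partial>(PiM I (\<lambda>_. gaussm) \<Otimes>\<^sub>M PiM I (\<lambda>_. gaussm)))"
      unfolding H_def by (rule nn_integral_zip_gaussm(1)[OF I m])
    moreover have "(\<lambda>i\<in>I. (?ab i, (\<lambda>i\<in>I. (fst p i, snd p i)) i)) = (\<lambda>i\<in>I. ((a i, b i), (fst p i, snd p i)))" for p :: "('i \<Rightarrow> 'c) \<times> ('i \<Rightarrow> 'd)"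
      by (auto simp: restrict_def)
    ultimately show "H ?ab = (\<integral>\<^sup>+z. F (\<lambda>i\<in>I. ((a i, b i), (fst z i, snd z i))) \<partial>(PiM I (\<lambda>_. gaussm) \<Otimes>\<^sub>M PiM I (\<lambda>_. gaussm)))" by simp
  qed
  finally show ?thesis by simp
qed

section \<open>Achievability by dirty paper coding\<close>

lemma borel_measurable_matrix_vector [measurable (raw)]:
  fixes F :: "complex^'n^'m"
  shows "f \<in> borel_measurable M \<Longrightarrow> (\<lambda>x. F *v f x) \<in> borel_measurable M"
  by (erule measurable_compose) (intro borel_measurable_continuous_onI linear_continuous_on matrix_vector_mul_bounded_linear)

lemma borel_measurable_cvec_nth [measurable (raw)]:
  fixes f :: "'a \<Rightarrow> complex^'n"
  shows "f \<in> borel_measurable M \<Longrightarrow> (\<lambda>x. f x $ k) \<in> borel_measurable M"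
  by (erule measurable_compose) (intro borel_measurable_continuous_onI continuous_intros)

text \<open>Centring lowers a second moment. Hence an energy bound for each codeword suffices for
  the covariance constraint.\<close>

lemma tr_cov_le_second_moment:
  fixes f :: "nat \<Rightarrow> nat \<Rightarrow> nat \<Rightarrow> complex^'t"
  assumes "0 < M1" "0 < M2"
  shows "tr_cov f M1 M2 i \<le> (1 / real (M1 * M2)) * (\<Sum>m1<M1. \<Sum>m2<M2. (norm (f m1 m2 i))\<^sup>2)"
proof -
  define M where "M = real (M1 * M2)"
  have M: "M > 0" using assms by (simp add: M_def)
  define S where "S = (\<Sum>m1<M1. \<Sum>m2<M2. f m1 m2 i)"
  define e where "e = (1 / M) *\<^sub>R S"
  have "(\<Sum>m1<M1. \<Sum>m2<M2. (norm (f m1 m2 i - e))\<^sup>2)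
      = (\<Sum>m1<M1. \<Sum>m2<M2. (norm (f m1 m2 i))\<^sup>2 - 2 * (f m1 m2 i \<bullet> e) + (norm e)\<^sup>2)"
    by (intro sum.cong refl) (simp add: power2_norm_eq_inner inner_diff_left inner_diff_right inner_commute)
  also have "\<dots> = (\<Sum>m1<M1. \<Sum>m2<M2. (norm (f m1 m2 i))\<^sup>2) - 2 * (S \<bullet> e) + M * (norm e)\<^sup>2"
    by (simp add: sum.distrib sum_subtractf inner_sum_left S_def M_def flip: sum_distrib_left)
  also have "S \<bullet> e = M * (norm e)\<^sup>2"
  proof -
    have "S = M *\<^sub>R e" using M by (simp add: e_def)
    then have "S \<bullet> e = (M *\<^sub>R e) \<bullet> e" by simp
    then show ?thesis by (simp add: power2_norm_eq_inner)
  qed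
  finally have "(\<Sum>m1<M1. \<Sum>m2<M2. (norm (f m1 m2 i - e))\<^sup>2) \<le> (\<Sum>m1<M1. \<Sum>m2<M2. (norm (f m1 m2 i))\<^sup>2)"
    using M by simp
  then have "(1 / M) * (\<Sum>m1<M1. \<Sum>m2<M2. (norm (f m1 m2 i - e))\<^sup>2) \<le> (1 / M) * (\<Sum>m1<M1. \<Sum>m2<M2. (norm (f m1 m2 i))\<^sup>2)"
    using M by (intro mult_left_mono) auto
  then show ?thesis by (simp add: tr_cov_def Let_def e_def S_def M_def)
qed

lemma prod_gaussm_likelihood:
  fixes d :: "'t::finite \<Rightarrow> real" and v :: "'i \<Rightarrow> complex^'t"
  assumes d: "\<And>i. 0 < d i" and I: "finite I"
  shows "(\<integral>\<^sup>+u. ennreal (exp (\<Sum>i\<in>I. (norm (u i))\<^sup>2 + (\<Sum>k\<in>UNIV. ln (d k)) - (\<Sum>k\<in>UNIV. d k * (cmod ((u i - v i) $ k))\<^sup>2)))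
      \<partial>PiM I (\<lambda>_. gaussm)) = 1"
proof -
  interpret prob_space "gaussm :: (complex^'t) measure" by (rule prob_space_gaussm)
  interpret P: product_prob_space "\<lambda>_. gaussm :: (complex^'t) measure" ..
  let ?f = "\<lambda>i u. ennreal (exp ((norm u)\<^sup>2 + (\<Sum>k\<in>UNIV. ln (d k)) - (\<Sum>k\<in>UNIV. d k * (cmod ((u - v i) $ k))\<^sup>2)))"
  have "(\<integral>\<^sup>+u. ennreal (exp (\<Sum>i\<in>I. (norm (u i))\<^sup>2 + (\<Sum>k\<in>UNIV. ln (d k)) - (\<Sum>k\<in>UNIV. d k * (cmod ((u i - v i) $ k))\<^sup>2)))
      \<partial>PiM I (\<lambda>_. gaussm)) = (\<integral>\<^sup>+u. (\<Prod>i\<in>I. ?f i (u i)) \<partial>PiM I (\<lambda>_. gaussm))"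
    using I by (simp add: exp_sum prod_ennreal)
  also have "\<dots> = (\<Prod>i\<in>I. \<integral>\<^sup>+u. ?f i u \<partial>gaussm)"
    by (rule P.product_nn_integral_prod[OF I]) measurable
  finally show ?thesis unfolding gaussm_diag_likelihood[OF d] by simp
qed

text \<open>The one-shot bound for Gaussian words \<open>a\<close>, auxiliary words
  \<open>A a + b\<close> and inputs \<open>B1 a + B2 b\<close>. The terms \<open>l0\<close>,
  \<open>l1\<close>, \<open>l2\<close> are the log likelihood ratios of one symbol; coefficients and
  thresholds are still free.\<close>

theorem dirty_paper_block_code:
  fixes G :: "complex^'t^'r" and K :: "complex^'t^'q" and B1 B2 A :: "complex^'t^'t"
    and W1 :: "complex^'r^'t" and W2 :: "complex^'q^'t" and d1 d2 :: "'t \<Rightarrow> real" and n :: nat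
  defines "x \<omega> \<equiv> B1 *v fst (fst \<omega>) + B2 *v snd (fst \<omega>)"
  defines "l0 \<omega> \<equiv> (norm (A *v fst (fst \<omega>) + snd (fst \<omega>)))\<^sup>2 - (norm (snd (fst \<omega>)))\<^sup>2"
    and "l1 \<omega> \<equiv> (norm (fst (fst \<omega>)))\<^sup>2 + (\<Sum>k\<in>UNIV. ln (d1 k))
        - (\<Sum>k\<in>UNIV. d1 k * (cmod ((fst (fst \<omega>) - W1 *v (G *v x \<omega> + fst (snd \<omega>))) $ k))\<^sup>2)"
    and "l2 \<omega> \<equiv> (norm (A *v fst (fst \<omega>) + snd (fst \<omega>)))\<^sup>2 + (\<Sum>k\<in>UNIV. ln (d2 k))
        - (\<Sum>k\<in>UNIV. d2 k * (cmod ((A *v fst (fst \<omega>) + snd (fst \<omega>) - W2 *v (K *v x \<omega> + snd (snd \<omega>))) $ k))\<^sup>2)"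
  assumes d: "\<And>k. 0 < d1 k" "\<And>k. 0 < d2 k" and c: "0 < c0" "0 < c1" "0 < c2" and s: "0 < s" "s < 1" and P: "0 \<le> P"
    and typical: "(\<integral>\<^sup>+\<omega>. of_bool (\<not> (\<Sum>i<n. (norm (x (\<omega> i)))\<^sup>2) \<le> real n * P \<or> c0 < exp (\<Sum>i<n. l0 (\<omega> i)) \<or>
        exp (\<Sum>i<n. l1 (\<omega> i)) < c1 \<or> exp (\<Sum>i<n. l2 (\<omega> i)) < c2) \<partial>PiM {..<n} (\<lambda>_. gaussm)) \<le> ennreal (s\<^sup>2)"
    and M: "1 \<le> M1" "1 \<le> M2" "1 \<le> L"
  shows "\<exists>f g1 g2. bc_code G K P n M1 M2 f g1 g2
     (3 * s + exp (- real L / c0) + (real M1 - 1) / c1 + (real M2 - 1) * real L / c2)"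
proof -
  let ?\<Gamma> = "PiM {..<n} (\<lambda>_. gaussm :: (complex^'t) measure)"
  let ?Z = "PiM {..<n} (\<lambda>_. gaussm :: (complex^'r) measure) \<Otimes>\<^sub>M PiM {..<n} (\<lambda>_. gaussm :: (complex^'q) measure)"
  let ?Y1 = "PiM {..<n} (\<lambda>_. borel :: (complex^'r) measure)" and ?Y2 = "PiM {..<n} (\<lambda>_. borel :: (complex^'q) measure)"
  \<comment> \<open>The input in terms of the pair that the encoder selects: \<open>b\<close> is
    recovered as \<open>u - A a\<close>.\<close>
  define xx where "xx a u i = B1 *v a i + B2 *v (u i - A *v a i)" for a u :: "nat \<Rightarrow> complex^'t" and i
  define \<tau> where "\<tau> a b = (\<lambda>i\<in>{..<n}. A *v a i + b i)" for a b :: "nat \<Rightarrow> complex^'t"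
  define y1 where "y1 a u z = (\<lambda>i\<in>{..<n}. G *v xx a u i + fst z i)" for a u and z :: "(nat \<Rightarrow> complex^'r) \<times> (nat \<Rightarrow> complex^'q)"
  define y2 where "y2 a u z = (\<lambda>i\<in>{..<n}. K *v xx a u i + snd z i)" for a u and z :: "(nat \<Rightarrow> complex^'r) \<times> (nat \<Rightarrow> complex^'q)"
  define ok where "ok a u \<longleftrightarrow> (\<Sum>i<n. (norm (xx a u i))\<^sup>2) \<le> real n * P" for a u
  define w0 where "w0 a u = exp (\<Sum>i<n. (norm (u i))\<^sup>2 - (norm (u i - A *v a i))\<^sup>2)" for a u :: "nat \<Rightarrow> complex^'t"
  define w1 where "w1 a y = exp (\<Sum>i<n. (norm (a i))\<^sup>2 + (\<Sum>k\<in>UNIV. ln (d1 k)) - (\<Sum>k\<in>UNIV. d1 k * (cmod ((a i - W1 *v y i) $ k))\<^sup>2))"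
    for a and y :: "nat \<Rightarrow> complex^'r"
  define w2 where "w2 u y = exp (\<Sum>i<n. (norm (u i))\<^sup>2 + (\<Sum>k\<in>UNIV. ln (d2 k)) - (\<Sum>k\<in>UNIV. d2 k * (cmod ((u i - W2 *v y i) $ k))\<^sup>2))"
    for u and y :: "nat \<Rightarrow> complex^'q"
  have \<Gamma>: "prob_space ?\<Gamma>" by (intro prob_space_PiM prob_space_gaussm)
  have Z: "prob_space ?Z" by (intro prob_space_pair prob_space_PiM prob_space_gaussm)
  have m\<tau>: "(\<lambda>(a, b). \<tau> a b) \<in> measurable (?\<Gamma> \<Otimes>\<^sub>M ?\<Gamma>) ?\<Gamma>"
    unfolding \<tau>_def split_beta' by measurable
  have my1: "(\<lambda>(a, u, z). y1 a u z) \<in> measurable (?\<Gamma> \<Otimes>\<^sub>M ?\<Gamma> \<Otimes>\<^sub>M ?Z) ?Y1"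
    unfolding y1_def xx_def split_beta' by measurable
  have my2: "(\<lambda>(a, u, z). y2 a u z) \<in> measurable (?\<Gamma> \<Otimes>\<^sub>M ?\<Gamma> \<Otimes>\<^sub>M ?Z) ?Y2"
    unfolding y2_def xx_def split_beta' by measurable
  have mok: "Measurable.pred (?\<Gamma> \<Otimes>\<^sub>M ?\<Gamma>) (\<lambda>(a, u). ok a u)"
    unfolding ok_def xx_def split_beta' by measurable
  have mw0: "(\<lambda>(a, u). w0 a u) \<in> borel_measurable (?\<Gamma> \<Otimes>\<^sub>M ?\<Gamma>)"
    unfolding w0_def split_beta' by measurable
  have mw1: "(\<lambda>(a, y). w1 a y) \<in> borel_measurable (?\<Gamma> \<Otimes>\<^sub>M ?Y1)"
    unfolding w1_def split_beta' by measurable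
  have mw2: "(\<lambda>(u, y). w2 u y) \<in> borel_measurable (?\<Gamma> \<Otimes>\<^sub>M ?Y2)"
    unfolding w2_def split_beta' by measurable
  have law: "emeasure ?\<Gamma> {b \<in> space ?\<Gamma>. \<tau> a b \<in> S} \<le> (\<integral>\<^sup>+u. ennreal (w0 a u) * indicator S u \<partial>?\<Gamma>)"
    if "a \<in> space ?\<Gamma>" "S \<in> sets ?\<Gamma>" for a S
    unfolding \<tau>_def w0_def using gaussm_PiM_shift[OF _ that(2), of "\<lambda>i. A *v a i"] by simp
  have int1: "(\<integral>\<^sup>+a. ennreal (w1 a y) \<partial>?\<Gamma>) \<le> 1" if "y \<in> space ?Y1" for y
    unfolding w1_def using prod_gaussm_likelihood[OF d(1), where I = "{..<n}" and v = "\<lambda>i. W1 *v y i"] by simp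
  have int2: "(\<integral>\<^sup>+u. ennreal (w2 u y) \<partial>?\<Gamma>) \<le> 1" if "y \<in> space ?Y2" for y
    unfolding w2_def using prod_gaussm_likelihood[OF d(2), where I = "{..<n}" and v = "\<lambda>i. W2 *v y i"] by simp
  define bad where "bad \<omega> \<longleftrightarrow> \<not> (\<Sum>i<n. (norm (x (\<omega> i)))\<^sup>2) \<le> real n * P \<or> c0 < exp (\<Sum>i<n. l0 (\<omega> i)) \<or>
        exp (\<Sum>i<n. l1 (\<omega> i)) < c1 \<or> exp (\<Sum>i<n. l2 (\<omega> i)) < c2" for \<omega>
  have gprod: "sets (gaussm :: (((complex^'t) \<times> (complex^'t)) \<times> ((complex^'r) \<times> (complex^'q))) measure)
      = sets ((borel \<Otimes>\<^sub>M borel) \<Otimes>\<^sub>M (borel \<Otimes>\<^sub>M borel))"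
    by (simp only: sets_gaussm borel_prod)
  have mbad: "(\<lambda>\<omega>. of_bool (bad \<omega>) :: ennreal) \<in> borel_measurable
     (PiM {..<n} (\<lambda>_. gaussm :: (((complex^'t) \<times> (complex^'t)) \<times> ((complex^'r) \<times> (complex^'q))) measure))"
  proof -
    have "(\<lambda>\<omega>. of_bool (bad \<omega>) :: ennreal) \<in> borel_measurable
       (PiM {..<n} (\<lambda>_. (borel \<Otimes>\<^sub>M borel) \<Otimes>\<^sub>M (borel \<Otimes>\<^sub>M borel)))"
      unfolding bad_def x_def l0_def l1_def l2_def by measurable
    then show ?thesis
      by (subst measurable_cong_sets[OF sets_PiM_cong[OF refl gprod] refl])
  qed
  have "(\<integral>\<^sup>+a. \<integral>\<^sup>+b. \<integral>\<^sup>+z. of_bool (\<not> ok a (\<tau> a b) \<or> c0 < w0 a (\<tau> a b) \<or>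
          w1 a (y1 a (\<tau> a b) z) < c1 \<or> w2 (\<tau> a b) (y2 a (\<tau> a b) z) < c2) \<partial>?Z \<partial>?\<Gamma> \<partial>?\<Gamma>)
     = (\<integral>\<^sup>+a. \<integral>\<^sup>+b. \<integral>\<^sup>+z. of_bool (bad (\<lambda>i\<in>{..<n}. ((a i, b i), (fst z i, snd z i)))) \<partial>?Z \<partial>?\<Gamma> \<partial>?\<Gamma>)"
    unfolding ok_def w0_def w1_def w2_def y1_def y2_def xx_def \<tau>_def bad_def x_def l0_def l1_def l2_def
    by simp
  also have "\<dots> = (\<integral>\<^sup>+\<omega>. of_bool (bad \<omega>) \<partial>PiM {..<n} (\<lambda>_. gaussm))"
    by (rule gaussm_quadruple[OF _ mbad]) simp
  also have "\<dots> \<le> ennreal (s\<^sup>2)" using typical by (simp add: bad_def)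
  finally have typ': "(\<integral>\<^sup>+a. \<integral>\<^sup>+b. \<integral>\<^sup>+z. of_bool (\<not> ok a (\<tau> a b) \<or> c0 < w0 a (\<tau> a b) \<or>
          w1 a (y1 a (\<tau> a b) z) < c1 \<or> w2 (\<tau> a b) (y2 a (\<tau> a b) z) < c2) \<partial>?Z \<partial>?\<Gamma> \<partial>?\<Gamma>) \<le> ennreal (s\<^sup>2)" .
  obtain g1 g2 a u good where g: "g1 \<in> measurable ?Y1 (count_space UNIV)" "g2 \<in> measurable ?Y2 (count_space UNIV)"
    and good: "\<forall>m1<M1. \<forall>m2<M2. good m1 m2 \<longrightarrow> ok (a m1) (u m1 m2)"
    and err: "(1 / real (M1 * M2)) * (\<Sum>m1<M1. \<Sum>m2<M2. if good m1 m2
        then measure ?Z {z \<in> space ?Z. g1 (y1 (a m1) (u m1 m2) z) \<noteq> m1 \<or> g2 (y2 (a m1) (u m1 m2) z) \<noteq> m2} else 1)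
      \<le> 3 * s + exp (- real L / c0) + (real M1 - 1) / c1 + (real M2 - 1) * real L / c2"
    by (rule one_shot_broadcast_code[where \<tau> = \<tau> and ?y1.0 = y1 and ?y2.0 = y2 and ok = ok and ?w0.0 = w0 and ?w1.0 = w1 and ?w2.0 = w2,
        OF \<Gamma> \<Gamma> \<Gamma> Z m\<tau> my1 my2 mok mw0 mw1 mw2 law int1 int2 c s typ' M])
  \<comment> \<open>Message pairs without a good word send zero, which costs no power; their error
    is already counted as 1.\<close>
  define f where "f m1 m2 i = (if good m1 m2 \<and> i < n then xx (a m1) (u m1 m2) i else 0)" for m1 m2 i
  have Mpos: "0 < M1" "0 < M2" using M by auto
  have "bc_code G K P n M1 M2 f g1 g2 (3 * s + exp (- real L / c0) + (real M1 - 1) / c1 + (real M2 - 1) * real L / c2)"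
    unfolding bc_code_def
  proof (intro conjI M g)
    have "(\<Sum>i<n. tr_cov f M1 M2 i) \<le> (\<Sum>i<n. (1 / real (M1 * M2)) * (\<Sum>m1<M1. \<Sum>m2<M2. (norm (f m1 m2 i))\<^sup>2))"
      by (intro sum_mono tr_cov_le_second_moment Mpos)
    also have "\<dots> = (1 / real (M1 * M2)) * (\<Sum>m1<M1. \<Sum>m2<M2. \<Sum>i<n. (norm (f m1 m2 i))\<^sup>2)"
    proof -
      have "(\<Sum>i<n. \<Sum>m1<M1. \<Sum>m2<M2. (norm (f m1 m2 i))\<^sup>2) = (\<Sum>m1<M1. \<Sum>i<n. \<Sum>m2<M2. (norm (f m1 m2 i))\<^sup>2)"
        by (rule sum.swap)
      also have "\<dots> = (\<Sum>m1<M1. \<Sum>m2<M2. \<Sum>i<n. (norm (f m1 m2 i))\<^sup>2)"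
        by (intro sum.cong refl sum.swap)
      finally have eq: "(\<Sum>i<n. \<Sum>m1<M1. \<Sum>m2<M2. (norm (f m1 m2 i))\<^sup>2) = (\<Sum>m1<M1. \<Sum>m2<M2. \<Sum>i<n. (norm (f m1 m2 i))\<^sup>2)" .
      show ?thesis unfolding sum_distrib_left[symmetric] eq ..
    qed
    also have "\<dots> \<le> (1 / real (M1 * M2)) * (\<Sum>m1<M1. \<Sum>m2<M2. real n * P)"
    proof (intro mult_left_mono sum_mono)
      fix m1 m2 assume m: "m1 \<in> {..<M1}" "m2 \<in> {..<M2}"
      show "(\<Sum>i<n. (norm (f m1 m2 i))\<^sup>2) \<le> real n * P"
        using good m P by (cases "good m1 m2") (auto simp: f_def ok_def)
    qed simp
    also have "\<dots> = real n * P" using Mpos by simp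
    finally show "(\<Sum>i<n. tr_cov f M1 M2 i) \<le> real n * P" .
    have nm: "noise_meas n = ?Z" by (simp add: noise_meas_def cnormal_vec_eq_gaussm)
    interpret Z: prob_space ?Z by (rule Z)
    have "avg_err G K n M1 M2 f g1 g2 \<le> (1 / real (M1 * M2)) * (\<Sum>m1<M1. \<Sum>m2<M2. if good m1 m2
        then measure ?Z {z \<in> space ?Z. g1 (y1 (a m1) (u m1 m2) z) \<noteq> m1 \<or> g2 (y2 (a m1) (u m1 m2) z) \<noteq> m2} else 1)"
      unfolding avg_err_def nm
    proof (intro mult_left_mono sum_mono)
      fix m1 m2
      show "measure ?Z {zz \<in> space ?Z. g1 (chan_out G (f m1 m2) n (fst zz)) \<noteq> m1 \<or> g2 (chan_out K (f m1 m2) n (snd zz)) \<noteq> m2}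
         \<le> (if good m1 m2 then measure ?Z {z \<in> space ?Z. g1 (y1 (a m1) (u m1 m2) z) \<noteq> m1 \<or> g2 (y2 (a m1) (u m1 m2) z) \<noteq> m2} else 1)"
      proof (cases "good m1 m2")
        case True
        have "chan_out G (f m1 m2) n (fst z) = y1 (a m1) (u m1 m2) z" "chan_out K (f m1 m2) n (snd z) = y2 (a m1) (u m1 m2) z" for z
          using True by (auto simp: chan_out_def y1_def y2_def f_def restrict_def)
        then show ?thesis using True by simp
      qed simp
    qed simp
    then show "avg_err G K n M1 M2 f g1 g2 \<le> 3 * s + exp (- real L / c0) + (real M1 - 1) / c1 + (real M2 - 1) * real L / c2"
      using err by linarith
  qed
  then show ?thesis by blast
qed

text \<open>The factor of a covariance matrix is only determined up to a unitary; this freedom is used to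
  diagonalise a second quadratic form.\<close>
lemma psd_factor_diagonalizing:
  fixes Q H :: "complex^'n^'n"
  assumes "psd Q" "psd H"
  obtains B :: "complex^'n^'n" and d where "Q = B ** ctrans B" "mat 1 + ctrans B ** H ** B = diagm d" "\<And>i. 1 \<le> d i"
proof -
  obtain C :: "complex^'n^'n" where C: "Q = C ** ctrans C" by (rule psd_factor[OF assms(1)])
  obtain V :: "complex^'n^'n" and e where V: "ctrans V ** V = mat 1" "V ** ctrans V = mat 1"
    "ctrans C ** H ** C = V ** diagm e ** ctrans V" and e: "\<And>i. 0 \<le> e i"
    using psd_spectral[OF psd_congr'[OF assms(2), of C]] by metis
  define B where "B = C ** V"
  have "B ** ctrans B = C ** (V ** ctrans V) ** ctrans C" by (simp add: B_def ctrans_mul matrix_mul_assoc)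
  then have 1: "Q = B ** ctrans B" by (simp add: V C)
  have "ctrans B ** H ** B = ctrans V ** (ctrans C ** H ** C) ** V" by (simp add: B_def ctrans_mul matrix_mul_assoc)
  also have "\<dots> = (ctrans V ** V) ** diagm e ** (ctrans V ** V)" unfolding V(3) by (simp add: matrix_mul_assoc)
  finally have "mat 1 + ctrans B ** H ** B = diagm (\<lambda>i. 1 + e i)"
    by (simp add: V(1) diagm_1[symmetric] diagm_add diagm_mul)
  then show ?thesis using 1 e that[of B "\<lambda>i. 1 + e i"] by simp
qed

lemma matrix_vector_mult_uminus: "(- F) *v x = - (F *v (x::complex^'n))"
  by (simp add: matrix_vector_mult_def vec_eq_iff sum_negf)

lemma logdet_diagm: "(\<And>i. 0 < d i) \<Longrightarrow> logdet (diagm d) = (\<Sum>i\<in>UNIV. ln (d i))"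
  unfolding logdet_def det_diagm Re_complex_of_real
  by (rule ln_prod) (simp_all add: less_imp_neq[THEN not_sym])

lemma norm_diagm_sqrt: "(\<And>i. 0 \<le> d i) \<Longrightarrow> (norm (diagm (\<lambda>i. sqrt (d i)) *v x))\<^sup>2 = (\<Sum>i\<in>UNIV. d i * (cmod (x $ i))\<^sup>2)"
proof -
  assume d: "\<And>i. 0 \<le> d i"
  have "(diagm (\<lambda>i. sqrt (d i)) *v x) $ i = of_real (sqrt (d i)) * x $ i" for i
    by (simp add: diagm_def matrix_vector_mult_def mult_delta_left)
  then show ?thesis using d by (simp add: norm_vec_square norm_mult power_mult_distrib)
qed

text \<open>The mean square of the whitened error of the linear estimators used by the decoders.\<close>
lemma frob_whitened:
  fixes d :: "'t::finite \<Rightarrow> real" and H :: "complex^'t^'t"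
  assumes "\<And>i. 0 < d i" "mat 1 + H = diagm d"
  shows "Re (trace (diagm (\<lambda>i. sqrt (d i)) ** diagm (\<lambda>i. 1 / d i) ** (mat 1 + H) ** diagm (\<lambda>i. 1 / d i) ** diagm (\<lambda>i. sqrt (d i)))) = CARD('t)"
proof -
  have "sqrt (d i) * (1 / d i) * d i * (1 / d i) * sqrt (d i) = 1" for i
    using assms(1)[of i] by (simp add: field_simps)
  then show ?thesis unfolding assms(2) diagm_mul by (simp only: diagm_1) (simp add: trace_I)
qed

text \<open>Union bound over finitely many maps, with one constant for all block lengths and
  margins. Integrals of \<open>of_bool\<close> match the form of the typicality hypothesis of the
  coding theorem.\<close>

lemma finite_linear_deviation:
  fixes \<L> :: "('a::euclidean_space \<Rightarrow> 'b::euclidean_space) set"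
  assumes "finite \<L>" "\<And>T. T \<in> \<L> \<Longrightarrow> linear T"
  obtains C where "0 \<le> C" "\<And>n \<delta>. 0 < n \<Longrightarrow> 0 < \<delta> \<Longrightarrow>
    (\<integral>\<^sup>+\<omega>. of_bool (\<exists>T\<in>\<L>. real n * \<delta> \<le> \<bar>(\<Sum>i<n. (norm (T (\<omega> i)))\<^sup>2) - real n * (\<integral>x. (norm (T x))\<^sup>2 \<partial>gaussm)\<bar>) \<partial>PiM {..<n} (\<lambda>_. gaussm))
      \<le> ennreal (C / (real n * \<delta>\<^sup>2))"
proof -
  define ev where "ev T n \<delta> \<omega> \<longleftrightarrow> real n * \<delta> \<le> \<bar>(\<Sum>i<n. (norm (T (\<omega> i)))\<^sup>2) - real n * (\<integral>x. (norm (T x))\<^sup>2 \<partial>gaussm)\<bar>"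
    for T :: "'a \<Rightarrow> 'b" and n \<delta> \<omega>
  have "\<forall>T\<in>\<L>. \<exists>C\<ge>0. \<forall>n \<delta>. 0 < n \<longrightarrow> 0 < \<delta> \<longrightarrow> (\<lambda>\<omega>. of_bool (ev T n \<delta> \<omega>) :: ennreal) \<in> borel_measurable (PiM {..<n} (\<lambda>_. gaussm)) \<and>
    (\<integral>\<^sup>+\<omega>. of_bool (ev T n \<delta> \<omega>) \<partial>PiM {..<n} (\<lambda>_. gaussm)) \<le> ennreal (C / (real n * \<delta>\<^sup>2))"
  proof
    fix T assume "T \<in> \<L>"
    then have T: "linear T" by (rule assms(2))
    have Tm [measurable]: "T \<in> borel_measurable borel"
      using T by (intro borel_measurable_continuous_onI linear_continuous_on) (simp add: linear_conv_bounded_linear)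
    obtain C where C: "0 \<le> C" "\<And>(n::nat) (\<delta>::real). 0 < n \<Longrightarrow> 0 < \<delta> \<Longrightarrow>
      measure (PiM {..<n} (\<lambda>_. gaussm)) {x \<in> space (PiM {..<n} (\<lambda>_. gaussm)). real n * \<delta> \<le> \<bar>(\<Sum>i<n. (norm (T (x i)))\<^sup>2) - real n * (\<integral>x. (norm (T x))\<^sup>2 \<partial>gaussm)\<bar>}
        \<le> C / (real n * \<delta>\<^sup>2)"
      using weak_law_PiM[OF prob_space_gaussm gaussm_linear_second_moment(1,2)[OF T]] by blast
    show "\<exists>C\<ge>0. \<forall>n \<delta>. 0 < n \<longrightarrow> 0 < \<delta> \<longrightarrow> (\<lambda>\<omega>. of_bool (ev T n \<delta> \<omega>) :: ennreal) \<in> borel_measurable (PiM {..<n} (\<lambda>_. gaussm)) \<and>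
      (\<integral>\<^sup>+\<omega>. of_bool (ev T n \<delta> \<omega>) \<partial>PiM {..<n} (\<lambda>_. gaussm)) \<le> ennreal (C / (real n * \<delta>\<^sup>2))"
    proof (intro exI[of _ C] conjI C(1) allI impI)
      fix n :: nat and \<delta> :: real assume n: "0 < n" "0 < \<delta>"
      interpret P: prob_space "PiM {..<n} (\<lambda>_. gaussm :: 'a measure)" by (intro prob_space_PiM prob_space_gaussm)
      have ev: "Measurable.pred (PiM {..<n} (\<lambda>_. gaussm)) (ev T n \<delta>)" unfolding ev_def by measurable
      then show "(\<lambda>\<omega>. of_bool (ev T n \<delta> \<omega>) :: ennreal) \<in> borel_measurable (PiM {..<n} (\<lambda>_. gaussm))"
        by (rule borel_measurable_of_bool_ennreal)
      show "(\<integral>\<^sup>+\<omega>. of_bool (ev T n \<delta> \<omega>) \<partial>PiM {..<n} (\<lambda>_. gaussm)) \<le> ennreal (C / (real n * \<delta>\<^sup>2))"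
        unfolding nn_integral_of_bool_eq[OF ev] P.emeasure_eq_measure using C(2)[OF n] by (intro ennreal_leI) (simp add: ev_def)
    qed
  qed
  then obtain C where C0: "\<And>T. T \<in> \<L> \<Longrightarrow> 0 \<le> C T"
    and C: "\<And>T n \<delta>. T \<in> \<L> \<Longrightarrow> 0 < n \<Longrightarrow> 0 < \<delta> \<Longrightarrow> (\<lambda>\<omega>. of_bool (ev T n \<delta> \<omega>) :: ennreal) \<in> borel_measurable (PiM {..<n} (\<lambda>_. gaussm))"
      "\<And>T n \<delta>. T \<in> \<L> \<Longrightarrow> 0 < n \<Longrightarrow> 0 < \<delta> \<Longrightarrow> (\<integral>\<^sup>+\<omega>. of_bool (ev T n \<delta> \<omega>) \<partial>PiM {..<n} (\<lambda>_. gaussm)) \<le> ennreal (C T / (real n * \<delta>\<^sup>2))"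
    by metis
  show ?thesis
  proof (rule that[of "\<Sum>T\<in>\<L>. C T"])
    show "0 \<le> (\<Sum>T\<in>\<L>. C T)" by (intro sum_nonneg C0)
    fix n :: nat and \<delta> :: real assume n: "0 < n" "0 < \<delta>"
    have "(\<integral>\<^sup>+\<omega>. of_bool (\<exists>T\<in>\<L>. ev T n \<delta> \<omega>) \<partial>PiM {..<n} (\<lambda>_. gaussm)) \<le> (\<integral>\<^sup>+\<omega>. (\<Sum>T\<in>\<L>. of_bool (ev T n \<delta> \<omega>)) \<partial>PiM {..<n} (\<lambda>_. gaussm))"
    proof (intro nn_integral_mono)
      fix \<omega>
      show "of_bool (\<exists>T\<in>\<L>. ev T n \<delta> \<omega>) \<le> (\<Sum>T\<in>\<L>. of_bool (ev T n \<delta> \<omega>) :: ennreal)"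
      proof (cases "\<exists>T\<in>\<L>. ev T n \<delta> \<omega>")
        case True
        then obtain T where T: "T \<in> \<L>" "ev T n \<delta> \<omega>" by blast
        show ?thesis using member_le_sum[OF T(1), of "\<lambda>T. of_bool (ev T n \<delta> \<omega>) :: ennreal"] T assms(1) by auto
      qed simp
    qed
    also have "\<dots> = (\<Sum>T\<in>\<L>. \<integral>\<^sup>+\<omega>. of_bool (ev T n \<delta> \<omega>) \<partial>PiM {..<n} (\<lambda>_. gaussm))"
      by (intro nn_integral_sum C n)
    also have "\<dots> \<le> (\<Sum>T\<in>\<L>. ennreal (C T / (real n * \<delta>\<^sup>2)))" by (intro sum_mono C n)
    also have "\<dots> = ennreal ((\<Sum>T\<in>\<L>. C T) / (real n * \<delta>\<^sup>2))"
      using C0 by (subst sum_ennreal) (auto simp: sum_divide_distrib)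
    finally show "(\<integral>\<^sup>+\<omega>. of_bool (\<exists>T\<in>\<L>. real n * \<delta> \<le> \<bar>(\<Sum>i<n. (norm (T (\<omega> i)))\<^sup>2) - real n * (\<integral>x. (norm (T x))\<^sup>2 \<partial>gaussm)\<bar>) \<partial>PiM {..<n} (\<lambda>_. gaussm))
      \<le> ennreal ((\<Sum>T\<in>\<L>. C T) / (real n * \<delta>\<^sup>2))"
      by (simp add: ev_def)
  qed
qed

text \<open>User 1 treats the signal of user 2 as noise, so its effective noise covariance is
  \<open>N\<close>; user 2 is encoded last, with the word of user 1 known, and loses no rate to it.
  Rate 0 is allowed without slack, since a single message needs no protection.\<close>

theorem dirty_paper_achievable:
  fixes G :: "complex^'t^'r" and K :: "complex^'t^'q" and Qp Qc :: "complex^'t^'t"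
  assumes Q: "psd Qp" "psd Qc" and P: "Re (trace Qp) + Re (trace Qc) < P"
    and R: "0 \<le> R1" "0 \<le> R2"
    and R1: "R1 = 0 \<or> R1 < logdet (mat 1 + G ** (Qp + Qc) ** ctrans G) - logdet (mat 1 + G ** Qc ** ctrans G)"
    and R2: "R2 = 0 \<or> R2 < logdet (mat 1 + K ** Qc ** ctrans K)"
  shows "bc_achievable G K P (R1, R2)"
proof -
  define N where "N = mat 1 + G ** Qc ** ctrans G"
  have N: "pdef N" unfolding N_def by (intro pdef_add_psd pdef_mat_1 psd_congr Q)
  define N' where "N' = matrix_inv N"
  have N': "N ** N' = mat 1" "N' ** N = mat 1" "ctrans N' = N'"
    unfolding N'_def by (intro matrix_inv_mul pdef_invertible N)+ (intro psd_hermitian pdef_psd pdef_matrix_inv N)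
  \<comment> \<open>Both factors are chosen so that the matrices inside the rate formulas become
    diagonal. The rates \<open>I1\<close>, \<open>I2\<close> are then sums of logarithms over the
    diagonal, as the likelihoods of \<open>gaussm_diag_likelihood\<close> require.\<close>
  obtain B2 :: "complex^'t^'t" and d2 where B2: "Qc = B2 ** ctrans B2" "mat 1 + ctrans B2 ** (ctrans K ** K) ** B2 = diagm d2" "\<And>i. 1 \<le> d2 i"
    using psd_factor_diagonalizing[OF Q(2) psd_ctrans_mult[of K]] by metis
  have "psd (ctrans G ** N' ** G)" unfolding N'_def by (intro psd_congr' pdef_psd pdef_matrix_inv N)
  then obtain B1 :: "complex^'t^'t" and d1 where B1: "Qp = B1 ** ctrans B1" "mat 1 + ctrans B1 ** (ctrans G ** N' ** G) ** B1 = diagm d1" "\<And>i. 1 \<le> d1 i"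
    using psd_factor_diagonalizing[OF Q(1)] by metis
  have d: "0 < d1 i" "0 < d2 i" for i using B1(3)[of i] B2(3)[of i] by linarith+
  define I1 where "I1 = (\<Sum>i\<in>UNIV. ln (d1 i))"
  define I2 where "I2 = (\<Sum>i\<in>UNIV. ln (d2 i))"
  define G1 where "G1 = G ** B1"
  define K2 where "K2 = K ** B2"
  have H1: "mat 1 + ctrans G1 ** N' ** G1 = diagm d1" using B1(2) by (simp add: G1_def ctrans_mul matrix_mul_assoc)
  have H2: "mat 1 + ctrans K2 ** K2 = diagm d2" using B2(2) by (simp add: K2_def ctrans_mul matrix_mul_assoc)
  have "mat 1 + G ** (Qp + Qc) ** ctrans G = N + G1 ** ctrans G1"
    by (simp add: N_def G1_def B1(1) ctrans_mul matrix_add_ldistrib matrix_add_rdistrib matrix_mul_assoc)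
  then have I1: "logdet (mat 1 + G ** (Qp + Qc) ** ctrans G) - logdet (mat 1 + G ** Qc ** ctrans G) = I1"
    using logdet_ratio[OF N, of G1] H1 logdet_diagm[OF d(1)] by (simp add: N_def[symmetric] N'_def[symmetric] I1_def)
  have "K ** Qc ** ctrans K = K2 ** ctrans K2" by (simp add: K2_def B2(1) ctrans_mul matrix_mul_assoc)
  then have I2: "logdet (mat 1 + K ** Qc ** ctrans K) = I2"
    using logdet_sylvester[of K2] H2 logdet_diagm[OF d(2)] by (simp add: I2_def)
  define E1 where "E1 = diagm (\<lambda>i. 1 / d1 i)"
  define E2 where "E2 = diagm (\<lambda>i. 1 / d2 i)"
  define D1 where "D1 = diagm (\<lambda>i. sqrt (d1 i))"
  define D2 where "D2 = diagm (\<lambda>i. sqrt (d2 i))"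
  have Ed: "E1 ** diagm d1 = mat 1" "E2 ** diagm d2 = mat 1"
    using d by (simp_all add: E1_def E2_def diagm_mul diagm_1 less_imp_neq[THEN not_sym])
  have hE: "ctrans E1 = E1" "ctrans E2 = E2" "ctrans D1 = D1" "ctrans D2 = D2"
    by (simp_all add: E1_def E2_def D1_def D2_def)
  \<comment> \<open>\<open>W1\<close> is the linear minimum mean square error estimator of
    \<open>a\<close> from the first output, \<open>W2\<close> that of \<open>b\<close> from the
    second output with \<open>a\<close> removed.\<close>
  define W1 where "W1 = E1 ** ctrans G1 ** N'"
  define W2 where "W2 = E2 ** ctrans K2"
  define A where "A = W2 ** K ** B1"
  \<comment> \<open>This is the mean of \<open>l0\<close>, the covering cost per symbol. The same
    \<open>l\<close> reappears in the mean of \<open>l2\<close> and offsets that cost in the rate of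
    user 2.\<close>
  define l where "l = frob A"
  have l0: "0 \<le> l" by (simp add: l_def frob_def sum_nonneg)
  let ?t = "real CARD('t)"
  \<comment> \<open>Here \<open>A\<close> is Costa's coefficient: it removes \<open>a\<close> from the estimation error of \<open>u = A a + b\<close>.\<close>
  define TA where "TA = (lin4 A (mat 1) (0::complex^'r^'t) (0::complex^'q^'t))"
  define Ta where "Ta = (lin4 (mat 1) (0::complex^'t^'t) (0::complex^'r^'t) (0::complex^'q^'t))"
  define Tb where "Tb = (lin4 (0::complex^'t^'t) (mat 1) (0::complex^'r^'t) (0::complex^'q^'t))"
  define Tx where "Tx = (lin4 B1 B2 (0::complex^'r^'t) (0::complex^'q^'t))"
  define T1 where "T1 = (lin4 (D1 ** E1) (- (D1 ** W1 ** G ** B2)) (- (D1 ** W1)) (0::complex^'q^'t))"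
  define T2 where "T2 = (lin4 (0::complex^'t^'t) (D2 ** E2) (0::complex^'r^'t) (- (D2 ** W2)))"
  define \<L> where "\<L> = {TA, Ta, Tb, Tx, T1, T2}"
  have lin: "linear T" if "T \<in> \<L>" for T
    using that by (auto simp: \<L>_def TA_def Ta_def Tb_def Tx_def T1_def T2_def linear_lin4)
  have mA: "(\<integral>x. (norm (TA x))\<^sup>2 \<partial>gaussm) = l + ?t" by (simp add: TA_def lin4_mean l_def)
  have ma: "(\<integral>x. (norm (Ta x))\<^sup>2 \<partial>gaussm) = ?t" by (simp add: Ta_def lin4_mean)
  have mb: "(\<integral>x. (norm (Tb x))\<^sup>2 \<partial>gaussm) = ?t" by (simp add: Tb_def lin4_mean)
  have mx: "(\<integral>x. (norm (Tx x))\<^sup>2 \<partial>gaussm) = Re (trace Qp) + Re (trace Qc)"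
    by (simp add: Tx_def lin4_mean frob_eq_trace[of B1] frob_eq_trace[of B2] B1(1) B2(1))
  \<comment> \<open>The whitened estimation error has the dimension as mean square, just like
    \<open>a\<close> itself; in the mean of \<open>l1\<close> the two cancel and leave
    \<open>I1\<close>.\<close>
  have m1: "(\<integral>x. (norm (T1 x))\<^sup>2 \<partial>gaussm) = ?t"
  proof -
    have "frob (D1 ** W1 ** G ** B2) + frob (D1 ** W1) = Re (trace (D1 ** W1 ** N ** ctrans W1 ** D1))"
      unfolding frob_eq_trace N_def B2(1)
      by (simp add: matrix_add_ldistrib matrix_add_rdistrib trace_add ctrans_mul hE matrix_mul_assoc)
    also have "D1 ** W1 ** N ** ctrans W1 ** D1 = D1 ** E1 ** ctrans G1 ** N' ** (N ** N') ** G1 ** E1 ** D1"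
      by (simp add: W1_def ctrans_mul hE N'(3) matrix_mul_assoc)
    also have "\<dots> = D1 ** E1 ** (ctrans G1 ** N' ** G1) ** E1 ** D1" by (simp add: N' matrix_mul_assoc)
    finally have "frob (D1 ** W1 ** G ** B2) + frob (D1 ** W1) = Re (trace (D1 ** E1 ** (ctrans G1 ** N' ** G1) ** E1 ** D1))" .
    moreover have "frob (D1 ** E1) = Re (trace (D1 ** E1 ** mat 1 ** E1 ** D1))"
      by (simp add: frob_eq_trace ctrans_mul hE matrix_mul_assoc)
    ultimately have "frob (D1 ** E1) + frob (D1 ** W1 ** G ** B2) + frob (D1 ** W1)
        = Re (trace (D1 ** E1 ** (mat 1 + ctrans G1 ** N' ** G1) ** E1 ** D1))"
      by (simp add: matrix_add_ldistrib matrix_add_rdistrib trace_add)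
    also have "\<dots> = ?t" unfolding D1_def E1_def by (rule frob_whitened[OF d(1) H1])
    finally show ?thesis by (simp add: T1_def lin4_mean)
  qed
  have m2: "(\<integral>x. (norm (T2 x))\<^sup>2 \<partial>gaussm) = ?t"
  proof -
    have "frob (D2 ** W2) = Re (trace (D2 ** E2 ** (ctrans K2 ** K2) ** E2 ** D2))"
      by (simp add: frob_eq_trace W2_def ctrans_mul hE matrix_mul_assoc)
    moreover have "frob (D2 ** E2) = Re (trace (D2 ** E2 ** mat 1 ** E2 ** D2))"
      by (simp add: frob_eq_trace ctrans_mul hE matrix_mul_assoc)
    ultimately have "frob (D2 ** E2) + frob (D2 ** W2) = Re (trace (D2 ** E2 ** (mat 1 + ctrans K2 ** K2) ** E2 ** D2))"
      by (simp add: matrix_add_ldistrib matrix_add_rdistrib trace_add)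
    also have "\<dots> = ?t" unfolding D2_def E2_def by (rule frob_whitened[OF d(2) H2])
    finally show ?thesis by (simp add: T2_def lin4_mean)
  qed
  define x where "x \<omega> = B1 *v fst (fst \<omega>) + B2 *v snd (fst \<omega>)"
    for \<omega> :: "((complex^'t) \<times> (complex^'t)) \<times> ((complex^'r) \<times> (complex^'q))"
  have ex: "Tx \<omega> = x \<omega>" and eA: "TA \<omega> = A *v fst (fst \<omega>) + snd (fst \<omega>)" and ea: "Ta \<omega> = fst (fst \<omega>)"
    and eb: "Tb \<omega> = snd (fst \<omega>)" for \<omega>
    by (simp_all add: Tx_def x_def TA_def Ta_def Tb_def lin4_def)
  \<comment> \<open>As \<open>W1 ** G1 = mat 1 - E1\<close>, the part of the error due to
    \<open>a\<close> is \<open>E1 *v a\<close>; the rest is interference and noise, independent of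
    it.\<close>
  have e1: "T1 \<omega> = D1 *v (fst (fst \<omega>) - W1 *v (G *v x \<omega> + fst (snd \<omega>)))" for \<omega>
  proof -
    have "mat 1 - W1 ** G1 = E1"
    proof -
      have "W1 ** G1 = E1 ** (diagm d1 - mat 1)" by (simp add: W1_def H1[symmetric] matrix_mul_assoc)
      then show ?thesis by (simp add: matrix_diff_ldistrib Ed)
    qed
    then have DE: "D1 ** E1 = D1 - D1 ** W1 ** G ** B1"
      by (metis G1_def matrix_diff_ldistrib matrix_mul_assoc matrix_mul_rid)
    show ?thesis unfolding T1_def lin4_def DE x_def 
      by (simp add: matrix_vector_mul_assoc matrix_vector_right_distrib matrix_vector_mult_diff_distrib
          matrix_vector_mult_diff_rdistrib matrix_vector_mult_uminus matrix_mul_assoc algebra_simps)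
  qed
  have e2: "T2 \<omega> = D2 *v (A *v fst (fst \<omega>) + snd (fst \<omega>) - W2 *v (K *v x \<omega> + snd (snd \<omega>)))" for \<omega>
  proof -
    have "mat 1 - W2 ** K2 = E2"
    proof -
      have "W2 ** K2 = E2 ** (diagm d2 - mat 1)" by (simp add: W2_def H2[symmetric] matrix_mul_assoc)
      then show ?thesis by (simp add: matrix_diff_ldistrib Ed)
    qed
    then have DE: "D2 ** E2 = D2 - D2 ** W2 ** K ** B2"
      by (metis K2_def matrix_diff_ldistrib matrix_mul_assoc matrix_mul_rid)
    show ?thesis unfolding T2_def lin4_def DE x_def A_def 
      by (simp add: matrix_vector_mul_assoc matrix_vector_right_distrib matrix_vector_mult_diff_distrib
          matrix_vector_mult_diff_rdistrib matrix_vector_mult_uminus matrix_mul_assoc algebra_simps)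
  qed
  define l0 where "l0 \<omega> = (norm (A *v fst (fst \<omega>) + snd (fst \<omega>)))\<^sup>2 - (norm (snd (fst \<omega>)))\<^sup>2"
    for \<omega> :: "((complex^'t) \<times> (complex^'t)) \<times> ((complex^'r) \<times> (complex^'q))"
  define l1 where "l1 \<omega> = (norm (fst (fst \<omega>)))\<^sup>2 + (\<Sum>k\<in>UNIV. ln (d1 k))
        - (\<Sum>k\<in>UNIV. d1 k * (cmod ((fst (fst \<omega>) - W1 *v (G *v x \<omega> + fst (snd \<omega>))) $ k))\<^sup>2)" for \<omega>
  define l2 where "l2 \<omega> = (norm (A *v fst (fst \<omega>) + snd (fst \<omega>)))\<^sup>2 + (\<Sum>k\<in>UNIV. ln (d2 k))
        - (\<Sum>k\<in>UNIV. d2 k * (cmod ((A *v fst (fst \<omega>) + snd (fst \<omega>) - W2 *v (K *v x \<omega> + snd (snd \<omega>))) $ k))\<^sup>2)" for \<omega>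
  have l0_eq: "l0 \<omega> = (norm (TA \<omega>))\<^sup>2 - (norm (Tb \<omega>))\<^sup>2" for \<omega> by (simp add: l0_def eA eb)
  have l1_eq: "l1 \<omega> = (norm (Ta \<omega>))\<^sup>2 + I1 - (norm (T1 \<omega>))\<^sup>2" for \<omega>
    unfolding l1_def ea e1 D1_def I1_def using d(1) by (subst norm_diagm_sqrt) (auto intro: less_imp_le)
  have l2_eq: "l2 \<omega> = (norm (TA \<omega>))\<^sup>2 + I2 - (norm (T2 \<omega>))\<^sup>2" for \<omega>
    unfolding l2_def eA e2 D2_def I2_def using d(2) by (subst norm_diagm_sqrt) (auto intro: less_imp_le)
  have R1': "R1 = 0 \<or> R1 < I1" and R2': "R2 = 0 \<or> R2 < I2" using R1 R2 by (simp_all add: I1 I2)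
  \<comment> \<open>Thresholds lie \<open>2 * \<delta>\<close> from the means and another
    \<open>\<delta>\<close> is for exponential decay, in all 3 for user 1. User 2 pays 3 more
    through the size of \<open>L\<close>. At rate 0 there is nothing to leave room for, hence the
    harmless value 1.\<close>
  define \<delta> where "\<delta> = min (P - (Re (trace Qp) + Re (trace Qc))) (min (if R1 = 0 then 1 else (I1 - R1) / 3) (if R2 = 0 then 1 else (I2 - R2) / 6))"
  have \<delta>: "0 < \<delta>" using P R1' R2' by (auto simp: \<delta>_def)
  have \<delta>P: "Re (trace Qp) + Re (trace Qc) + \<delta> \<le> P" by (simp add: \<delta>_def)
  have \<delta>1: "R1 + 3 * \<delta> \<le> I1" if "R1 \<noteq> 0"
  proof -
    have "\<delta> \<le> (if R1 = 0 then 1 else (I1 - R1) / 3)"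
      unfolding \<delta>_def by (rule min.coboundedI2[OF min.cobounded1])
    then show ?thesis using that by simp
  qed
  have \<delta>2: "R2 + 6 * \<delta> \<le> I2" if "R2 \<noteq> 0"
  proof -
    have "\<delta> \<le> (if R2 = 0 then 1 else (I2 - R2) / 6)"
      unfolding \<delta>_def by (rule min.coboundedI2[OF min.cobounded2])
    then show ?thesis using that by simp
  qed
  have P0: "0 \<le> P" using P psd_trace_nonneg[OF Q(1)] psd_trace_nonneg[OF Q(2)] by linarith
  obtain C where C0: "0 \<le> C" and C: "\<And>(n::nat) (\<delta>::real). 0 < n \<Longrightarrow> 0 < \<delta> \<Longrightarrow>
    (\<integral>\<^sup>+\<omega>. of_bool (\<exists>T\<in>\<L>. real n * \<delta> \<le> \<bar>(\<Sum>i<n. (norm (T (\<omega> i)))\<^sup>2) - real n * (\<integral>x. (norm (T x))\<^sup>2 \<partial>gaussm)\<bar>) \<partial>PiM {..<n} (\<lambda>_. gaussm))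
      \<le> ennreal (C / (real n * \<delta>\<^sup>2))"
  proof (rule finite_linear_deviation[of \<L>])
    show "finite \<L>" by (simp add: \<L>_def)
  qed (use lin in auto)
  show ?thesis
    unfolding bc_achievable_def
  proof (intro allI impI)
    fix eps :: real assume eps: "0 < eps"
    \<comment> \<open>\<open>3 * s\<close> takes half of \<open>eps\<close>. The other half covers
      four exponential terms: one each from \<open>b0\<close> and \<open>b1\<close>, two from
      \<open>b2\<close>.\<close>
    define s where "s = min (eps / 6) (1 / 2)"
    have s: "0 < s" "s < 1" "3 * s \<le> eps / 2" using eps by (auto simp: s_def)
    \<comment> \<open>The first entry makes the deviation probability at most
      \<open>s\<^sup>2\<close>; the second makes \<open>4 * exp (- (n * \<delta>))\<close> at most
      \<open>eps / 2\<close>, by way of \<open>x \<le> exp x\<close>.\<close>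
    define N0 where "N0 = nat \<lceil>max (C / (\<delta>\<^sup>2 * s\<^sup>2)) (8 / (\<delta> * eps))\<rceil> + 1"
    show "\<exists>N. \<forall>n\<ge>N. \<exists>M1 M2 f g1 g2. exp (real n * fst (R1, R2)) \<le> real M1 \<and> exp (real n * snd (R1, R2)) \<le> real M2 \<and>
        bc_code G K P n M1 M2 f g1 g2 eps"
    proof (rule exI[of _ N0], intro allI impI)
      fix n assume "N0 \<le> n"
      then have n: "0 < n" "C / (\<delta>\<^sup>2 * s\<^sup>2) \<le> real n" "8 / (\<delta> * eps) \<le> real n"
        unfolding N0_def by (auto, linarith+)
      have nC: "C / (real n * \<delta>\<^sup>2) \<le> s\<^sup>2" using n \<delta> s by (simp add: field_simps)
      have ne: "4 * exp (- (real n * \<delta>)) \<le> eps / 2"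
      proof -
        have p: "0 < real n * \<delta>" using n \<delta> by simp
        have "real n * \<delta> \<le> exp (real n * \<delta>)" using exp_ge_add_one_self[of "real n * \<delta>"] by linarith
        then have "exp (- (real n * \<delta>)) \<le> 1 / (real n * \<delta>)" using p by (simp add: exp_minus field_simps)
        moreover have "4 / (real n * \<delta>) \<le> eps / 2" using n(3) n(1) \<delta> eps by (simp add: field_simps)
        ultimately show ?thesis by simp
      qed
      \<comment> \<open>Each log likelihood sum involves two sums of squares, each within
        \<open>n * \<delta>\<close> of its mean, whence the margins \<open>2 * \<delta>\<close>. The
        exponent of \<open>L\<close> exceeds that of \<open>c0\<close> by
        \<open>n * \<delta>\<close>, so that covering succeeds.\<close>
      define c0 where "c0 = exp (real n * (l + 2 * \<delta>))"
      define c1 where "c1 = exp (real n * (I1 - 2 * \<delta>))"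
      define c2 where "c2 = exp (real n * (l + I2 - 2 * \<delta>))"
      define M1 where "M1 = nat \<lceil>exp (real n * R1)\<rceil>"
      define M2 where "M2 = nat \<lceil>exp (real n * R2)\<rceil>"
      define L where "L = nat \<lceil>exp (real n * (l + 3 * \<delta>))\<rceil>"
      have ceil: "1 \<le> nat \<lceil>exp v\<rceil>" "exp v \<le> real (nat \<lceil>exp v\<rceil>)" "real (nat \<lceil>exp v\<rceil>) - 1 \<le> exp v" for v :: real
      proof -
        have "0 < exp v" by simp
        then have "0 < \<lceil>exp v\<rceil>" by linarith
        then show "1 \<le> nat \<lceil>exp v\<rceil>" "exp v \<le> real (nat \<lceil>exp v\<rceil>)" "real (nat \<lceil>exp v\<rceil>) - 1 \<le> exp v" by linarith+
      qed
      have bad_le: "(\<integral>\<^sup>+\<omega>. of_bool (\<not> (\<Sum>i<n. (norm (x (\<omega> i)))\<^sup>2) \<le> real n * P \<or> c0 < exp (\<Sum>i<n. l0 (\<omega> i)) \<or>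
        exp (\<Sum>i<n. l1 (\<omega> i)) < c1 \<or> exp (\<Sum>i<n. l2 (\<omega> i)) < c2) \<partial>PiM {..<n} (\<lambda>_. gaussm)) \<le> ennreal (s\<^sup>2)"
      proof -
        let ?dev = "\<lambda>T \<omega>. real n * \<delta> \<le> \<bar>(\<Sum>i<n. (norm (T (\<omega> i)))\<^sup>2) - real n * (\<integral>x. (norm (T x))\<^sup>2 \<partial>gaussm)\<bar>"
        have "\<exists>T\<in>\<L>. ?dev T \<omega>" if "\<not> (\<Sum>i<n. (norm (x (\<omega> i)))\<^sup>2) \<le> real n * P \<or> c0 < exp (\<Sum>i<n. l0 (\<omega> i)) \<or>
          exp (\<Sum>i<n. l1 (\<omega> i)) < c1 \<or> exp (\<Sum>i<n. l2 (\<omega> i)) < c2" for \<omega>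
        proof (rule ccontr)
          assume "\<not> (\<exists>T\<in>\<L>. ?dev T \<omega>)"
          then have nd: "\<bar>(\<Sum>i<n. (norm (T (\<omega> i)))\<^sup>2) - real n * (\<integral>x. (norm (T x))\<^sup>2 \<partial>gaussm)\<bar> < real n * \<delta>" if "T \<in> \<L>" for T
            using that by (auto simp: not_le)
          have nA: "\<bar>(\<Sum>i<n. (norm (TA (\<omega> i)))\<^sup>2) - real n * (l + ?t)\<bar> < real n * \<delta>"
            and na: "\<bar>(\<Sum>i<n. (norm (Ta (\<omega> i)))\<^sup>2) - real n * ?t\<bar> < real n * \<delta>"
            and nb: "\<bar>(\<Sum>i<n. (norm (Tb (\<omega> i)))\<^sup>2) - real n * ?t\<bar> < real n * \<delta>"
            and nx: "\<bar>(\<Sum>i<n. (norm (Tx (\<omega> i)))\<^sup>2) - real n * (Re (trace Qp) + Re (trace Qc))\<bar> < real n * \<delta>"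
            and n1: "\<bar>(\<Sum>i<n. (norm (T1 (\<omega> i)))\<^sup>2) - real n * ?t\<bar> < real n * \<delta>"
            and n2: "\<bar>(\<Sum>i<n. (norm (T2 (\<omega> i)))\<^sup>2) - real n * ?t\<bar> < real n * \<delta>"
            using nd[of TA] nd[of Ta] nd[of Tb] nd[of Tx] nd[of T1] nd[of T2]
            unfolding mA ma mb mx m1 m2 by (simp_all add: \<L>_def)
          have "(\<Sum>i<n. (norm (x (\<omega> i)))\<^sup>2) \<le> real n * (Re (trace Qp) + Re (trace Qc) + \<delta>)"
            using nx by (simp add: ex algebra_simps)
          also have "\<dots> \<le> real n * P" using \<delta>P by (intro mult_left_mono) auto
          finally have 1: "(\<Sum>i<n. (norm (x (\<omega> i)))\<^sup>2) \<le> real n * P" .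
          have "(\<Sum>i<n. l0 (\<omega> i)) = (\<Sum>i<n. (norm (TA (\<omega> i)))\<^sup>2) - (\<Sum>i<n. (norm (Tb (\<omega> i)))\<^sup>2)"
            by (simp add: l0_eq sum_subtractf)
          also have "\<dots> \<le> real n * (l + 2 * \<delta>)" using nA nb by (simp add: algebra_simps)
          finally have 2: "exp (\<Sum>i<n. l0 (\<omega> i)) \<le> c0" by (simp add: c0_def)
          have "(\<Sum>i<n. l1 (\<omega> i)) = (\<Sum>i<n. (norm (Ta (\<omega> i)))\<^sup>2) + real n * I1 - (\<Sum>i<n. (norm (T1 (\<omega> i)))\<^sup>2)"
            by (simp add: l1_eq sum_subtractf sum.distrib)
          also have "\<dots> \<ge> real n * (I1 - 2 * \<delta>)" using na n1 by (simp add: algebra_simps)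
          finally have 3: "c1 \<le> exp (\<Sum>i<n. l1 (\<omega> i))" by (simp add: c1_def)
          have "(\<Sum>i<n. l2 (\<omega> i)) = (\<Sum>i<n. (norm (TA (\<omega> i)))\<^sup>2) + real n * I2 - (\<Sum>i<n. (norm (T2 (\<omega> i)))\<^sup>2)"
            by (simp add: l2_eq sum_subtractf sum.distrib)
          also have "\<dots> \<ge> real n * (l + I2 - 2 * \<delta>)" using nA n2 by (simp add: algebra_simps)
          finally have 4: "c2 \<le> exp (\<Sum>i<n. l2 (\<omega> i))" by (simp add: c2_def)
          show False using that 1 2 3 4 by linarith
        qed
        then have "(\<integral>\<^sup>+\<omega>. of_bool (\<not> (\<Sum>i<n. (norm (x (\<omega> i)))\<^sup>2) \<le> real n * P \<or> c0 < exp (\<Sum>i<n. l0 (\<omega> i)) \<or>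
          exp (\<Sum>i<n. l1 (\<omega> i)) < c1 \<or> exp (\<Sum>i<n. l2 (\<omega> i)) < c2) \<partial>PiM {..<n} (\<lambda>_. gaussm))
          \<le> (\<integral>\<^sup>+\<omega>. of_bool (\<exists>T\<in>\<L>. ?dev T \<omega>) \<partial>PiM {..<n} (\<lambda>_. gaussm))"
          by (intro nn_integral_mono) (simp only: of_bool_def, auto)
        also have "\<dots> \<le> ennreal (C / (real n * \<delta>\<^sup>2))" by (rule C[OF n(1) \<delta>])
        also have "\<dots> \<le> ennreal (s\<^sup>2)" by (rule ennreal_leI[OF nC])
        finally show ?thesis .
      qed
      have "\<exists>f g1 g2. bc_code G K P n M1 M2 f g1 g2
          (3 * s + exp (- real L / c0) + (real M1 - 1) / c1 + (real M2 - 1) * real L / c2)"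
        by (rule dirty_paper_block_code[OF d _ _ _ s(1,2) P0 bad_le[unfolded l0_def l1_def l2_def x_def]])
           (use ceil(1) in \<open>simp_all add: c0_def c1_def c2_def M1_def M2_def L_def\<close>)
      then obtain f g1 g2 where code: "bc_code G K P n M1 M2 f g1 g2
          (3 * s + exp (- real L / c0) + (real M1 - 1) / c1 + (real M2 - 1) * real L / c2)" by blast
      have b0: "exp (- real L / c0) \<le> exp (- (real n * \<delta>))"
      proof -
        have "real n * \<delta> \<le> exp (real n * \<delta>)" using exp_ge_add_one_self[of "real n * \<delta>"] by linarith
        also have "\<dots> = exp (real n * (l + 3 * \<delta>)) / c0" by (simp add: c0_def exp_diff[symmetric] algebra_simps)
        also have "\<dots> \<le> real L / c0" unfolding L_def by (intro divide_right_mono ceil) (simp add: c0_def)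
        finally show ?thesis by simp
      qed
      have b1: "(real M1 - 1) / c1 \<le> exp (- (real n * \<delta>))"
      proof (cases "R1 = 0")
        case False
        have "(real M1 - 1) / c1 \<le> exp (real n * R1) / c1"
          unfolding M1_def by (intro divide_right_mono ceil) (simp add: c1_def)
        also have "\<dots> = exp (real n * (R1 - (I1 - 2 * \<delta>)))" by (simp add: c1_def exp_diff[symmetric] algebra_simps)
        also have "\<dots> \<le> exp (- (real n * \<delta>))"
        proof -
          have "real n * (R1 - (I1 - 2 * \<delta>)) \<le> real n * (- \<delta>)" using \<delta>1[OF False] by (intro mult_left_mono) auto
          then show ?thesis by simp
        qed
        finally show ?thesis .
      qed (simp add: M1_def)
      have b2: "(real M2 - 1) * real L / c2 \<le> 2 * exp (- (real n * \<delta>))"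
      proof (cases "R2 = 0")
        case False
        \<comment> \<open>Rounding up \<open>L\<close> costs a factor of at most 2, as the
          exponential is at least 1.\<close>
        have e1: "1 \<le> exp (real n * (l + 3 * \<delta>))" using l0 \<delta> by simp
        have "real L \<le> 2 * exp (real n * (l + 3 * \<delta>))" using ceil(3)[of "real n * (l + 3 * \<delta>)"] e1 unfolding L_def by linarith
        moreover have "real M2 - 1 \<le> exp (real n * R2)" unfolding M2_def by (rule ceil)
        ultimately have "(real M2 - 1) * real L / c2 \<le> exp (real n * R2) * (2 * exp (real n * (l + 3 * \<delta>))) / c2"
          by (intro divide_right_mono mult_mono) (auto simp: c2_def)
        also have "\<dots> = 2 * exp (real n * (R2 + (l + 3 * \<delta>) - (l + I2 - 2 * \<delta>)))"
        proof -
          have "exp (real n * R2) * exp (real n * (l + 3 * \<delta>)) / c2 = exp (real n * R2 + real n * (l + 3 * \<delta>) - real n * (l + I2 - 2 * \<delta>))"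
            by (simp only: c2_def exp_add exp_diff)
          also have "real n * R2 + real n * (l + 3 * \<delta>) - real n * (l + I2 - 2 * \<delta>) = real n * (R2 + (l + 3 * \<delta>) - (l + I2 - 2 * \<delta>))"
            by (simp add: algebra_simps)
          finally have eq: "exp (real n * R2) * exp (real n * (l + 3 * \<delta>)) / c2 = exp (real n * (R2 + (l + 3 * \<delta>) - (l + I2 - 2 * \<delta>)))" .
          have "exp (real n * R2) * (2 * exp (real n * (l + 3 * \<delta>))) / c2 = 2 * (exp (real n * R2) * exp (real n * (l + 3 * \<delta>)) / c2)"
            by simp
          then show ?thesis by (simp only: eq)
        qed
        also have "\<dots> \<le> 2 * exp (- (real n * \<delta>))"
        proof -
          have "real n * (R2 + (l + 3 * \<delta>) - (l + I2 - 2 * \<delta>)) \<le> real n * (- \<delta>)"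
            using \<delta>2[OF False] by (intro mult_left_mono) auto
          then show ?thesis by simp
        qed
        finally show ?thesis .
      qed (simp add: M2_def)
      have "3 * s + exp (- real L / c0) + (real M1 - 1) / c1 + (real M2 - 1) * real L / c2 \<le> eps"
        using b0 b1 b2 ne s(3) by linarith
      then have "bc_code G K P n M1 M2 f g1 g2 eps" using code by (auto simp: bc_code_def)
      then show "\<exists>M1 M2 f g1 g2. exp (real n * fst (R1, R2)) \<le> real M1 \<and> exp (real n * snd (R1, R2)) \<le> real M2 \<and>
        bc_code G K P n M1 M2 f g1 g2 eps"
        using ceil(2) by (intro exI[of _ M1] exI[of _ M2] exI[of _ f] exI[of _ g1] exI[of _ g2]) (auto simp: M1_def M2_def)
    qed
  qed
qed

section \<open>Boundedness of the capacity region\<close>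

text \<open>Weighting the standard Gaussian by \<open>exp\<close> of half the squared norm gives an
  unnormalised Gaussian of doubled variance; its mass per symbol is 2 to the power
  \<open>CARD('r)\<close>. Obtained from the likelihood of mass 1 with all precisions
  \<open>1 / 2\<close>.\<close>

lemma nn_integral_exp_half_norm:
  assumes I: "finite I"
  shows "(\<integral>\<^sup>+u. ennreal (exp (\<Sum>i\<in>I. (norm (u i :: complex^'r))\<^sup>2 / 2)) \<partial>PiM I (\<lambda>_. gaussm)) = ennreal (exp (real (card I) * (real CARD('r) * ln 2)))"
proof -
  let ?c = "real (card I) * (real CARD('r) * ln 2)"
  have eq: "(\<Sum>i\<in>I. (norm (u i))\<^sup>2 + (\<Sum>k\<in>(UNIV::'r set). ln (1 / 2)) - (\<Sum>k\<in>UNIV. (1 / 2) * (cmod ((u i - 0) $ k))\<^sup>2))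
      = (\<Sum>i\<in>I. (norm (u i))\<^sup>2 / 2) - ?c" for u :: "'a \<Rightarrow> complex^'r"
  proof -
    have "(\<Sum>k\<in>UNIV. (1 / 2) * (cmod ((u i - 0) $ k))\<^sup>2) = (norm (u i))\<^sup>2 / 2" for i
      by (simp add: norm_vec_square sum_divide_distrib)
    then show ?thesis by (simp add: sum_subtractf sum.distrib ln_div sum_divide_distrib[symmetric])
  qed
  have "ennreal (exp (\<Sum>i\<in>I. (norm (u i))\<^sup>2 / 2)) = ennreal (exp ?c) * ennreal (exp ((\<Sum>i\<in>I. (norm (u i))\<^sup>2 / 2) - ?c))"
    for u :: "'a \<Rightarrow> complex^'r"
    by (simp add: ennreal_mult'[symmetric] exp_add[symmetric])
  then have "(\<integral>\<^sup>+u. ennreal (exp (\<Sum>i\<in>I. (norm (u i :: complex^'r))\<^sup>2 / 2)) \<partial>PiM I (\<lambda>_. gaussm))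
      = (\<integral>\<^sup>+u. ennreal (exp ?c) * ennreal (exp ((\<Sum>i\<in>I. (norm (u i :: complex^'r))\<^sup>2 / 2) - ?c)) \<partial>PiM I (\<lambda>_. gaussm))"
    by simp
  also have "\<dots> = ennreal (exp ?c) * (\<integral>\<^sup>+u. ennreal (exp ((\<Sum>i\<in>I. (norm (u i :: complex^'r))\<^sup>2 / 2) - ?c)) \<partial>PiM I (\<lambda>_. gaussm))"
    by (rule nn_integral_cmult) measurable
  also have "(\<integral>\<^sup>+u. ennreal (exp ((\<Sum>i\<in>I. (norm (u i :: complex^'r))\<^sup>2 / 2) - ?c)) \<partial>PiM I (\<lambda>_. gaussm)) = 1"
    using prod_gaussm_likelihood[of "\<lambda>_::'r. 1 / 2" I "\<lambda>_. 0"] I unfolding eq by simp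
  finally show ?thesis by simp
qed

text \<open>Change of measure: relative to the codebook mean, the output density of a codeword at deviation \<open>v\<close>
  is at most \<open>exp (norm v ^ 2)\<close> times that of a fixed wider Gaussian, and the decoding sets of
  different messages are disjoint.\<close>
lemma message_count_bound:
  fixes F :: "complex^'t^'r" and f :: "nat \<Rightarrow> nat \<Rightarrow> nat \<Rightarrow> complex^'t"
  assumes M: "0 < M1" "0 < M2" and n: "0 < n" and P: "0 < P"
    and k: "0 \<le> k" "\<And>v. (norm (F *v v))\<^sup>2 \<le> k * (norm v)\<^sup>2"
    and pow: "(\<Sum>i<n. tr_cov f M1 M2 i) \<le> real n * P"
    and g: "g \<in> measurable (PiM {..<n} (\<lambda>_. borel)) (count_space UNIV)"
    and err: "(\<Sum>m1<M1. \<Sum>m2<M2. measure (PiM {..<n} (\<lambda>_. gaussm))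
        {z \<in> space (PiM {..<n} (\<lambda>_. gaussm)). g (chan_out F (f m1 m2) n z) \<noteq> m1}) \<le> real (M1 * M2) / 4"
  shows "real M1 \<le> 2 * exp (real n * (real CARD('r) * ln 2 + 4 * k * P))"
proof -
  let ?\<Gamma> = "PiM {..<n} (\<lambda>_. gaussm :: (complex^'r) measure)"
  interpret \<Gamma>: prob_space ?\<Gamma> by (intro prob_space_PiM prob_space_gaussm)
  \<comment> \<open>The power constraint bounds covariances only, so codewords may share a large
    mean. It carries no information and is subtracted.\<close>
  define e where "e i = (1 / real (M1 * M2)) *\<^sub>R (\<Sum>m1<M1. \<Sum>m2<M2. f m1 m2 i)" for i
  define E where "E m1 m2 = (\<Sum>i<n. (norm (f m1 m2 i - e i))\<^sup>2)" for m1 m2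
  define S where "S m = {u \<in> space ?\<Gamma>. g (\<lambda>i\<in>{..<n}. F *v e i + u i) = m}" for m
  have gm: "(\<lambda>u. g (\<lambda>i\<in>{..<n}. F *v e i + u i)) \<in> measurable ?\<Gamma> (count_space UNIV)"
    by (rule measurable_compose[OF _ g]) measurable
  have S: "S m \<in> sets ?\<Gamma>" for m
    unfolding S_def by (rule measurable_sets_Collect[OF gm, of "\<lambda>x. x = m"]) simp
  define ch where "ch m1 m2 = measure ?\<Gamma> {z \<in> space ?\<Gamma>. g (chan_out F (f m1 m2) n z) = m1}" for m1 m2
  have chm: "(\<lambda>z. g (chan_out F x n z)) \<in> measurable ?\<Gamma> (count_space UNIV)" for x
    unfolding chan_out_def by (rule measurable_compose[OF _ g]) measurable
  have ch_err: "measure ?\<Gamma> {z \<in> space ?\<Gamma>. g (chan_out F (f m1 m2) n z) \<noteq> m1} = 1 - ch m1 m2" for m1 m2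
  proof -
    have "{z \<in> space ?\<Gamma>. g (chan_out F (f m1 m2) n z) = m1} \<in> \<Gamma>.events"
      by (rule measurable_sets_Collect[OF chm, of "\<lambda>x. x = m1"]) simp
    from \<Gamma>.prob_compl[OF this]
    have "measure ?\<Gamma> (space ?\<Gamma> - {z \<in> space ?\<Gamma>. g (chan_out F (f m1 m2) n z) = m1}) = 1 - ch m1 m2"
      unfolding ch_def .
    moreover have "space ?\<Gamma> - {z \<in> space ?\<Gamma>. g (chan_out F (f m1 m2) n z) = m1} = {z \<in> space ?\<Gamma>. g (chan_out F (f m1 m2) n z) \<noteq> m1}"
      by auto
    ultimately show ?thesis by simp
  qed
  have "(\<Sum>m1<M1. \<Sum>m2<M2. 1 - ch m1 m2) \<le> real (M1 * M2) / 4" using err unfolding ch_err .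
  then have total: "3 / 4 * real (M1 * M2) \<le> (\<Sum>m1<M1. \<Sum>m2<M2. ch m1 m2)"
    by (simp add: sum_subtractf)
  \<comment> \<open>Mass of the decoding set of \<open>m\<close> under the wide Gaussian; by
    disjointness these masses sum to at most the total, which bounds the number of messages.\<close>
  define \<rho> where "\<rho> m = enn2real (\<integral>\<^sup>+u. ennreal (exp (\<Sum>i<n. (norm (u i))\<^sup>2 / 2)) * indicator (S m) u \<partial>?\<Gamma>)" for m
  let ?h = "\<lambda>u. ennreal (exp (\<Sum>i<n. (norm (u i :: complex^'r))\<^sup>2 / 2))"
  have hm: "?h \<in> borel_measurable ?\<Gamma>" by measurable
  have tot_h: "(\<integral>\<^sup>+u. ?h u \<partial>?\<Gamma>) = ennreal (exp (real n * (real CARD('r) * ln 2)))"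
    using nn_integral_exp_half_norm[of "{..<n}", where ?'r = 'r] by simp
  have fin: "(\<integral>\<^sup>+u. ?h u * indicator (S m) u \<partial>?\<Gamma>) < \<top>" for m
  proof -
    have "(\<integral>\<^sup>+u. ?h u * indicator (S m) u \<partial>?\<Gamma>) \<le> (\<integral>\<^sup>+u. ?h u \<partial>?\<Gamma>)"
      by (intro nn_integral_mono) (auto simp: indicator_def)
    then show ?thesis unfolding tot_h by (simp add: le_less_trans)
  qed
  have \<rho>: "ennreal (\<rho> m) = (\<integral>\<^sup>+u. ?h u * indicator (S m) u \<partial>?\<Gamma>)" for m
    unfolding \<rho>_def using fin by (simp add: less_top)
  have \<rho>0: "0 \<le> \<rho> m" for m by (simp add: \<rho>_def)
  have sum\<rho>: "(\<Sum>m<M1. \<rho> m) \<le> exp (real n * (real CARD('r) * ln 2))"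
  proof -
    have "ennreal (\<Sum>m<M1. \<rho> m) = (\<Sum>m<M1. \<integral>\<^sup>+u. ?h u * indicator (S m) u \<partial>?\<Gamma>)"
      by (simp add: sum_ennreal[symmetric] \<rho>0 \<rho>)
    also have "\<dots> = (\<integral>\<^sup>+u. (\<Sum>m<M1. ?h u * indicator (S m) u) \<partial>?\<Gamma>)"
      by (rule nn_integral_sum[symmetric]) (intro borel_measurable_times_ennreal hm borel_measurable_indicator S)
    also have "\<dots> \<le> (\<integral>\<^sup>+u. ?h u \<partial>?\<Gamma>)"
    proof (intro nn_integral_mono)
      fix u
      have "(\<Sum>m<M1. indicator (S m) u :: ennreal) \<le> (\<Sum>m<M1. of_bool (m = g (\<lambda>i\<in>{..<n}. F *v e i + u i)))"
        by (intro sum_mono) (auto simp: S_def indicator_def)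
      also have "\<dots> \<le> 1" by (simp add: of_bool_def)
      finally have "?h u * (\<Sum>m<M1. indicator (S m) u) \<le> ?h u * 1" by (rule mult_left_mono) simp
      then show "(\<Sum>m<M1. ?h u * indicator (S m) u) \<le> ?h u" by (simp add: sum_distrib_left)
    qed
    finally show ?thesis unfolding tot_h by (simp add: ennreal_le_iff)
  qed
  have bound: "ch m1 m2 \<le> exp (k * E m1 m2) * \<rho> m1" for m1 m2
  proof -
    define v where "v i = F *v (f m1 m2 i - e i)" for i
    have "{z \<in> space ?\<Gamma>. g (chan_out F (f m1 m2) n z) = m1} = {b \<in> space ?\<Gamma>. (\<lambda>i\<in>{..<n}. v i + b i) \<in> S m1}"
    proof -
      have "chan_out F (f m1 m2) n z = (\<lambda>i\<in>{..<n}. F *v e i + (\<lambda>i\<in>{..<n}. v i + z i) i)" for z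
        by (auto simp: chan_out_def v_def matrix_vector_mult_diff_distrib restrict_def)
      moreover have "(\<lambda>i\<in>{..<n}. v i + z i) \<in> space ?\<Gamma>" for z by (auto simp: space_PiM)
      ultimately show ?thesis by (simp add: S_def)
    qed
    then have "ennreal (ch m1 m2) = (\<integral>\<^sup>+u. ennreal (exp (\<Sum>i<n. (norm (u i))\<^sup>2 - (norm (u i - v i))\<^sup>2)) * indicator (S m1) u \<partial>?\<Gamma>)"
      unfolding ch_def \<Gamma>.emeasure_eq_measure[symmetric] using gaussm_PiM_shift[OF finite_lessThan S[of m1], where v = v] by simp
    also have "\<dots> \<le> (\<integral>\<^sup>+u. ennreal (exp (k * E m1 m2)) * (?h u * indicator (S m1) u) \<partial>?\<Gamma>)"
    proof (intro nn_integral_mono)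
      fix u :: "nat \<Rightarrow> complex^'r"
      have "(\<Sum>i<n. (norm (u i))\<^sup>2 - (norm (u i - v i))\<^sup>2) \<le> (\<Sum>i<n. k * (norm (f m1 m2 i - e i))\<^sup>2 + (norm (u i))\<^sup>2 / 2)"
      proof (rule sum_mono)
        fix i
        \<comment> \<open>Completing the square with \<open>2 *\<^sub>R v i\<close> leaves half of
          the squared norm of \<open>u i\<close>, the exponent of the wide Gaussian, plus the
          squared norm of \<open>v i\<close>.\<close>
        have "0 \<le> (norm (u i - 2 *\<^sub>R v i))\<^sup>2" by simp
        then have "(norm (u i))\<^sup>2 - (norm (u i - v i))\<^sup>2 \<le> (norm (v i))\<^sup>2 + (norm (u i))\<^sup>2 / 2"
          unfolding power2_norm_eq_inner by (simp add: inner_diff_left inner_diff_right inner_commute)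
        then show "(norm (u i))\<^sup>2 - (norm (u i - v i))\<^sup>2 \<le> k * (norm (f m1 m2 i - e i))\<^sup>2 + (norm (u i))\<^sup>2 / 2"
          using k(2)[of "f m1 m2 i - e i"] by (simp add: v_def)
      qed
      also have "\<dots> = k * E m1 m2 + (\<Sum>i<n. (norm (u i))\<^sup>2 / 2)" by (simp add: E_def sum.distrib sum_distrib_left)
      finally have "ennreal (exp (\<Sum>i<n. (norm (u i))\<^sup>2 - (norm (u i - v i))\<^sup>2)) \<le> ennreal (exp (k * E m1 m2)) * ?h u"
        by (simp add: ennreal_mult'[symmetric] exp_add[symmetric] ennreal_leI)
      then show "ennreal (exp (\<Sum>i<n. (norm (u i))\<^sup>2 - (norm (u i - v i))\<^sup>2)) * indicator (S m1) u \<le> ennreal (exp (k * E m1 m2)) * (?h u * indicator (S m1) u)"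
        by (simp add: indicator_def)
    qed
    also have "\<dots> = ennreal (exp (k * E m1 m2)) * ennreal (\<rho> m1)"
      unfolding \<rho> by (rule nn_integral_cmult) (intro borel_measurable_times_ennreal hm borel_measurable_indicator S)
    finally show ?thesis by (simp add: ennreal_mult'[symmetric] \<rho>0 ennreal_le_iff)
  qed
  have Epos: "0 \<le> E m1 m2" for m1 m2 by (simp add: E_def sum_nonneg)
  have sumE: "(\<Sum>m1<M1. \<Sum>m2<M2. E m1 m2) \<le> real (M1 * M2) * (real n * P)"
  proof -
    have tc: "tr_cov f M1 M2 i = (1 / real (M1 * M2)) * (\<Sum>m1<M1. \<Sum>m2<M2. (norm (f m1 m2 i - e i))\<^sup>2)" for i
      by (simp add: tr_cov_def Let_def e_def)
    have "(\<Sum>m1<M1. \<Sum>m2<M2. E m1 m2) = (\<Sum>m1<M1. \<Sum>i<n. \<Sum>m2<M2. (norm (f m1 m2 i - e i))\<^sup>2)"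
      unfolding E_def by (intro sum.cong refl sum.swap)
    also have "\<dots> = (\<Sum>i<n. \<Sum>m1<M1. \<Sum>m2<M2. (norm (f m1 m2 i - e i))\<^sup>2)" by (rule sum.swap)
    also have "\<dots> = real (M1 * M2) * (\<Sum>i<n. tr_cov f M1 M2 i)"
      unfolding tc sum_distrib_left[symmetric] using M by simp
    also have "\<dots> \<le> real (M1 * M2) * (real n * P)" using pow by (intro mult_left_mono) auto
    finally show ?thesis .
  qed
  let ?B = "exp (k * (4 * real n * P))"
  \<comment> \<open>Markov split at four times the permitted mean energy: above it the success
    probability is bounded by \<open>E / (4 * n * P)\<close>, whose average is at most 1/4. Success
    has average at least 3/4, so one half is left to the change of measure.\<close>
  have pt: "ch m1 m2 \<le> E m1 m2 / (4 * real n * P) + ?B * \<rho> m1" for m1 m2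
  proof (cases "E m1 m2 \<le> 4 * real n * P")
    case True
    have "ch m1 m2 \<le> exp (k * E m1 m2) * \<rho> m1" by (rule bound)
    also have "\<dots> \<le> ?B * \<rho> m1" using True k \<rho>0 by (intro mult_right_mono) (auto intro!: mult_left_mono)
    finally show ?thesis using Epos[of m1 m2] n P by (simp add: add_increasing)
  next
    case False
    then have "1 \<le> E m1 m2 / (4 * real n * P)" using n P by (simp add: field_simps)
    moreover have "ch m1 m2 \<le> 1" by (simp add: ch_def)
    moreover have "0 \<le> ?B * \<rho> m1" using \<rho>0 by simp
    ultimately show ?thesis by linarith
  qed
  have "3 / 4 * real (M1 * M2) \<le> (\<Sum>m1<M1. \<Sum>m2<M2. E m1 m2 / (4 * real n * P) + ?B * \<rho> m1)"
    by (rule order_trans[OF total]) (intro sum_mono pt)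
  also have "\<dots> = (\<Sum>m1<M1. \<Sum>m2<M2. E m1 m2) / (4 * real n * P) + real M2 * (?B * (\<Sum>m1<M1. \<rho> m1))"
    by (simp add: sum.distrib sum_divide_distrib sum_distrib_left mult.left_commute)
  also have "\<dots> \<le> (real (M1 * M2) * (real n * P)) / (4 * real n * P) + real M2 * (?B * exp (real n * (real CARD('r) * ln 2)))"
    using sumE sum\<rho> n P by (intro add_mono divide_right_mono mult_left_mono) auto
  also have "(real (M1 * M2) * (real n * P)) / (4 * real n * P) = real (M1 * M2) / 4" using n P by simp
  also have "?B * exp (real n * (real CARD('r) * ln 2)) = exp (real n * (real CARD('r) * ln 2 + 4 * k * P))"
    by (simp add: exp_add[symmetric] algebra_simps)
  finally have "real M2 * (real M1 / 2) \<le> real M2 * exp (real n * (real CARD('r) * ln 2 + 4 * k * P))"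
    by (simp add: algebra_simps)
  then show ?thesis using M by simp
qed

lemma matrix_vector_norm_bound:
  fixes F :: "complex^'t^'r"
  obtains k where "0 \<le> k" "\<And>v. (norm (F *v v))\<^sup>2 \<le> k * (norm v)\<^sup>2"
proof -
  obtain c where c: "\<And>v. norm (F *v v) \<le> norm v * c" "0 \<le> c"
    using bounded_linear.nonneg_bounded[OF matrix_vector_mul_bounded_linear[of F]] by blast
  have "(norm (F *v v))\<^sup>2 \<le> c\<^sup>2 * (norm v)\<^sup>2" for v
    using power_mono[OF c(1)[of v], of 2] by (simp add: power_mult_distrib mult.commute)
  then show ?thesis using that[of "c\<^sup>2"] by simp
qed

text \<open>A single block length with error probability 1/4 bounds both rates through
  \<open>message_count_bound\<close>; for user 2 the roles of the messages are exchanged.\<close>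

theorem bc_achievable_bounded:
  fixes G :: "complex^'t^'r" and K :: "complex^'t^'q"
  assumes P: "0 < P"
  obtains c where "\<And>R. bc_achievable G K P R \<Longrightarrow> fst R \<le> c \<and> snd R \<le> c"
proof -
  obtain k1 where k1: "0 \<le> k1" "\<And>v. (norm (G *v v))\<^sup>2 \<le> k1 * (norm v)\<^sup>2"
    using matrix_vector_norm_bound[of G] by metis
  obtain k2 where k2: "0 \<le> k2" "\<And>v. (norm (K *v v))\<^sup>2 \<le> k2 * (norm v)\<^sup>2"
    using matrix_vector_norm_bound[of K] by metis
  define c1 where "c1 = real CARD('r) * ln 2 + 4 * k1 * P"
  define c2 where "c2 = real CARD('q) * ln 2 + 4 * k2 * P"
  \<comment> \<open>The factor 2 in the message count costs \<open>ln 2 / n\<close>, which is at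
    most 1.\<close>
  have lim: "x \<le> c + 1" if "0 < n" "exp (real n * x) \<le> m" "m \<le> 2 * exp (real n * c)" for n :: nat and x c m :: real
  proof -
    have "exp (real n * x) \<le> exp (ln 2) * exp (real n * c)" using that by simp
    also have "\<dots> = exp (ln 2 + real n * c)" by (rule exp_add[symmetric])
    finally have "real n * x \<le> ln 2 + real n * c" by simp
    also have "ln 2 \<le> (1::real)" using ln_le_minus_one[of 2] by simp
    finally have "real n * (x - c) \<le> 1" by (simp add: algebra_simps)
    moreover have "1 * (x - c) \<le> real n * (x - c)" if "0 \<le> x - c" using that \<open>0 < n\<close> by (intro mult_right_mono) auto
    ultimately show ?thesis by (cases "0 \<le> x - c") auto
  qed
  show ?thesis
  proof (rule that[of "max (c1 + 1) (c2 + 1)"])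
    fix R assume "bc_achievable G K P R"
    then obtain N where N: "\<And>n. n \<ge> N \<Longrightarrow> \<exists>M1 M2 f g1 g2. exp (real n * fst R) \<le> real M1 \<and> exp (real n * snd R) \<le> real M2 \<and>
        bc_code G K P n M1 M2 f g1 g2 (1 / 4)"
      unfolding bc_achievable_def by (metis zero_less_divide_1_iff zero_less_numeral)
    define n where "n = N + 1"
    have n: "0 < n" by (simp add: n_def)
    obtain M1 M2 f g1 g2 where R1: "exp (real n * fst R) \<le> real M1" and R2: "exp (real n * snd R) \<le> real M2"
      and code: "bc_code G K P n M1 M2 f g1 g2 (1 / 4)" using N[of n] by (auto simp: n_def)
    let ?\<Gamma>1 = "PiM {..<n} (\<lambda>_. gaussm :: (complex^'r) measure)" and ?\<Gamma>2 = "PiM {..<n} (\<lambda>_. gaussm :: (complex^'q) measure)"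
    interpret \<Gamma>1: prob_space ?\<Gamma>1 by (intro prob_space_PiM prob_space_gaussm)
    interpret \<Gamma>2: prob_space ?\<Gamma>2 by (intro prob_space_PiM prob_space_gaussm)
    interpret Z: pair_prob_space ?\<Gamma>1 ?\<Gamma>2 ..
    have nm: "noise_meas n = ?\<Gamma>1 \<Otimes>\<^sub>M ?\<Gamma>2" by (simp add: noise_meas_def cnormal_vec_eq_gaussm)
    have M: "0 < M1" "0 < M2" and g: "g1 \<in> measurable (PiM {..<n} (\<lambda>_. borel)) (count_space UNIV)"
        "g2 \<in> measurable (PiM {..<n} (\<lambda>_. borel)) (count_space UNIV)"
      and pow: "(\<Sum>i<n. tr_cov f M1 M2 i) \<le> real n * P" and err: "avg_err G K n M1 M2 f g1 g2 \<le> 1 / 4"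
      using code by (auto simp: bc_code_def)
    have ch1: "(\<lambda>z. g1 (chan_out G x n z)) \<in> measurable ?\<Gamma>1 (count_space UNIV)" for x
      unfolding chan_out_def by (rule measurable_compose[OF _ g(1)]) measurable
    have ch2: "(\<lambda>z. g2 (chan_out K x n z)) \<in> measurable ?\<Gamma>2 (count_space UNIV)" for x
      unfolding chan_out_def by (rule measurable_compose[OF _ g(2)]) measurable
    define er where "er m1 m2 = measure (?\<Gamma>1 \<Otimes>\<^sub>M ?\<Gamma>2) {zz \<in> space (?\<Gamma>1 \<Otimes>\<^sub>M ?\<Gamma>2).
        g1 (chan_out G (f m1 m2) n (fst zz)) \<noteq> m1 \<or> g2 (chan_out K (f m1 m2) n (snd zz)) \<noteq> m2}" for m1 m2
    have er: "(\<Sum>m1<M1. \<Sum>m2<M2. er m1 m2) \<le> real (M1 * M2) / 4"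
      using err M unfolding avg_err_def nm er_def by (simp add: field_simps)
    have ev: "{zz \<in> space (?\<Gamma>1 \<Otimes>\<^sub>M ?\<Gamma>2). g1 (chan_out G (f m1 m2) n (fst zz)) \<noteq> m1 \<or> g2 (chan_out K (f m1 m2) n (snd zz)) \<noteq> m2}
        \<in> sets (?\<Gamma>1 \<Otimes>\<^sub>M ?\<Gamma>2)" for m1 m2
      using pred_neq_disj[OF measurable_compose[OF measurable_fst ch1] measurable_compose[OF measurable_snd ch2]]
      by (simp add: pred_def)
    have A1: "{z \<in> space ?\<Gamma>1. g1 (chan_out G (f m1 m2) n z) \<noteq> m1} \<in> sets ?\<Gamma>1" for m1 m2
      by (rule measurable_sets_Collect[OF ch1, of "\<lambda>x. x \<noteq> m1"]) simp
    have A2: "{z \<in> space ?\<Gamma>2. g2 (chan_out K (f m1 m2) n z) \<noteq> m2} \<in> sets ?\<Gamma>2" for m1 m2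
      by (rule measurable_sets_Collect[OF ch2, of "\<lambda>x. x \<noteq> m2"]) simp
    have le1: "measure ?\<Gamma>1 {z \<in> space ?\<Gamma>1. g1 (chan_out G (f m1 m2) n z) \<noteq> m1} \<le> er m1 m2" for m1 m2
    proof -
      have "measure ?\<Gamma>1 {z \<in> space ?\<Gamma>1. g1 (chan_out G (f m1 m2) n z) \<noteq> m1} * measure ?\<Gamma>2 (space ?\<Gamma>2)
          = measure (?\<Gamma>1 \<Otimes>\<^sub>M ?\<Gamma>2) ({z \<in> space ?\<Gamma>1. g1 (chan_out G (f m1 m2) n z) \<noteq> m1} \<times> space ?\<Gamma>2)"
        by (simp add: measure_def \<Gamma>2.emeasure_pair_measure_Times[OF A1 sets.top] enn2real_mult)
      also have "\<dots> \<le> er m1 m2"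
        unfolding er_def by (rule Z.P.finite_measure_mono[OF _ ev]) (auto simp: space_pair_measure)
      finally show ?thesis by (simp add: \<Gamma>2.prob_space)
    qed
    have le2: "measure ?\<Gamma>2 {z \<in> space ?\<Gamma>2. g2 (chan_out K (f m1 m2) n z) \<noteq> m2} \<le> er m1 m2" for m1 m2
    proof -
      have "measure ?\<Gamma>1 (space ?\<Gamma>1) * measure ?\<Gamma>2 {z \<in> space ?\<Gamma>2. g2 (chan_out K (f m1 m2) n z) \<noteq> m2}
          = measure (?\<Gamma>1 \<Otimes>\<^sub>M ?\<Gamma>2) (space ?\<Gamma>1 \<times> {z \<in> space ?\<Gamma>2. g2 (chan_out K (f m1 m2) n z) \<noteq> m2})"
        by (simp add: measure_def \<Gamma>2.emeasure_pair_measure_Times[OF sets.top A2] enn2real_mult)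
      also have "\<dots> \<le> er m1 m2"
        unfolding er_def by (rule Z.P.finite_measure_mono[OF _ ev]) (auto simp: space_pair_measure)
      finally show ?thesis by (simp add: \<Gamma>1.prob_space)
    qed
    have "real M1 \<le> 2 * exp (real n * c1)"
      unfolding c1_def
      by (rule message_count_bound[OF M n P k1 pow g(1)])
         (rule order_trans[OF _ er], intro sum_mono le1)
    moreover have "real M2 \<le> 2 * exp (real n * c2)"
      unfolding c2_def
    proof (rule message_count_bound[OF M(2,1) n P k2 _ g(2)])
      have "tr_cov (\<lambda>m2 m1. f m1 m2) M2 M1 i = tr_cov f M1 M2 i" for i
        unfolding tr_cov_def Let_def by (subst (1 2) sum.swap) (simp add: mult.commute)
      then show "(\<Sum>i<n. tr_cov (\<lambda>m2 m1. f m1 m2) M2 M1 i) \<le> real n * P" using pow by simp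
      have "(\<Sum>m2<M2. \<Sum>m1<M1. measure ?\<Gamma>2 {z \<in> space ?\<Gamma>2. g2 (chan_out K (f m1 m2) n z) \<noteq> m2})
          \<le> (\<Sum>m2<M2. \<Sum>m1<M1. er m1 m2)" by (intro sum_mono le2)
      also have "\<dots> = (\<Sum>m1<M1. \<Sum>m2<M2. er m1 m2)" by (rule sum.swap)
      finally show "(\<Sum>m2<M2. \<Sum>m1<M1. measure ?\<Gamma>2 {z \<in> space ?\<Gamma>2. g2 (chan_out K (f m1 m2) n z) \<noteq> m2})
          \<le> real (M2 * M1) / 4" using er by (simp add: mult.commute)
    qed
    ultimately have "fst R \<le> c1 + 1" "snd R \<le> c2 + 1"
      using lim[OF n R1] lim[OF n R2] by auto
    then show "fst R \<le> max (c1 + 1) (c2 + 1) \<and> snd R \<le> max (c1 + 1) (c2 + 1)" by auto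
  qed
qed

section \<open>The weighted sum rate\<close>

text \<open>A closed half-plane is convex, so an inequality for the generating pairs survives convex
  hull and closure.\<close>

lemma weighted_closure_hull_le:
  fixes \<mu> c :: real
  assumes "\<And>x y. (x, y) \<in> S \<Longrightarrow> \<mu> * x + y \<le> c" and R: "R \<in> closure (convex hull S)"
  shows "\<mu> * fst R + snd R \<le> c"
proof -
  let ?H = "{R. \<mu> * fst R + snd R \<le> c}"
  have "convex ?H"
  proof (rule convexI)
    fix R Q and u v :: real assume *: "R \<in> ?H" "Q \<in> ?H" "0 \<le> u" "0 \<le> v" "u + v = 1"
    have "\<mu> * fst (u *\<^sub>R R + v *\<^sub>R Q) + snd (u *\<^sub>R R + v *\<^sub>R Q) = u * (\<mu> * fst R + snd R) + v * (\<mu> * fst Q + snd Q)"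
      by (simp add: algebra_simps)
    also have "\<dots> \<le> u * c + v * c" using * by (intro add_mono mult_left_mono) auto
    also have "\<dots> = c" using * by (simp add: distrib_right[symmetric])
    finally show "u *\<^sub>R R + v *\<^sub>R Q \<in> ?H" by simp
  qed
  moreover have "S \<subseteq> ?H" using assms(1) by auto
  ultimately have "convex hull S \<subseteq> ?H" by (rule hull_minimal[rotated])
  moreover have "closed ?H" by (intro closed_Collect_le continuous_intros)
  ultimately have "closure (convex hull S) \<subseteq> ?H" by (rule closure_minimal)
  then show ?thesis using R by auto
qed

lemma wmax_upper: "bdd_above ((\<lambda>R. \<mu> * fst R + snd R) ` S) \<Longrightarrow> R \<in> S \<Longrightarrow> \<mu> * fst R + snd R \<le> wmax \<mu> S"
  unfolding wmax_def by (rule cSUP_upper)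

lemma wmax_least: "S \<noteq> {} \<Longrightarrow> (\<And>R. R \<in> S \<Longrightarrow> \<mu> * fst R + snd R \<le> c) \<Longrightarrow> wmax \<mu> S \<le> c"
  unfolding wmax_def by (rule cSUP_least)

lemma Kbar_eq_bcol: "Kbar \<alpha> Hpp Hcp Hcc = bcol (Galpha \<alpha> Hpp Hcp) (Kalpha \<alpha> Hcc)"
  by (auto simp: Kbar_def bcol_def Galpha_def Kalpha_def bmat_def brow_def vec_eq_iff split: sum.split)

text \<open>Concavity between \<open>mat 1\<close>, where \<open>logdet\<close> is 0, and
  \<open>mat 1 + X\<close>: the tangent at the intermediate point is evaluated at both ends and
  averaged with weights \<open>1 - t\<close> and \<open>t\<close>.\<close>

lemma logdet_scaleR_ge:
  fixes X :: "complex^'n^'n"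
  assumes X: "psd X" and t: "0 \<le> t" "t \<le> 1"
  shows "t * logdet (mat 1 + X) \<le> logdet (mat 1 + t *\<^sub>R X)"
proof -
  define Y where "Y = mat 1 + t *\<^sub>R X"
  define Y' where "Y' = matrix_inv Y"
  have pY: "pdef Y" unfolding Y_def by (intro pdef_add_psd pdef_mat_1 psd_scaleR X t)
  have pX: "pdef (mat 1 + X)" by (intro pdef_add_psd pdef_mat_1 X)
  have a: "mat 1 + X - Y = (1 - t) *\<^sub>R X" and b: "mat 1 - Y = (- t) *\<^sub>R X"
    by (simp_all add: Y_def algebra_simps)
  have "logdet (mat 1 + X) \<le> logdet Y + (1 - t) * Re (trace (Y' ** X))"
    using logdet_tangent[OF pX pY] unfolding a Y'_def by (simp add: matrix_scaleR_right trace_scaleR)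
  then have 1: "t * logdet (mat 1 + X) \<le> t * (logdet Y + (1 - t) * Re (trace (Y' ** X)))"
    using t(1) by (rule mult_left_mono)
  have "0 \<le> logdet Y - t * Re (trace (Y' ** X))"
    using logdet_tangent[OF pdef_mat_1 pY] unfolding b Y'_def matrix_scaleR_right trace_scaleR by simp
  then have "0 \<le> (1 - t) * (logdet Y - t * Re (trace (Y' ** X)))"
    using t by simp
  with 1 show ?thesis unfolding Y_def[symmetric] by (simp add: algebra_simps)
qed

text \<open>Duality turns a dual point into covariances, but codes need strict slack. Power is
  released by scaling with \<open>t < 1\<close>, rates by subtracting \<open>d\<close>; both limits
  are then taken on the level of values.\<close>

theorem mac_rate_le_capacity:
  fixes G :: "complex^'t^'r" and K :: "complex^'t^'q"
  assumes \<mu>: "1 \<le> \<mu>" and P: "0 < P" and S: "psd S1" "psd S2" "Re (trace S1) + Re (trace S2) \<le> P"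
  shows "mac_rate \<mu> G K S1 S2 \<le> wmax \<mu> (bc_capacity_region G K P)"
proof -
  obtain c where c: "\<And>R. bc_achievable G K P R \<Longrightarrow> fst R \<le> c \<and> snd R \<le> c"
    using bc_achievable_bounded[OF P, of G K] by metis
  define A where "A = {R. 0 \<le> fst R \<and> 0 \<le> snd R \<and> bc_achievable G K P R}"
  have "A \<subseteq> {R. \<mu> * fst R + snd R \<le> \<mu> * c + c}"
  proof
    fix R assume "R \<in> A"
    then have "fst R \<le> c" "snd R \<le> c" using c by (auto simp: A_def)
    moreover have "\<mu> * fst R \<le> \<mu> * c" using \<mu> calculation by (intro mult_left_mono) auto
    ultimately show "R \<in> {R. \<mu> * fst R + snd R \<le> \<mu> * c + c}" by simp
  qed
  then have "closure A \<subseteq> {R. \<mu> * fst R + snd R \<le> \<mu> * c + c}"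
    by (rule closure_minimal) (intro closed_Collect_le continuous_intros)
  then have bdd: "bdd_above ((\<lambda>R. \<mu> * fst R + snd R) ` bc_capacity_region G K P)"
    unfolding bc_capacity_region_def A_def[symmetric] by (intro bdd_aboveI[of _ "\<mu> * c + c"]) auto
  let ?W = "wmax \<mu> (bc_capacity_region G K P)"
  have scaled: "t * mac_rate \<mu> G K S1 S2 \<le> ?W" if t: "0 \<le> t" "t < 1" for t
  proof -
    define X where "X = ctrans G ** S1 ** G"
    define Y where "Y = ctrans G ** S1 ** G + ctrans K ** S2 ** K"
    have pX: "psd X" "psd Y" unfolding X_def Y_def by (intro psd_add psd_congr' S)+
    have "mac_rate \<mu> G K S1 S2 = (\<mu> - 1) * logdet (mat 1 + X) + logdet (mat 1 + Y)"
      by (simp add: mac_rate_def X_def Y_def add.assoc)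
    then have "t * mac_rate \<mu> G K S1 S2 = (\<mu> - 1) * (t * logdet (mat 1 + X)) + t * logdet (mat 1 + Y)"
      by (simp add: distrib_left mult.left_commute)
    also have "\<dots> \<le> (\<mu> - 1) * logdet (mat 1 + t *\<^sub>R X) + logdet (mat 1 + t *\<^sub>R Y)"
      using \<mu> t by (intro add_mono mult_left_mono logdet_scaleR_ge pX) auto
    also have "\<dots> = mac_rate \<mu> G K (t *\<^sub>R S1) (t *\<^sub>R S2)"
      by (simp add: mac_rate_def X_def Y_def matrix_scaleR_left matrix_scaleR_right scaleR_right_distrib add.assoc)
    finally have le: "t * mac_rate \<mu> G K S1 S2 \<le> mac_rate \<mu> G K (t *\<^sub>R S1) (t *\<^sub>R S2)" .
    obtain Qp Qc :: "complex^'t^'t" where Q: "psd Qp" "psd Qc"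
      and tr: "Re (trace Qp) + Re (trace Qc) \<le> Re (trace (t *\<^sub>R S1)) + Re (trace (t *\<^sub>R S2))"
      and val: "\<mu> * (logdet (mat 1 + G ** (Qp + Qc) ** ctrans G) - logdet (mat 1 + G ** Qc ** ctrans G))
         + logdet (mat 1 + K ** Qc ** ctrans K) = mac_rate \<mu> G K (t *\<^sub>R S1) (t *\<^sub>R S2)"
      using mac_to_bc[OF psd_scaleR[OF S(1) t(1)] psd_scaleR[OF S(2) t(1)], of \<mu> G K] by metis
    define I1 where "I1 = logdet (mat 1 + G ** (Qp + Qc) ** ctrans G) - logdet (mat 1 + G ** Qc ** ctrans G)"
    define I2 where "I2 = logdet (mat 1 + K ** Qc ** ctrans K)"
    have "Re (trace Qp) + Re (trace Qc) \<le> t * (Re (trace S1) + Re (trace S2))"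
      using tr by (simp add: trace_scaleR algebra_simps)
    also have "\<dots> \<le> t * P" using S(3) t by (intro mult_left_mono) auto
    also have "\<dots> < P" using t P by simp
    finally have trP: "Re (trace Qp) + Re (trace Qc) < P" .
    have step: "\<mu> * I1 + I2 - (\<mu> + 1) * d \<le> ?W" if d: "0 < d" for d
    proof -
      \<comment> \<open>Truncation keeps the rates nonnegative when the margin \<open>d\<close>
        exceeds them, and rate 0 is achievable without a strict inequality.\<close>
      define R1 where "R1 = (if I1 \<le> d then 0 else I1 - d)"
      define R2 where "R2 = (if I2 \<le> d then 0 else I2 - d)"
      have R: "0 \<le> R1" "0 \<le> R2" "R1 = 0 \<or> R1 < I1" "R2 = 0 \<or> R2 < I2" "I1 - d \<le> R1" "I2 - d \<le> R2"
        using d by (auto simp: R1_def R2_def)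
      have "bc_achievable G K P (R1, R2)"
        using R by (intro dirty_paper_achievable[OF Q trP]) (auto simp: I1_def I2_def)
      then have "(R1, R2) \<in> bc_capacity_region G K P"
        unfolding bc_capacity_region_def using R by (intro subsetD[OF closure_subset]) simp
      from wmax_upper[OF bdd this] have "\<mu> * R1 + R2 \<le> ?W" by simp
      moreover have "\<mu> * (I1 - d) \<le> \<mu> * R1" using R \<mu> by (intro mult_left_mono) auto
      ultimately show ?thesis using R by (simp add: algebra_simps)
    qed
    have lim: "\<mu> * I1 + I2 \<le> ?W + (\<mu> + 1) * d" if "0 < d" for d using step[OF that] by linarith
    have "\<mu> * I1 + I2 \<le> ?W"
    proof (rule field_le_epsilon)
      fix e :: real assume "0 < e"
      then show "\<mu> * I1 + I2 \<le> ?W + e" using lim[of "e / (\<mu> + 1)"] \<mu> by simp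
    qed
    then show ?thesis using le val by (simp add: I1_def I2_def)
  qed
  show ?thesis
  proof (rule LIMSEQ_le_const2)
    show "(\<lambda>n. (1 - inverse (real (Suc n))) * mac_rate \<mu> G K S1 S2) \<longlonglongrightarrow> mac_rate \<mu> G K S1 S2"
      using tendsto_mult[OF tendsto_diff[OF tendsto_const LIMSEQ_inverse_real_of_nat] tendsto_const,
          of 1 "mac_rate \<mu> G K S1 S2"] by simp
    show "\<exists>N. \<forall>n\<ge>N. (1 - inverse (real (Suc n))) * mac_rate \<mu> G K S1 S2 \<le> ?W"
    proof (intro exI[of _ 0] allI impI scaled)
      fix n
      show "0 \<le> 1 - inverse (real (Suc n))" "1 - inverse (real (Suc n)) < 1" by (simp_all add: inverse_le_1_iff)
    qed
  qed
qed

definition out_pairs :: "complex^'t^'r \<Rightarrow> complex^'t^'s \<Rightarrow> complex^'s^'s \<Rightarrow> real \<Rightarrow> (real \<times> real) set" where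
  "out_pairs G K Z P = {(Rp, Rc). 0 \<le> Rp \<and> 0 \<le> Rc \<and> (\<exists>Qp Qc. psd Qp \<and> psd Qc \<and> Re (trace Qp) + Re (trace Qc) \<le> P \<and>
     Rp \<le> logdet (mat 1 + G ** (Qp + Qc) ** ctrans G) - logdet (mat 1 + G ** Qc ** ctrans G) \<and>
     Rc \<le> logdet (Z + K ** Qc ** ctrans K) - logdet Z)}"

lemma R_out_eq:
  "R_out Hpp Hcp Hcc Pp Pc \<alpha> Sz = closure (convex hull
     out_pairs (Galpha \<alpha> Hpp Hcp) (bcol (Galpha \<alpha> Hpp Hcp) (Kalpha \<alpha> Hcc)) Sz (Pp + \<alpha> * Pc))"
  by (simp add: R_out_def out_pairs_def Kbar_eq_bcol)

text \<open>\<open>bc_to_mac\<close> carries each generating pair to a dual point whose second power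
  is weighted by \<open>Z\<close>, the constraint under which the cooperative bound holds.\<close>

lemma out_pairs_le:
  fixes G :: "complex^'t^'r" and K :: "complex^'t^'s"
  assumes \<mu>: "0 \<le> \<mu>" and Z: "pdef Z"
    and le: "\<And>T1 T2. psd T1 \<Longrightarrow> psd T2 \<Longrightarrow> Re (trace T1) + Re (trace (Z ** T2)) \<le> P \<Longrightarrow> mac_rate \<mu> G K T1 T2 \<le> c"
    and R: "(x, y) \<in> out_pairs G K Z P"
  shows "\<mu> * x + y \<le> c"
proof -
  obtain Qp Qc :: "complex^'t^'t" where Q: "psd Qp" "psd Qc" "Re (trace Qp) + Re (trace Qc) \<le> P"
    and x: "x \<le> logdet (mat 1 + G ** (Qp + Qc) ** ctrans G) - logdet (mat 1 + G ** Qc ** ctrans G)"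
    and y: "y \<le> logdet (Z + K ** Qc ** ctrans K) - logdet Z"
    using R by (auto simp: out_pairs_def)
  obtain S1 :: "complex^'r^'r" and S2 :: "complex^'s^'s" where S: "psd S1" "psd S2"
    "Re (trace S1) + Re (trace (Z ** S2)) \<le> Re (trace Qp) + Re (trace Qc)"
    and val: "\<mu> * (logdet (mat 1 + G ** (Qp + Qc) ** ctrans G) - logdet (mat 1 + G ** Qc ** ctrans G))
       + (logdet (Z + K ** Qc ** ctrans K) - logdet Z) = mac_rate \<mu> G K S1 S2"
    using bc_to_mac[OF Q(1,2) Z, of \<mu> G K] by metis
  have "\<mu> * x + y \<le> mac_rate \<mu> G K S1 S2"
    unfolding val[symmetric] using x y \<mu> by (intro add_mono mult_left_mono) auto
  also have "\<dots> \<le> c" using S Q(3) by (intro le) auto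
  finally show ?thesis .
qed

text \<open>Continuity on the compact set of covariance pairs. It makes the supremum over
  \<open>R_out\<close> genuine for each admissible noise, so that passing to a larger region cannot
  lower \<open>wmax\<close>.\<close>

lemma out_pairs_bounded:
  fixes G :: "complex^'t^'r" and K :: "complex^'t^'s"
  assumes \<mu>: "0 \<le> \<mu>" and Z: "pdef Z"
  obtains c where "\<And>x y. (x, y) \<in> out_pairs G K Z P \<Longrightarrow> \<mu> * x + y \<le> c"
proof -
  let ?C = "{(A :: complex^'t^'t, B :: complex^'t^'t). psd A \<and> psd B \<and> Re (trace A) + Re (trace B) \<le> P}"
  define \<phi> where "\<phi> z = \<mu> * (logdet (mat 1 + G ** (fst z + snd z) ** ctrans G) - logdet (mat 1 + G ** snd z ** ctrans G))
      + (logdet (Z + K ** snd z ** ctrans K) - logdet Z)" for z :: "(complex^'t^'t) \<times> (complex^'t^'t)"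
  have "continuous_on ?C \<phi>"
    unfolding \<phi>_def
    by (intro continuous_intros continuous_on_logdet) (auto intro!: pdef_add_psd psd_congr psd_add Z)
  then have "bdd_above (\<phi> ` ?C)"
    by (intro bounded_imp_bdd_above compact_imp_bounded compact_continuous_image compact_psd_pairs)
  then obtain c where c: "\<And>z. z \<in> ?C \<Longrightarrow> \<phi> z \<le> c" unfolding bdd_above_def by auto
  show ?thesis
  proof (rule that[of c])
    fix x y assume "(x, y) \<in> out_pairs G K Z P"
    then obtain Qp Qc :: "complex^'t^'t" where Q: "psd Qp" "psd Qc" "Re (trace Qp) + Re (trace Qc) \<le> P"
      and x: "x \<le> logdet (mat 1 + G ** (Qp + Qc) ** ctrans G) - logdet (mat 1 + G ** Qc ** ctrans G)"
      and y: "y \<le> logdet (Z + K ** Qc ** ctrans K) - logdet Z"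
      by (auto simp: out_pairs_def)
    have "\<mu> * x + y \<le> \<phi> (Qp, Qc)"
      unfolding \<phi>_def fst_conv snd_conv using x y \<mu> by (intro add_mono mult_left_mono) auto
    also have "\<dots> \<le> c" using Q by (intro c) simp
    finally show "\<mu> * x + y \<le> c" .
  qed
qed

section \<open>Inclusion of \<open>R_part_out\<close> in \<open>R_out\<close>\<close>

definition block_lower :: "complex^'c^'c \<Rightarrow> complex^('p::finite+'c::finite)^('p+'c)" where
  "block_lower S = bmat 0 0 0 S"

lemma cquad_block_lower: "cquad (block_lower S) w = cquad S (lower w)"
  by (simp add: cquad_def block_lower_def bmat_def lower_def sum_UNIV_sum_type)

lemma psd_block_lower: "psd S \<Longrightarrow> psd (block_lower S)"
  by (simp add: psd_def cquad_block_lower)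

lemma trace_block_lower: "trace (block_lower S) = trace S"
  by (simp add: trace_def block_lower_def bmat_def sum_UNIV_sum_type)

lemma brow_block_lower:
  "brow A B ** block_lower S ** ctrans (brow A B) = B ** S ** ctrans B"
  by (simp add: vec_eq_iff matrix_matrix_mult_def brow_def ctrans_def block_lower_def bmat_def sum_UNIV_sum_type)

text \<open>Isometry onto the coordinates of the second receiver; its adjoint discards the first
  output. Since the lower diagonal block of an admissible matrix is the identity, the noise left
  over is white.\<close>

definition lower_embed :: "complex^'s^('r::finite+'s::finite)" where
  "lower_embed = (\<chi> r k. case r of Inl _ \<Rightarrow> 0 | Inr i \<Rightarrow> if i = k then 1 else 0)"

lemma lower_embed_bcol: "ctrans lower_embed ** bcol G K = K"
  by (simp add: vec_eq_iff matrix_matrix_mult_def ctrans_def lower_embed_def bcol_def sum_UNIV_sum_type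
      if_distrib[where f = cnj] mult_delta_left cong: if_cong)

lemma lower_embed_corr: "ctrans lower_embed ** bmat A B C D ** lower_embed = D"
  by (simp add: vec_eq_iff matrix_matrix_mult_def ctrans_def lower_embed_def bmat_def sum_UNIV_sum_type
      if_distrib[where f = cnj] mult_delta_left mult_delta_right cong: if_cong)

text \<open>Padding \<open>Scc\<close> by zeros makes the bounds on the first rate coincide and
  turns the second into that of a receiver with channel \<open>Kalpha\<close>.
  \<open>logdet_data_processing\<close> compares it with the joint receiver, whatever the noise
  correlation.\<close>

lemma R_part_out_subset_R_out:
  fixes Hpp :: "complex^'pt::finite^'pr::finite" and Hcp :: "complex^'ct::finite^'pr" and Hcc :: "complex^'ct^'cr::finite"
  assumes \<alpha>: "0 < \<alpha>" and Sz: "admissible_Sz Sz"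
  shows "R_part_out Hpp Hcp Hcc Pp Pc \<alpha> \<subseteq> R_out Hpp Hcp Hcc Pp Pc \<alpha> Sz"
  unfolding R_out_eq R_part_out_def
proof (intro closure_mono hull_mono subsetI)
  let ?G = "Galpha \<alpha> Hpp Hcp" and ?K = "Kalpha \<alpha> Hcc :: complex^('pt+'ct)^'cr"
  fix R assume "R \<in> {(Rp, Rc). 0 \<le> Rp \<and> 0 \<le> Rc \<and>
       (\<exists>(Qp :: complex^('pt+'ct)^('pt+'ct)) (Scc :: complex^'ct^'ct). psd Qp \<and> psd Scc \<and>
          Re (trace Qp) + Re (trace Scc) \<le> Pp + \<alpha> * Pc \<and>
          Rp \<le> logdet (mat 1 + ?G ** Qp ** ctrans ?G + (1 / \<alpha>) *\<^sub>R (Hcp ** Scc ** ctrans Hcp))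
               - logdet (mat 1 + (1 / \<alpha>) *\<^sub>R (Hcp ** Scc ** ctrans Hcp)) \<and>
          Rc \<le> logdet (mat 1 + (1 / \<alpha>) *\<^sub>R (Hcc ** Scc ** ctrans Hcc)))}"
  then obtain Rp Rc and Qp :: "complex^('pt+'ct)^('pt+'ct)" and S :: "complex^'ct^'ct" where R: "R = (Rp, Rc)" "0 \<le> Rp" "0 \<le> Rc"
    and Q: "psd Qp" "psd S" "Re (trace Qp) + Re (trace S) \<le> Pp + \<alpha> * Pc"
    and Rp: "Rp \<le> logdet (mat 1 + ?G ** Qp ** ctrans ?G + (1 / \<alpha>) *\<^sub>R (Hcp ** S ** ctrans Hcp))
               - logdet (mat 1 + (1 / \<alpha>) *\<^sub>R (Hcp ** S ** ctrans Hcp))"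
    and Rc: "Rc \<le> logdet (mat 1 + (1 / \<alpha>) *\<^sub>R (Hcc ** S ** ctrans Hcc))" by auto
  define Qc :: "complex^('pt+'ct)^('pt+'ct)" where "Qc = block_lower S"
  have Qc: "psd Qc" "trace Qc = trace S" using Q(2) by (simp_all add: Qc_def psd_block_lower trace_block_lower)
  have GQ: "?G ** Qc ** ctrans ?G = (1 / \<alpha>) *\<^sub>R (Hcp ** S ** ctrans Hcp)"
    unfolding Galpha_def Qc_def brow_block_lower
    using \<alpha> by (simp add: ctrans_scaleR matrix_scaleR_left matrix_scaleR_right)
  have KQ: "?K ** Qc ** ctrans ?K = (1 / \<alpha>) *\<^sub>R (Hcc ** S ** ctrans Hcc)"
    unfolding Kalpha_def Qc_def brow_block_lower
    using \<alpha> by (simp add: ctrans_scaleR matrix_scaleR_left matrix_scaleR_right)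
  have "Rp \<le> logdet (mat 1 + ?G ** (Qp + Qc) ** ctrans ?G) - logdet (mat 1 + ?G ** Qc ** ctrans ?G)"
    using Rp unfolding matrix_add_ldistrib matrix_add_rdistrib GQ by (simp add: add.assoc)
  moreover obtain Qz where pz: "pdef Sz" and Sz_eq: "Sz = bmat (mat 1) Qz (ctrans Qz) (mat 1)"
    using Sz by (auto simp: admissible_Sz_def)
  have "ctrans lower_embed ** Sz ** lower_embed = mat 1" unfolding Sz_eq by (rule lower_embed_corr)
  from logdet_data_processing[OF pz Qc(1) this, of "bcol ?G ?K"]
  have "logdet (mat 1 + ?K ** Qc ** ctrans ?K) \<le> logdet (Sz + bcol ?G ?K ** Qc ** ctrans (bcol ?G ?K)) - logdet Sz"
    unfolding lower_embed_bcol .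
  with Rc have "Rc \<le> logdet (Sz + bcol ?G ?K ** Qc ** ctrans (bcol ?G ?K)) - logdet Sz" unfolding KQ by linarith
  ultimately show "R \<in> out_pairs ?G (bcol ?G ?K) Sz (Pp + \<alpha> * Pc)"
    unfolding R(1) out_pairs_def using R(2,3) Q Qc by (intro CollectI case_prodI conjI exI[of _ Qp] exI[of _ Qc]) auto
qed

lemma zero_in_R_part_out:
  assumes "0 \<le> Pp + \<alpha> * Pc"
  shows "(0, 0) \<in> R_part_out Hpp Hcp Hcc Pp Pc \<alpha>"
  unfolding R_part_out_def
  by (intro subsetD[OF closure_subset] hull_inc) (use assms in \<open>auto intro!: exI[of _ 0] simp: trace_def\<close>)

lemma admissible_mat_1: "admissible_Sz (mat 1 :: complex^('r::finite+'s::finite)^('r+'s))"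
proof -
  have "(mat 1 :: complex^('r+'s)^('r+'s)) = bmat (mat 1) 0 (ctrans 0) (mat 1)"
    by (auto simp: vec_eq_iff mat_def bmat_def split: sum.split)
  then show ?thesis unfolding admissible_Sz_def using pdef_mat_1 by blast
qed

theorem theorem3:
  fixes Hpp :: "complex^'pt::finite^'pr::finite"
    and Hcp :: "complex^'ct::finite^'pr"
    and Hcc :: "complex^'ct^'cr::finite"
    and Pp Pc \<alpha> \<mu> :: real
  assumes "0 < Pp" and "0 < Pc" and "0 < \<alpha>" and "1 \<le> \<mu>"
    and "wmax \<mu> (R_part_out Hpp Hcp Hcc Pp Pc \<alpha>) = wmax \<mu> (C_BC Hpp Hcp Hcc Pp Pc \<alpha>)"
  shows "wmax \<mu> (R_part_out Hpp Hcp Hcc Pp Pc \<alpha>) =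
         (INF Sz\<in>{Sz :: complex^('pr+'cr)^('pr+'cr). admissible_Sz Sz}.
            wmax \<mu> (R_out Hpp Hcp Hcc Pp Pc \<alpha> Sz))"
proof -
  define P where "P = Pp + \<alpha> * Pc"
  have P: "0 < P" using assms(1-3) by (simp add: P_def add_pos_pos)
  define G where "G = Galpha \<alpha> Hpp Hcp"
  define K where "K = (Kalpha \<alpha> Hcc :: complex^('pt+'ct)^'cr)"
  let ?V = "wmax \<mu> (R_part_out Hpp Hcp Hcc Pp Pc \<alpha>)"
  let ?W = "\<lambda>Sz. wmax \<mu> (R_out Hpp Hcp Hcc Pp Pc \<alpha> Sz)"
  let ?A = "{Sz :: complex^('pr+'cr)^('pr+'cr). admissible_Sz Sz}"
  have Rout: "R_out Hpp Hcp Hcc Pp Pc \<alpha> Sz = closure (convex hull out_pairs G (bcol G K) Sz P)" for Sz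
    by (simp add: R_out_eq G_def K_def P_def)
  have ne: "(0, 0) \<in> R_part_out Hpp Hcp Hcc Pp Pc \<alpha>" using P by (intro zero_in_R_part_out) (simp add: P_def)
  \<comment> \<open>Monotonicity of suprema needs the larger set to be bounded, hence the constant
    \<open>c\<close> first.\<close>
  have ge: "?V \<le> ?W Sz" if Sz: "Sz \<in> ?A" for Sz
  proof -
    have pz: "pdef Sz" using Sz by (simp add: admissible_Sz_def)
    have \<mu>: "0 \<le> \<mu>" using assms(4) by simp
    obtain c where "\<And>x y. (x, y) \<in> out_pairs G (bcol G K) Sz P \<Longrightarrow> \<mu> * x + y \<le> c"
      using out_pairs_bounded[OF \<mu> pz, of G "bcol G K" P] by blast
    then have "bdd_above ((\<lambda>R. \<mu> * fst R + snd R) ` R_out Hpp Hcp Hcc Pp Pc \<alpha> Sz)"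
      unfolding Rout by (intro bdd_aboveI[of _ c]) (auto intro: weighted_closure_hull_le)
    moreover have "R_part_out Hpp Hcp Hcc Pp Pc \<alpha> \<subseteq> R_out Hpp Hcp Hcc Pp Pc \<alpha> Sz"
      using Sz by (intro R_part_out_subset_R_out assms(3)) simp
    ultimately show ?thesis
      unfolding wmax_def using ne by (intro cSUP_subset_mono) auto
  qed
  have A_ne: "?A \<noteq> {}" using admissible_mat_1 by blast
  have "?V \<le> (INF Sz\<in>?A. ?W Sz)" by (rule cINF_greatest[OF A_ne ge])
  moreover have "(INF Sz\<in>?A. ?W Sz) \<le> ?V"
  proof -
    obtain S1 :: "complex^'pr^'pr" and S2 :: "complex^'cr^'cr" where S: "psd S1" "psd S2" "Re (trace S1) + Re (trace S2) \<le> P"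
      and max: "\<And>T1 T2. psd T1 \<Longrightarrow> psd T2 \<Longrightarrow> Re (trace T1) + Re (trace T2) \<le> P \<Longrightarrow>
        mac_rate \<mu> G K T1 T2 \<le> mac_rate \<mu> G K S1 S2"
      using mac_rate_attains_max[OF less_imp_le[OF P], of \<mu> G K] by metis
    \<comment> \<open>The hypothesis enters here: the value of \<open>R_part_out\<close> is
      exchanged for that of the capacity region, which dominates the dual optimum.\<close>
    have cap: "mac_rate \<mu> G K S1 S2 \<le> ?V"
      using mac_rate_le_capacity[OF assms(4) P S, of G K] assms(5) by (simp add: C_BC_def G_def K_def P_def)
    \<comment> \<open>Each \<open>e\<close> supplies its own admissible matrix, whose value exceeds
      the dual optimum by at most \<open>e * P\<close>; the infimum absorbs the error.\<close>
    have "(INF Sz\<in>?A. ?W Sz) \<le> ?V + e * P" if e: "0 < e" for e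
    proof -
      obtain Q where Q: "pdef (bmat (mat 1) Q (ctrans Q) (mat 1))"
        and bd: "\<And>T1 T2. psd T1 \<Longrightarrow> psd T2 \<Longrightarrow>
          Re (trace T1) + Re (trace (bmat (mat 1) Q (ctrans Q) (mat 1) ** T2)) \<le> P \<Longrightarrow>
          mac_rate \<mu> G (bcol G K) T1 T2 \<le> mac_rate \<mu> G K S1 S2 + e * P"
        using mac_rate_cooperative_bound[OF assms(4) P e S max] by metis
      define Sz where "Sz = bmat (mat 1) Q (ctrans Q) (mat 1)"
      have Sz: "Sz \<in> ?A" using Q by (auto simp: admissible_Sz_def Sz_def)
      have \<mu>: "0 \<le> \<mu>" using assms(4) by simp
      have "(INF Sz\<in>?A. ?W Sz) \<le> ?W Sz"
        by (rule cINF_lower[OF bdd_belowI2[of _ ?V] Sz]) (rule ge)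
      also have "?W Sz \<le> mac_rate \<mu> G K S1 S2 + e * P"
      proof (rule wmax_least)
        show "R_out Hpp Hcp Hcc Pp Pc \<alpha> Sz \<noteq> {}" using ne R_part_out_subset_R_out[OF assms(3)] Sz by blast
        fix R assume "R \<in> R_out Hpp Hcp Hcc Pp Pc \<alpha> Sz"
        then show "\<mu> * fst R + snd R \<le> mac_rate \<mu> G K S1 S2 + e * P"
          unfolding Rout
          by (rule weighted_closure_hull_le[rotated])
             (rule out_pairs_le[OF \<mu> Q[folded Sz_def] bd[folded Sz_def]])
      qed
      finally show ?thesis using cap by linarith
    qed
    note lim = this
    show ?thesis
    proof (rule field_le_epsilon)
      fix e :: real assume "0 < e"
      then show "(INF Sz\<in>?A. ?W Sz) \<le> ?V + e" using lim[of "e / P"] P by simp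
    qed
  qed
  ultimately show ?thesis by (rule antisym)
qed

end
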